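(* For $(d,r)\in\{(-8,0),(-4,2)\}$ let $$F_{d,r}(\tau)=\frac{|d|^{5/2}}{4\pi^3}\sum_{Q\in\mathcal Q^{(2)}_{d,r}}Q(\tau,1)^{-3},$$ where $\mathcal Q^{(2)}_{d,r}$ is the set of binary quadratic forms $[a,b,c]$ with $a,b,c\in\mathbf Z$, $a>0$, $b^2-4ac=d$, $2\mid a$ and $b\equiv r\pmod 4$. Let $t(\tau)=(\eta(2\tau)/\eta(\tau))^{24}$, $J(\tau)=2E_2(2\tau)-E_2(\tau)$ and $$C_{6a}=\frac{t(5+1408t+20480t^2)}{9(1-64t)^3}\bigl(8J^3+E_6\bigr),\qquad C_{6b}=\frac{t(1-64t)}{9(1+64t)^2}\bigl(8J^3+E_6\bigr).$$ Then one has the exact identities of meromorphic functions on the upper half-plane $$F_{-8,0}=-64\,C_{6a},\qquad F_{-4,2}=32\,C_{6b}.$$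
   Context: $\tau$ is in the upper half-plane and $q=e^{2\pi i\tau}$. $\eta(\tau)=q^{1/24}\prod_{n\ge1}(1-q^n)$; $E_2=1-24\sum_{n\ge1}\sigma_1(n)q^n$, $E_6=1-504\sum_{n\ge1}\sigma_5(n)q^n$. A binary quadratic form $Q=[a,b,c]$ means $Q(x,y)=ax^2+bxy+cy^2$, so $Q(\tau,1)=a\tau^2+b\tau+c$. The functions $F_{d,r}$ are meromorphic modular forms of weight $6$ for $\Gamma_0(2)$ (they are the forms usually denoted $f_{3,d,r,1,1}$ at level $2$). *)

theory Defs
  imports
    "HOL-Complex_Analysis.Complex_Analysis"
    "HOL-Number_Theory.Number_Theory"
begin

definition upper_half_plane :: "complex set" where
  "upper_half_plane = {\<tau>. Im \<tau> > 0}"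

definition nome :: "complex \<Rightarrow> complex" where
  "nome \<tau> = exp (2 * of_real pi * \<i> * \<tau>)"

text \<open>The factor $q^{1/24}$ means $e^{2\pi i\tau/24}$, i.e. \<^term>\<open>nome (\<tau> / 24)\<close>,
  and not a principal root of $q$.\<close>

definition dedekind_eta :: "complex \<Rightarrow> complex" where
  "dedekind_eta \<tau> = nome (\<tau> / 24) * (\<Prod>n. 1 - nome \<tau> ^ Suc n)"

definition divisor_sigma :: "nat \<Rightarrow> nat \<Rightarrow> nat" where
  "divisor_sigma k n = (\<Sum>d | d dvd n. d ^ k)"

definition Eis2 :: "complex \<Rightarrow> complex" where
  "Eis2 \<tau> = 1 - 24 * (\<Sum>n. of_nat (divisor_sigma 1 (Suc n)) * nome \<tau> ^ Suc n)"

definition Eis6 :: "complex \<Rightarrow> complex" where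
  "Eis6 \<tau> = 1 - 504 * (\<Sum>n. of_nat (divisor_sigma 5 (Suc n)) * nome \<tau> ^ Suc n)"

definition qf_at :: "int \<times> int \<times> int \<Rightarrow> complex \<Rightarrow> complex" where
  "qf_at = (\<lambda>(a, b, c) \<tau>. of_int a * \<tau>\<^sup>2 + of_int b * \<tau> + of_int c)"

definition level2_forms :: "int \<Rightarrow> int \<Rightarrow> (int \<times> int \<times> int) set" where
  "level2_forms d r =
     {(a, b, c). a > 0 \<and> b\<^sup>2 - 4 * a * c = d \<and> 2 dvd a \<and> [b = r] (mod 4)}"

text \<open>At a zero of some \<^term>\<open>qf_at Q\<close>, a pole of the meromorphic function, the value of
  \<open>F_form\<close> is an artefact of \<open>inverse 0 = 0\<close>; likewise for \<open>C6a\<close> and \<open>C6b\<close> at the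
  zeros of their denominators.\<close>

definition F_form :: "int \<Rightarrow> int \<Rightarrow> complex \<Rightarrow> complex" where
  "F_form d r \<tau> =
     of_real (\<bar>real_of_int d\<bar> powr (5 / 2) / (4 * pi ^ 3)) *
     (\<Sum>\<^sub>\<infinity>Q\<in>level2_forms d r. inverse (qf_at Q \<tau> ^ 3))"

definition t_fun :: "complex \<Rightarrow> complex" where
  "t_fun \<tau> = (dedekind_eta (2 * \<tau>) / dedekind_eta \<tau>) ^ 24"

definition J_fun :: "complex \<Rightarrow> complex" where
  "J_fun \<tau> = 2 * Eis2 (2 * \<tau>) - Eis2 \<tau>"

definition C6a :: "complex \<Rightarrow> complex" where
  "C6a \<tau> = (t_fun \<tau> * (5 + 1408 * t_fun \<tau> + 20480 * t_fun \<tau> ^ 2)) /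
             (9 * (1 - 64 * t_fun \<tau>) ^ 3) * (8 * J_fun \<tau> ^ 3 + Eis6 \<tau>)"

definition C6b :: "complex \<Rightarrow> complex" where
  "C6b \<tau> = (t_fun \<tau> * (1 - 64 * t_fun \<tau>)) /
             (9 * (1 + 64 * t_fun \<tau>) ^ 2) * (8 * J_fun \<tau> ^ 3 + Eis6 \<tau>)"

definition form_roots :: "int \<Rightarrow> int \<Rightarrow> complex set" where
  "form_roots d r = {\<tau>. \<exists>Q\<in>level2_forms d r. qf_at Q \<tau> = 0}"

end

theory Submission
  imports Defs
begin

text \<open>
  The group generated by \<open>\<tau> \<mapsto> \<tau> + 1\<close> and the Fricke involution \<open>\<tau> \<mapsto> -1/(2\<tau>)\<close> has a single cusp. A
  function that is holomorphic on the upper half-plane, invariant under this group in absolute value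
  and zero at the cusp vanishes, by the maximum modulus principle. Applied to \<open>f\<^sup>4/\<Delta>\<^sup>k\<close>, where
  \<open>\<Delta>(\<tau>) = \<eta>(\<tau>)\<^sup>8\<eta>(2\<tau>)\<^sup>8\<close> has no zeros, this says that a form \<open>f\<close> of weight \<open>2k\<close> vanishes as soon as its
  order at the cusp exceeds \<open>k/4\<close>, so that identities can be read off from a few \<open>q\<close>-coefficients. The
  transformation of \<open>\<Delta>\<close> comes from that of \<open>E\<^sub>2\<close>, proved by Eisenstein's summation of a double series in
  both orders.

  Put \<open>a = \<eta>(\<tau>)\<^sup>1\<^sup>6/\<eta>(2\<tau>)\<^sup>8\<close>, \<open>b = t a\<close> and \<open>B = a - 64 b\<close>. Then \<open>J\<^sup>2 = a + 64 b\<close> and \<open>8J\<^sup>3 + E\<^sub>6 = 9 J a\<close>. The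
  sum over the forms has triple poles at the roots of the forms. By reduction of quadratic forms \<open>J\<close>
  (for discriminant -4) or \<open>B\<close> (for discriminant -8) vanishes at all of them, so multiplying by its
  cube gives holomorphic forms of weight 12 and 18, which are combinations of \<open>a b B\<close>, respectively of
  \<open>a b J\<^sup>5\<close> and \<open>a\<^sup>2 b\<^sup>2 J\<close>, by the vanishing criterion. The coefficients follow from the principal part at a
  single pole, \<open>(-1 + i)/2\<close> or \<open>i/\<surd>2\<close>; in the second case this needs three Taylor coefficients,
  which Ramanujan's differential equations for \<open>J\<close>, \<open>B\<close> and \<open>E = (E\<^sub>2(\<tau>) + 2E\<^sub>2(2\<tau>))/3\<close> provide. The resulting
  identities also show that \<open>J\<close> and \<open>B\<close> have no zeros other than the roots of the forms.
\<close>

section \<open>Lattice sums\<close>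

text \<open>No Fourier coefficient of the sums over forms is computed. Only their decay at the cusp
  enters, so their first coefficients remain unknowns: one of them for weight 12 and two for weight
  18, since order 2, respectively 3, at the cusp already forces a form to vanish. Relative to the
  factors (2 \<tau>^2)^k the sum over forms has sign +1 under the involution, whereas
  \<open>J_fun\<close> and the difference B have sign -1; this fixes the sign of the products and
  restricts the candidates. At the fixed point i/sqrt 2 the same symmetry empties the first-order
  comparison, which is why two unknowns cost three Taylor coefficients. The fourth power in the
  vanishing criterion balances weights, as \<Delta> has weight 8; and because only absolute values
  are compared, signs in the transformation laws do no harm there. At a root the sum takes a value
  that depends on \<open>inverse 0 = 0\<close>, so identities involving it are proved off the roots,
  and the cleared products are extended by limits.\<close>

lemma lattice_norm_lower_bound:
  fixes m n :: int and \<tau> :: complex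
  assumes "y0 > 0" "X \<ge> 0" "\<bar>Re \<tau>\<bar> \<le> X" "y0 \<le> Im \<tau>"
  shows "real_of_int (\<bar>m\<bar> + \<bar>n\<bar>) \<le> (1 + (X + 1) / y0) * cmod (of_int m * \<tau> + of_int n)"
proof -
  let ?z = "of_int m * \<tau> + of_int n"
  have im: "\<bar>real_of_int m\<bar> * y0 \<le> cmod ?z"
  proof -
    have "\<bar>real_of_int m\<bar> * y0 \<le> \<bar>real_of_int m\<bar> * Im \<tau>"
      using assms by (intro mult_left_mono) auto
    also have "\<dots> = \<bar>Im ?z\<bar>" using assms by (simp add: abs_mult)
    also have "\<dots> \<le> cmod ?z" by (rule abs_Im_le_cmod)
    finally show ?thesis .
  qed
  have "\<bar>real_of_int n\<bar> - \<bar>real_of_int m\<bar> * X \<le> \<bar>real_of_int n\<bar> - \<bar>real_of_int m\<bar> * \<bar>Re \<tau>\<bar>"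
    using assms by (intro diff_left_mono mult_left_mono) auto
  also have "\<dots> \<le> \<bar>Re ?z\<bar>" by (simp add: abs_mult [symmetric])
  also have "\<dots> \<le> cmod ?z" by (rule abs_Re_le_cmod)
  finally have re: "\<bar>real_of_int n\<bar> - \<bar>real_of_int m\<bar> * X \<le> cmod ?z" .
  have "\<bar>real_of_int m\<bar> * (X + 1) = (X + 1) / y0 * (\<bar>real_of_int m\<bar> * y0)"
    using assms by simp
  also have "\<dots> \<le> (X + 1) / y0 * cmod ?z"
    using assms by (intro mult_left_mono im) auto
  finally show ?thesis using re by (simp add: algebra_simps)
qed

lemma summable_on_int_powr:
  "(\<lambda>n::int. (1 + \<bar>real_of_int n\<bar>) powr (-3/2)) summable_on UNIV"
proof -
  have "summable (\<lambda>n. real n powr (-3/2))" by (simp add: summable_real_powr_iff)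
  then have s: "summable (\<lambda>n. (1 + real n) powr (-3/2))"
    by (subst (asm) summable_Suc_iff [symmetric]) simp
  then have *: "(\<lambda>n. (1 + real n) powr (-3/2)) summable_on UNIV"
    by (subst summable_on_UNIV_nonneg_real_iff) auto
  have 1: "(\<lambda>n::int. (1 + \<bar>real_of_int n\<bar>) powr (-3/2)) summable_on range int"
    by (subst summable_on_reindex) (use * in \<open>auto simp: o_def inj_on_def\<close>)
  have 2: "(\<lambda>n::int. (1 + \<bar>real_of_int n\<bar>) powr (-3/2)) summable_on range (\<lambda>n. - int n)"
    by (subst summable_on_reindex) (use * in \<open>auto simp: o_def inj_on_def\<close>)
  have "(UNIV :: int set) = range int \<union> range (\<lambda>n. - int n)"
  proof safe
    fix x :: int assume "x \<notin> range (\<lambda>n. - int n)"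
    then show "x \<in> range int" by (cases x rule: int_cases2) auto
  qed auto
  with summable_on_union[OF 1 2] show ?thesis by simp
qed

text \<open>From (1 + u)(1 + v) \<le> (1 + u + v)^2 the summand is at most (1 + u)^(-3/2) (1 +
  v)^(-3/2); the exponent 3/2 > 1 makes each factor summable on its own.\<close>

lemma summable_on_lattice:
  "(\<lambda>(m::int, n::int). inverse ((1 + \<bar>real_of_int m\<bar> + \<bar>real_of_int n\<bar>) ^ 3)) summable_on UNIV"
proof (rule summable_on_comparison_test)
  let ?f = "\<lambda>n::int. (1 + \<bar>real_of_int n\<bar>) powr (-3/2)"
  have "(\<lambda>(m, n). ?f m * ?f n) summable_on (SIGMA m:UNIV. UNIV)"
    by (rule summable_on_SigmaI[where g = "\<lambda>m. ?f m * infsum ?f UNIV"])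
       (use summable_on_int_powr in \<open>auto intro!: has_sum_cmult_right has_sum_infsum summable_on_cmult_left\<close>)
  then show "(\<lambda>(m, n). ?f m * ?f n) summable_on UNIV" by simp
  fix x :: "int \<times> int"
  obtain m n where x: "x = (m, n)" by force
  define u v where "u = \<bar>real_of_int m\<bar>" and "v = \<bar>real_of_int n\<bar>"
  have uv: "u \<ge> 0" "v \<ge> 0" by (auto simp: u_def v_def)
  have "((1 + u) * (1 + v)) powr (3/2) \<le> ((1 + u + v)\<^sup>2) powr (3/2)"
    using uv by (intro powr_mono2) (auto simp: power2_eq_square algebra_simps)
  also have "\<dots> = (1 + u + v) ^ 3"
    using uv by (simp add: powr_powr flip: powr_numeral)
  finally have "inverse ((1 + u + v) ^ 3) \<le> inverse (((1 + u) * (1 + v)) powr (3/2))"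
    using uv by (intro le_imp_inverse_le) auto
  also have "\<dots> = (1 + u) powr (-3/2) * (1 + v) powr (-3/2)"
    using uv by (simp add: powr_mult powr_minus)
  finally show "(case x of (m, n) \<Rightarrow> inverse ((1 + \<bar>real_of_int m\<bar> + \<bar>real_of_int n\<bar>) ^ 3))
       \<le> (case x of (m, n) \<Rightarrow> ?f m * ?f n)" by (simp add: x u_def v_def)
qed (auto simp: case_prod_unfold)

text \<open>The junk value \<open>inverse 0 = 0\<close> makes this bound valid at the origin as well.\<close>

lemma lattice_inverse_cube_bound:
  fixes m n :: int and \<tau> :: complex
  assumes "y0 > 0" "X \<ge> 0" "\<bar>Re \<tau>\<bar> \<le> X" "y0 \<le> Im \<tau>"
  shows "inverse (cmod (of_int m * \<tau> + of_int n) ^ 3)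
           \<le> (2 * (1 + (X + 1) / y0)) ^ 3 * inverse ((1 + \<bar>real_of_int m\<bar> + \<bar>real_of_int n\<bar>) ^ 3)"
proof (cases "m = 0 \<and> n = 0")
  case True
  then show ?thesis using assms by auto
next
  case False
  define K where "K = 1 + (X + 1) / y0"
  define c where "c = cmod (of_int m * \<tau> + of_int n)"
  have K: "K > 0" using assms by (auto simp: K_def intro!: add_pos_nonneg)
  have "1 + \<bar>real_of_int m\<bar> + \<bar>real_of_int n\<bar> \<le> 2 * real_of_int (\<bar>m\<bar> + \<bar>n\<bar>)"
    using False by auto
  also have "\<dots> \<le> 2 * (K * c)"
    unfolding K_def c_def using lattice_norm_lower_bound[OF assms] by (intro mult_left_mono) auto
  finally have le: "1 + \<bar>real_of_int m\<bar> + \<bar>real_of_int n\<bar> \<le> 2 * K * c" by simp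
  then have c: "c > 0" using K
    by (smt (verit, best) abs_ge_zero mult_nonneg_nonpos)
  have "(1 + \<bar>real_of_int m\<bar> + \<bar>real_of_int n\<bar>) ^ 3 \<le> (2 * K * c) ^ 3"
    by (intro power_mono le) auto
  then have "inverse ((2 * K * c) ^ 3) \<le> inverse ((1 + \<bar>real_of_int m\<bar> + \<bar>real_of_int n\<bar>) ^ 3)"
    by (intro le_imp_inverse_le) (auto intro!: zero_less_power)
  then have "(2 * K) ^ 3 * inverse ((2 * K * c) ^ 3)
      \<le> (2 * K) ^ 3 * inverse ((1 + \<bar>real_of_int m\<bar> + \<bar>real_of_int n\<bar>) ^ 3)"
    using K by (intro mult_left_mono) auto
  moreover have "(2 * K) ^ 3 * inverse ((2 * K * c) ^ 3) = inverse (c ^ 3)"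
    using K c by (simp add: power_mult_distrib field_simps)
  ultimately show ?thesis by (simp add: K_def c_def)
qed

lemma lattice_inverse_cube_summable:
  assumes "Im \<tau> > 0"
  shows "(\<lambda>(m::int, n::int). inverse (cmod (of_int m * \<tau> + of_int n) ^ 3)) summable_on UNIV"
proof (rule summable_on_comparison_test)
  let ?K = "(2 * (1 + (\<bar>Re \<tau>\<bar> + 1) / Im \<tau>)) ^ 3"
  show "(\<lambda>x. ?K * (case x of (m::int, n::int) \<Rightarrow>
      inverse ((1 + \<bar>real_of_int m\<bar> + \<bar>real_of_int n\<bar>) ^ 3))) summable_on UNIV"
    by (intro summable_on_cmult_right summable_on_lattice)
qed (use lattice_inverse_cube_bound[of "Im \<tau>" "\<bar>Re \<tau>\<bar>" \<tau>] assms in auto)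

lemma int_interval_filterlim:
  "filterlim (\<lambda>N. {- int N..<int N}) (finite_subsets_at_top (UNIV :: int set)) sequentially"
  unfolding filterlim_finite_subsets_at_top
proof safe
  fix X :: "int set" assume X: "finite X"
  show "\<forall>\<^sub>F N in sequentially. finite {- int N..<int N} \<and> X \<subseteq> {- int N..<int N} \<and> {- int N..<int N} \<subseteq> UNIV"
    using eventually_gt_at_top[of "Max (insert 0 ((\<lambda>x. nat \<bar>x\<bar>) ` X))"]
  proof eventually_elim
    case (elim N)
    have "\<bar>x\<bar> < int N" if "x \<in> X" for x
    proof -
      have "nat \<bar>x\<bar> \<le> Max (insert 0 ((\<lambda>x. nat \<bar>x\<bar>) ` X))" using X that by (intro Max_ge) auto
      with elim show ?thesis by linarith
    qed
    then show ?case by force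
  qed
qed

text \<open>Over half-open intervals from -N to N the partial sums collapse to
  \<open>f (- int N) - f (int N)\<close>. The two limits are kept apart because for the cotangent
  they differ, and their difference is the defect in the transformation law of
  \<open>Eis2\<close>.\<close>

lemma infsum_int_telescope:
  fixes f :: "int \<Rightarrow> complex"
  assumes "(\<lambda>n. f n - f (n + 1)) summable_on UNIV"
    and "(\<lambda>N. f (int N)) \<longlonglongrightarrow> l" and "(\<lambda>N. f (- int N)) \<longlonglongrightarrow> l'"
  shows "(\<Sum>\<^sub>\<infinity>n. f n - f (n + 1)) = l' - l"
proof -
  have "((\<lambda>n. f n - f (n + 1)) has_sum (\<Sum>\<^sub>\<infinity>n. f n - f (n + 1))) UNIV"
    using assms(1) by simp
  then have "(\<lambda>N. \<Sum>n\<in>{- int N..<int N}. f n - f (n + 1)) \<longlonglongrightarrow> (\<Sum>\<^sub>\<infinity>n. f n - f (n + 1))"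
    unfolding has_sum_def by (rule filterlim_compose[OF _ int_interval_filterlim])
  moreover have "(\<Sum>n\<in>{- int N..<int N}. f n - f (n + 1)) = f (- int N) - f (int N)" for N
  proof (induction N)
    case (Suc N)
    have "{- int (Suc N)..<int (Suc N)} = insert (- int N - 1) (insert (int N) {- int N..<int N})"
      by auto
    moreover have "f (- 1 - int N) = f (- int N - 1)" by (rule arg_cong[of _ _ f]) simp
    ultimately show ?case using Suc by (simp add: algebra_simps)
  qed auto
  ultimately have "(\<lambda>N. f (- int N) - f (int N)) \<longlonglongrightarrow> (\<Sum>\<^sub>\<infinity>n. f n - f (n + 1))" by simp
  moreover have "(\<lambda>N. f (- int N) - f (int N)) \<longlonglongrightarrow> l' - l" by (intro tendsto_diff assms)
  ultimately show ?thesis by (rule LIMSEQ_unique)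
qed

lemma infsum_int_split:
  fixes f :: "int \<Rightarrow> complex"
  assumes "f summable_on UNIV"
  shows "(\<Sum>\<^sub>\<infinity>n. f n) = f 0 + (\<Sum>\<^sub>\<infinity>n::nat. f (int (Suc n)) + f (- int (Suc n)))"
proof -
  have s: "f summable_on A" for A by (rule summable_on_subset_banach[OF assms]) auto
  have bij1: "bij_betw (\<lambda>n. int (Suc n)) UNIV {0<..}"
    by (rule bij_betwI[where g = "\<lambda>n. nat (n - 1)"]) auto
  have bij2: "bij_betw (\<lambda>n. - int (Suc n)) UNIV {..<0}"
    by (rule bij_betwI[where g = "\<lambda>n. nat (- n - 1)"]) auto
  have U: "UNIV = insert 0 ({0<..} \<union> {..<0::int})" by auto
  have "(\<Sum>\<^sub>\<infinity>n. f n) = f 0 + (infsum f {0<..} + infsum f {..<0})"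
    by (subst U, subst infsum_insert) (auto intro!: s infsum_Un_disjoint)
  also have "infsum f {0<..} = (\<Sum>\<^sub>\<infinity>n::nat. f (int (Suc n)))"
    by (rule infsum_reindex_bij_betw[OF bij1, symmetric])
  also have "infsum f {..<0} = (\<Sum>\<^sub>\<infinity>n::nat. f (- int (Suc n)))"
    by (rule infsum_reindex_bij_betw[OF bij2, symmetric])
  also have "(\<Sum>\<^sub>\<infinity>n::nat. f (int (Suc n))) + (\<Sum>\<^sub>\<infinity>n::nat. f (- int (Suc n)))
      = (\<Sum>\<^sub>\<infinity>n::nat. f (int (Suc n)) + f (- int (Suc n)))"
    using summable_on_reindex_bij_betw[OF bij1, of f] summable_on_reindex_bij_betw[OF bij2, of f] s
    by (intro infsum_add [symmetric]) auto
  finally show ?thesis .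
qed


section \<open>The Lipschitz formula\<close>

lemma nome_eq_0 [simp]: "nome z \<noteq> 0"
  by (simp add: nome_def)

lemma norm_nome: "cmod (nome z) = exp (- 2 * pi * Im z)"
  by (simp add: nome_def norm_exp_eq_Re)

lemma norm_nome_less_1: "Im z > 0 \<Longrightarrow> cmod (nome z) < 1"
  by (simp add: norm_nome)

lemma nome_add: "nome (w + z) = nome w * nome z"
  by (simp add: nome_def exp_add algebra_simps)

lemma nome_power: "nome z ^ n = nome (of_nat n * z)"
  by (simp add: nome_def exp_of_nat_mult [symmetric] algebra_simps)

lemma nome_int [simp]: "nome (of_int n) = 1"
  unfolding nome_def by (rule exp_eq_1 [THEN iffD2]) (auto simp: mult_ac)

lemma nome_1 [simp]: "nome 1 = 1"
  using nome_int[of 1] by simp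

lemma nome_plus_1 [simp]: "nome (z + 1) = nome z"
  by (simp add: nome_add)

lemma has_field_derivative_nome [derivative_intros]:
  "(f has_field_derivative f') (at z within A) \<Longrightarrow>
     ((\<lambda>z. nome (f z)) has_field_derivative 2 * of_real pi * \<i> * f' * nome (f z)) (at z within A)"
  unfolding nome_def by (auto intro!: derivative_eq_intros)

lemma holomorphic_on_nome [holomorphic_intros]:
  "f holomorphic_on A \<Longrightarrow> (\<lambda>z. nome (f z)) holomorphic_on A"
  unfolding nome_def by (intro holomorphic_intros)

text \<open>This is the polylogarithm of order -k plus the term at n = 0, which is 1 for k = 0 and 0
  otherwise. Up to a constant factor, it is what k differentiations of the q-expansion of the
  cotangent produce.\<close>

definition polylog_series :: "nat \<Rightarrow> complex \<Rightarrow> complex" where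
  "polylog_series k w = (\<Sum>n. of_nat n ^ k * w ^ n)"

lemma summable_polylog:
  fixes w :: "'a :: {real_normed_field, banach}"
  assumes "norm w < 1"
  shows "summable (\<lambda>n. of_nat n ^ k * w ^ n)"
  using assms
proof (induction k arbitrary: w)
  case 0
  then show ?case by (simp add: summable_geometric)
next
  case (Suc k)
  have "summable (\<lambda>n. diffs (\<lambda>n. of_nat n ^ k) n * w ^ n)"
    by (rule termdiff_converges[where K = 1]) (use Suc in auto)
  then have "summable (\<lambda>n. w * (of_nat (Suc n) ^ Suc k * w ^ n))"
    by (intro summable_mult) (simp add: diffs_def)
  then show ?case by (subst summable_Suc_iff [symmetric]) (simp add: mult_ac)
qed

text \<open>The operator w d/dw multiplies the n-th coefficient by n and so raises k by one;
  \<open>diffs\<close> is termwise differentiation.\<close>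

lemma polylog_series_Suc:
  assumes "cmod w < 1"
  shows "polylog_series (Suc k) w = w * (\<Sum>n. diffs (\<lambda>n. of_nat n ^ k) n * w ^ n)"
proof -
  have "polylog_series (Suc k) w = (\<Sum>n. of_nat (Suc n) ^ Suc k * w ^ Suc n)"
    unfolding polylog_series_def using summable_polylog[OF assms, of "Suc k"]
    by (subst suminf_split_head) auto
  also have "\<dots> = (\<Sum>n. w * (diffs (\<lambda>n. of_nat n ^ k) n * w ^ n))"
    by (simp add: diffs_def mult_ac)
  also have "\<dots> = w * (\<Sum>n. diffs (\<lambda>n. of_nat n ^ k) n * w ^ n)"
    by (rule suminf_mult) (rule termdiff_converges[where K = 1], use assms summable_polylog in auto)
  finally show ?thesis .
qed

lemma has_field_derivative_polylog_nome:
  assumes "Im z > 0"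
  shows "((\<lambda>z. polylog_series k (nome z)) has_field_derivative
           2 * of_real pi * \<i> * polylog_series (Suc k) (nome z)) (at z)"
proof -
  have "(polylog_series k has_field_derivative (\<Sum>n. diffs (\<lambda>n. of_nat n ^ k) n * nome z ^ n)) (at (nome z))"
    unfolding polylog_series_def
    by (rule termdiffs_strong_converges_everywhere[THEN DERIV_cong] termdiffs_strong'[where K = 1])
       (use assms norm_nome_less_1 in \<open>auto intro: summable_polylog\<close>)
  from DERIV_chain2[OF this has_field_derivative_nome[OF DERIV_ident]]
  show ?thesis
    using assms norm_nome_less_1[of z] by (simp add: polylog_series_Suc mult_ac)
qed

lemma polylog_series_0: "cmod w < 1 \<Longrightarrow> polylog_series 0 w = 1 / (1 - w)"
  by (simp add: polylog_series_def suminf_geometric)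

lemma nonreal_not_Int: "Im z \<noteq> 0 \<Longrightarrow> z \<notin> \<int>"
  by (auto elim!: Ints_cases)

lemma nonreal_not_nonpos_Int: "Im z \<noteq> 0 \<Longrightarrow> z \<notin> \<int>\<^sub>\<le>\<^sub>0"
  using nonpos_Ints_subset_Ints nonreal_not_Int by blast

lemma sin_pi_nonzero: "Im z \<noteq> 0 \<Longrightarrow> sin (of_real pi * z) \<noteq> (0::complex)"
proof
  assume z: "Im z \<noteq> 0" and "sin (of_real pi * z) = 0"
  then obtain n :: int where "of_real pi * z = of_real (of_int n * pi)"
    by (auto simp: sin_eq_0)
  then have "Im (of_real pi * z) = Im (of_real (of_int n * pi))" by simp
  with z show False by simp
qed

text \<open>Logarithmic differentiation of Gamma(z) Gamma(1 - z) = pi / sin(pi z).\<close>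

lemma Digamma_reflection_complex:
  fixes z :: complex
  assumes "Im z \<noteq> 0"
  shows "Digamma (1 - z) - Digamma z = of_real pi * cot (of_real pi * z)"
proof -
  let ?G = "\<lambda>z. Gamma z * Gamma (1 - z)" and ?s = "sin (of_real pi * z)"
  have s: "?s \<noteq> 0" using assms by (rule sin_pi_nonzero)
  have "(?G has_field_derivative ?G z * (Digamma z - Digamma (1 - z))) (at z)"
    using assms nonreal_not_nonpos_Int[of z] nonreal_not_nonpos_Int[of "1 - z"]
    by (auto intro!: derivative_eq_intros simp: algebra_simps)
  then have "((\<lambda>z. of_real pi / sin (of_real pi * z)) has_field_derivative
      (of_real pi / ?s) * (Digamma z - Digamma (1 - z))) (at z)"
    by (simp add: Gamma_reflection_complex)
  moreover have "((\<lambda>z. of_real pi / sin (of_real pi * z)) has_field_derivative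
      (of_real pi / ?s) * (- of_real pi * cot (of_real pi * z))) (at z)"
    using s by (auto intro!: derivative_eq_intros simp: cot_def power2_eq_square field_simps)
  ultimately have "(of_real pi / ?s) * (Digamma z - Digamma (1 - z))
      = (of_real pi / ?s) * (- of_real pi * cot (of_real pi * z))"
    by (rule DERIV_unique)
  moreover have "of_real pi / ?s \<noteq> 0" using s by simp
  ultimately have "Digamma z - Digamma (1 - z) = - of_real pi * cot (of_real pi * z)"
    by (metis mult_left_cancel)
  then show ?thesis by (metis minus_diff_eq minus_minus mult_minus_left)
qed

lemma pi_cot_eq_polylog:
  assumes "Im z > 0"
  shows "of_real pi * cot (of_real pi * z)
           = of_real pi * \<i> - 2 * of_real pi * \<i> * polylog_series 0 (nome z)"
proof -
  define w where "w = exp (\<i> * (of_real pi * z))"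
  have w: "w \<noteq> 0" "exp (- (\<i> * (of_real pi * z))) = 1 / w" "nome z = w ^ 2"
    by (simp_all add: w_def exp_minus field_simps nome_def power2_eq_square flip: exp_add)
  have w2: "w ^ 2 \<noteq> 1" using norm_nome_less_1[OF assms] w(3) by auto
  have aux: "(x / 2) / (y / (2 * \<i>)) = \<i> * x / y" for x y :: complex
    by (cases "y = 0") (simp_all add: divide_simps)
  have "cot (of_real pi * z) = ((w + 1 / w) / 2) / ((w - 1 / w) / (2 * \<i>))"
    unfolding cot_def sin_exp_eq cos_exp_eq w(2) w_def [symmetric] ..
  also have "\<dots> = \<i> * (w + 1 / w) / (w - 1 / w)"
    by (rule aux)
  also have "\<dots> = \<i> * (w ^ 2 + 1) / (w ^ 2 - 1)"
    using w(1) w2 by (simp add: field_simps power2_eq_square)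
  also have "\<dots> = \<i> - 2 * \<i> / (1 - w ^ 2)"
    using w2 by (simp add: field_simps)
  finally have "of_real pi * cot (of_real pi * z) = of_real pi * (\<i> - 2 * \<i> / (1 - w ^ 2))"
    by (rule arg_cong)
  also have "\<dots> = of_real pi * \<i> - 2 * of_real pi * \<i> * (1 / (1 - w ^ 2))"
    by (simp add: algebra_simps)
  finally show ?thesis
    using norm_nome_less_1[OF assms] by (simp add: polylog_series_0 w(3))
qed

text \<open>The case k = 0 is the reflection formula for the digamma function with the cotangent
  expanded in q. Each differentiation raises the order on both sides, the inner function 1 - z
  accounting for the sign (-1)^k, and the constant pi i disappears at the first one.\<close>

lemma Polygamma_reflection_upper:
  assumes "Im z > 0"
  shows "(-1) ^ k * Polygamma k (1 - z) - Polygamma k z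
    = (if k = 0 then of_real pi * \<i> else 0) - (2 * of_real pi * \<i>) ^ Suc k * polylog_series k (nome z)"
  using assms
proof (induction k arbitrary: z)
  case 0
  then show ?case by (simp add: Digamma_reflection_complex pi_cot_eq_polylog)
next
  case (Suc k)
  let ?L = "\<lambda>z. (-1) ^ k * Polygamma k (1 - z) - Polygamma k z"
  let ?R = "\<lambda>z. (if k = 0 then of_real pi * \<i> else 0)
                - (2 * of_real pi * \<i>) ^ Suc k * polylog_series k (nome z)"
  have "(?L has_field_derivative ((-1) ^ Suc k * Polygamma (Suc k) (1 - z) - Polygamma (Suc k) z)) (at z)"
    using Suc.prems nonreal_not_nonpos_Int[of z] nonreal_not_nonpos_Int[of "1 - z"]
    by (auto intro!: derivative_eq_intros)
  moreover have "(?R has_field_derivative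
      (0 - (2 * of_real pi * \<i>) ^ Suc k * (2 * of_real pi * \<i> * polylog_series (Suc k) (nome z)))) (at z)"
    by (intro derivative_intros DERIV_cmult has_field_derivative_polylog_nome Suc.prems)
  then have "(?L has_field_derivative
      (0 - (2 * of_real pi * \<i>) ^ Suc k * (2 * of_real pi * \<i> * polylog_series (Suc k) (nome z)))) (at z)"
    by (rule has_field_derivative_transform_within_open[where S = "{z. Im z > 0}"])
       (use Suc.IH Suc.prems in \<open>auto simp: open_halfspace_Im_gt\<close>)
  ultimately show ?case by (auto dest: DERIV_unique)
qed

lemma summable_on_int_inverse_power:
  assumes "Im z > 0" "p \<ge> 2"
  shows "(\<lambda>n::int. inverse ((z + of_int n) ^ p)) summable_on UNIV"
proof (rule abs_summable_summable, rule summable_on_comparison_test)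
  define K where "K = 1 + (\<bar>Re z\<bar> + 1) / Im z"
  have K: "K > 0" using assms by (auto simp: K_def intro!: add_pos_nonneg)
  show "(\<lambda>n::int. K ^ p * (1 + \<bar>real_of_int n\<bar>) powr (-3/2)) summable_on UNIV"
    by (intro summable_on_cmult_right summable_on_int_powr)
  fix n :: int
  have 1: "1 + \<bar>real_of_int n\<bar> \<le> K * cmod (z + of_int n)"
    using lattice_norm_lower_bound[of "Im z" "\<bar>Re z\<bar>" z 1 n] assms by (simp add: K_def)
  then have pos: "cmod (z + of_int n) > 0" using K
    by (smt (verit, best) abs_ge_zero mult_nonneg_nonpos)
  have "(1 + \<bar>real_of_int n\<bar>) powr (3/2) \<le> (1 + \<bar>real_of_int n\<bar>) powr real p"
    using assms by (intro powr_mono) auto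
  also have "\<dots> = (1 + \<bar>real_of_int n\<bar>) ^ p" by (simp add: powr_realpow)
  also have "\<dots> \<le> (K * cmod (z + of_int n)) ^ p" by (intro power_mono 1) auto
  finally have "inverse ((K * cmod (z + of_int n)) ^ p) \<le> inverse ((1 + \<bar>real_of_int n\<bar>) powr (3/2))"
    by (intro le_imp_inverse_le) auto
  then have "K ^ p * inverse ((K * cmod (z + of_int n)) ^ p) \<le> K ^ p * inverse ((1 + \<bar>real_of_int n\<bar>) powr (3/2))"
    using K by (intro mult_left_mono) auto
  moreover have "K ^ p * inverse ((K * cmod (z + of_int n)) ^ p) = norm (inverse ((z + of_int n) ^ p))"
    using K pos by (simp add: norm_inverse norm_divide norm_power power_mult_distrib field_simps)
  moreover have "inverse ((1 + \<bar>real_of_int n\<bar>) powr (3/2)) = (1 + \<bar>real_of_int n\<bar>) powr (-3/2)"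
    by (simp add: powr_minus)
  ultimately show "norm (inverse ((z + of_int n) ^ p)) \<le> K ^ p * (1 + \<bar>real_of_int n\<bar>) powr (-3/2)"
    by simp
qed auto

lemma infsum_nat_eq_suminf:
  fixes f :: "nat \<Rightarrow> complex"
  shows "f summable_on UNIV \<Longrightarrow> (\<Sum>\<^sub>\<infinity>n. f n) = (\<Sum>n. f n)"
  by (metis has_sum_imp_sums has_sum_infsum sums_unique)

text \<open>Cut at n = 0, the sum over the integers becomes two polygamma series, at z and at 1 - z,
  which the reflection formula combines. Odd k makes the exponent even, so the negative half can be
  rewritten in 1 - z without a sign.\<close>

theorem Lipschitz_formula:
  assumes "Im z > 0" "odd k"
  shows "(\<Sum>\<^sub>\<infinity>n::int. inverse ((z + of_int n) ^ Suc k))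
           = (2 * of_real pi * \<i>) ^ Suc k / fact k * polylog_series k (nome z)"
proof -
  let ?f = "\<lambda>n::int. inverse ((z + of_int n) ^ Suc k)"
  have k: "k \<noteq> 0" "even (Suc k)" using assms by (auto intro: Nat.gr0I)
  have s: "?f summable_on A" for A
    by (rule summable_on_subset_banach[OF summable_on_int_inverse_power])
       (use assms k in \<open>auto simp: Suc_le_eq\<close>)
  have bij1: "bij_betw int UNIV {0..}"
    by (rule bij_betwI[where g = nat]) auto
  have bij2: "bij_betw (\<lambda>n. - int (Suc n)) UNIV {..<0}"
    by (rule bij_betwI[where g = "\<lambda>n. nat (- n - 1)"]) auto
  have "infsum ?f UNIV = infsum ?f ({0..} \<union> {..<0})"
    by (rule arg_cong[of _ _ "infsum ?f"]) auto
  also have "\<dots> = infsum ?f {0..} + infsum ?f {..<0}"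
    by (intro infsum_Un_disjoint s) auto
  also have "infsum ?f {0..} = (\<Sum>\<^sub>\<infinity>n::nat. ?f (int n))"
    by (rule infsum_reindex_bij_betw[OF bij1, symmetric])
  also have "\<dots> = (\<Sum>n. ?f (int n))"
    using summable_on_reindex_bij_betw[OF bij1, of ?f] s by (intro infsum_nat_eq_suminf) auto
  also have "\<dots> = Polygamma k z / fact k"
    using k by (simp add: Polygamma_def)
  also have "infsum ?f {..<0} = (\<Sum>\<^sub>\<infinity>n::nat. ?f (- int (Suc n)))"
    by (rule infsum_reindex_bij_betw[OF bij2, symmetric])
  also have "\<dots> = (\<Sum>n. ?f (- int (Suc n)))"
    using summable_on_reindex_bij_betw[OF bij2, of ?f] s by (intro infsum_nat_eq_suminf) auto
  also have "(\<lambda>n. ?f (- int (Suc n))) = (\<lambda>n. inverse ((1 - z + of_nat n) ^ Suc k))"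
  proof
    fix n
    have "z + of_int (- int (Suc n)) = - (1 - z + of_nat n)" by simp
    then show "?f (- int (Suc n)) = inverse ((1 - z + of_nat n) ^ Suc k)"
      using k by (simp only: power_minus_even)
  qed
  also have "suminf \<dots> = Polygamma k (1 - z) / fact k"
    using k by (simp add: Polygamma_def)
  also have "Polygamma k z / fact k + Polygamma k (1 - z) / fact k
      = - ((-1) ^ k * Polygamma k (1 - z) - Polygamma k z) / fact k"
    using assms by (simp add: field_simps)
  also have "\<dots> = (2 * of_real pi * \<i>) ^ Suc k / fact k * polylog_series k (nome z)"
    using k by (subst Polygamma_reflection_upper[OF assms(1)]) simp
  finally show ?thesis .
qed

lemma cot_partial_fractions:
  assumes "Im z \<noteq> 0 \<or> z = 0"
  shows "(\<lambda>m. inverse (z + of_nat (Suc m)) + inverse (z - of_nat (Suc m)))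
           sums (of_real pi * cot (of_real pi * z) - inverse z)"
proof (cases "z = 0")
  case True
  have "(\<lambda>m. inverse (z + of_nat (Suc m)) + inverse (z - of_nat (Suc m))) = (\<lambda>_. 0)"
    by (rule ext) (simp add: True inverse_eq_divide del: of_nat_Suc)
  then show ?thesis by (simp add: True)
next
  case False
  with assms have z: "Im z \<noteq> 0" "z \<noteq> 0" "1 - z \<noteq> 0" by auto
  let ?l = "\<lambda>z m. of_real (ln (real m)) - (\<Sum>n<m. inverse (z + of_nat n))"
  have "(\<lambda>m. ?l (1 - z) m - ?l z m) \<longlonglongrightarrow> Digamma (1 - z) - Digamma z"
    using z by (intro tendsto_diff Digamma_LIMSEQ) auto
  moreover have "?l (1 - z) m - ?l z m
      = inverse z + (\<Sum>n<m. inverse (z + of_nat (Suc n)) + inverse (z - of_nat (Suc n)))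
        - inverse (z + of_nat m)" for m
  proof -
    have "(\<Sum>n<m. inverse (z + of_nat n)) + inverse (z + of_nat m)
        = inverse z + (\<Sum>n<m. inverse (z + of_nat (Suc n)))"
      using sum.lessThan_Suc_shift[of "\<lambda>n. inverse (z + of_nat n)" m]
      by (simp add: add.commute)
    moreover have "(\<Sum>n<m. inverse (1 - z + of_nat n)) = - (\<Sum>n<m. inverse (z - of_nat (Suc n)))"
      unfolding sum_negf [symmetric]
      by (intro sum.cong refl) (simp add: inverse_minus_eq [symmetric] del: inverse_minus_eq)
    ultimately show ?thesis by (simp add: sum.distrib algebra_simps)
  qed
  ultimately have 1: "(\<lambda>m. inverse z + (\<Sum>n<m. inverse (z + of_nat (Suc n)) + inverse (z - of_nat (Suc n)))
        - inverse (z + of_nat m)) \<longlonglongrightarrow> of_real pi * cot (of_real pi * z)"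
    using z by (simp add: Digamma_reflection_complex)
  have 2: "(\<lambda>m. inverse (z + of_nat m)) \<longlonglongrightarrow> 0"
    by (rule filterlim_compose[OF tendsto_inverse_0])
       (intro tendsto_add_filterlim_at_infinity[OF tendsto_const] tendsto_of_nat)
  from tendsto_diff[OF tendsto_add[OF 1 2] tendsto_const[of "inverse z"]]
  show ?thesis by (simp add: sums_def)
qed


section \<open>Lambert series and Eisenstein series\<close>

definition sigma_series :: "nat \<Rightarrow> complex \<Rightarrow> complex" where
  "sigma_series k \<tau> = (\<Sum>n. of_nat (divisor_sigma k (Suc n)) * nome \<tau> ^ Suc n)"

lemma Eis2_eq: "Eis2 \<tau> = 1 - 24 * sigma_series 1 \<tau>"
  by (simp add: Eis2_def sigma_series_def)

lemma Eis6_eq: "Eis6 \<tau> = 1 - 504 * sigma_series 5 \<tau>"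
  by (simp add: Eis6_def sigma_series_def)

lemma has_sum_Suc_iff:
  "((\<lambda>n. f (Suc n)) has_sum S) UNIV \<longleftrightarrow> (f has_sum S) {0<..}"
  by (rule has_sum_reindex_bij_betw) (rule bij_betwI[where g = "\<lambda>n. n - 1"], auto)

lemma has_sum_polylog:
  assumes "cmod w < 1" "k > 0"
  shows "((\<lambda>n. of_nat n ^ k * w ^ n) has_sum polylog_series k w) {0<..}"
proof -
  have "((\<lambda>n. of_nat n ^ k * w ^ n) has_sum polylog_series k w) UNIV"
    unfolding polylog_series_def
  proof (rule norm_summable_imp_has_sum)
    show "summable (\<lambda>n. norm (of_nat n ^ k * w ^ n))"
      using summable_polylog[of "norm w" k] assms by (simp add: norm_mult norm_power)
    show "(\<lambda>n. of_nat n ^ k * w ^ n) sums (\<Sum>n. of_nat n ^ k * w ^ n)"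
      using summable_polylog[of w k] assms by (simp add: summable_sums)
  qed
  then show ?thesis
    by (rule has_sum_cong_neutral[THEN iffD1, rotated -1]) (use assms in auto)
qed

text \<open>For positive m and r one has m r \<ge> (m - 1) + r, so the terms are dominated by a
  geometric series in m times a convergent series in r.\<close>

lemma summable_on_lambert:
  fixes w :: complex
  assumes "cmod w < 1"
  shows "(\<lambda>(m, r). of_nat r ^ k * w ^ (m * r)) summable_on {0<..} \<times> {0<..}"
proof (rule abs_summable_summable, rule summable_on_comparison_test)
  let ?f = "\<lambda>r::nat. real r ^ k * cmod w ^ r"
  have "?f summable_on UNIV"
    using summable_polylog[of "cmod w" k] assms by (subst summable_on_UNIV_nonneg_real_iff) auto
  then have 1: "?f summable_on {0<..}" by (rule summable_on_subset_banach) auto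
  have "summable (\<lambda>m. cmod w ^ (m - 1))"
    by (subst summable_Suc_iff [symmetric]) (use assms in \<open>simp add: summable_geometric\<close>)
  then have "(\<lambda>m. cmod w ^ (m - 1)) summable_on UNIV"
    by (subst summable_on_UNIV_nonneg_real_iff) auto
  then have 2: "(\<lambda>m. cmod w ^ (m - 1)) summable_on {0<..}" by (rule summable_on_subset_banach) auto
  show "(\<lambda>(m, r). cmod w ^ (m - 1) * ?f r) summable_on {0<..} \<times> {0<..}"
    by (rule summable_on_SigmaI[where g = "\<lambda>m. cmod w ^ (m - 1) * infsum ?f {0<..}"])
       (use 1 2 in \<open>auto intro!: has_sum_cmult_right has_sum_infsum summable_on_cmult_left\<close>)
  fix x :: "nat \<times> nat" assume "x \<in> {0<..} \<times> {0<..}"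
  then obtain m r where x: "x = (Suc m, Suc r)"
    by (metis SigmaE greaterThan_iff gr0_implies_Suc)
  have "cmod w ^ (Suc m * Suc r) \<le> cmod w ^ (m + Suc r)"
    using assms by (intro power_decreasing) auto
  then have "real (Suc r) ^ k * cmod w ^ (Suc m * Suc r) \<le> real (Suc r) ^ k * cmod w ^ (m + Suc r)"
    by (intro mult_left_mono) auto
  then show "norm (case x of (m, r) \<Rightarrow> of_nat r ^ k * w ^ (m * r))
      \<le> (case x of (m, r) \<Rightarrow> cmod w ^ (m - 1) * ?f r)"
    by (simp add: x norm_mult norm_power power_add mult_ac del: of_nat_Suc)
qed auto

text \<open>One absolutely convergent double sum of r^k q^(m r) is evaluated in three ways: over r
  for fixed m, as the rows of Eisenstein series produce it; over m for fixed r, as the logarithmic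
  derivative of the eta product produces it; and over the pairs with m r = n, which gives the
  divisor sums.\<close>

lemma lambert_series:
  assumes "Im \<tau> > 0" "k > 0"
  shows "((\<lambda>m. polylog_series k (nome \<tau> ^ Suc m)) has_sum sigma_series k \<tau>) UNIV"
    and "((\<lambda>r. of_nat r ^ k * (nome \<tau> ^ r / (1 - nome \<tau> ^ r))) has_sum sigma_series k \<tau>) {0<..}"
    and "summable (\<lambda>n. of_nat (divisor_sigma k (Suc n)) * nome \<tau> ^ Suc n)"
proof -
  let ?q = "nome \<tau>"
  have q: "cmod ?q < 1" using assms by (intro norm_nome_less_1)
  let ?f = "\<lambda>(m::nat, r::nat). of_nat r ^ k * ?q ^ (m * r)"
  obtain T where T: "(?f has_sum T) ({0<..} \<times> {0<..})"
    using summable_on_lambert[OF q] unfolding summable_on_def by blast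
  have 1: "((\<lambda>m. polylog_series k (?q ^ m)) has_sum T) {0<..}"
  proof (rule has_sum_SigmaD[OF T])
    fix m :: nat assume "m \<in> {0<..}"
    then have "cmod (?q ^ m) < 1" using q by (simp add: norm_power power_less_one_iff)
    from has_sum_polylog[OF this \<open>k > 0\<close>]
    show "((\<lambda>r. ?f (m, r)) has_sum polylog_series k (?q ^ m)) {0<..}"
      by (simp add: power_mult)
  qed
  have "((\<lambda>(n, d). of_nat d ^ k * ?q ^ n) has_sum T) (SIGMA n:{0<..}. {d. d dvd n})"
    using T
    by (rule has_sum_reindex_bij_witness[where i = "\<lambda>(n, d). (n div d, d)" and j = "\<lambda>(m, r). (m * r, r)",
          THEN iffD1, rotated -1]) (auto elim!: dvdE)
  then have 2: "((\<lambda>n. of_nat (divisor_sigma k n) * ?q ^ n) has_sum T) {0<..}"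
  proof (rule has_sum_SigmaD)
    fix n :: nat assume "n \<in> {0<..}"
    then show "((\<lambda>d. case (n, d) of (n, d) \<Rightarrow> of_nat d ^ k * ?q ^ n) has_sum
        of_nat (divisor_sigma k n) * ?q ^ n) {d. d dvd n}"
      by (intro has_sum_finiteI) (auto simp: divisor_sigma_def sum_distrib_right)
  qed
  then have 3: "(\<lambda>n. of_nat (divisor_sigma k (Suc n)) * ?q ^ Suc n) sums T"
    by (intro has_sum_imp_sums) (subst has_sum_Suc_iff)
  then show "summable (\<lambda>n. of_nat (divisor_sigma k (Suc n)) * ?q ^ Suc n)" by (rule sums_summable)
  from 3 have "T = sigma_series k \<tau>" by (simp add: sigma_series_def sums_unique)
  with 1 show "((\<lambda>m. polylog_series k (?q ^ Suc m)) has_sum sigma_series k \<tau>) UNIV"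
    by (subst has_sum_Suc_iff) simp
  have "((\<lambda>(r, m). ?f (m, r)) has_sum T) ({0<..} \<times> {0<..})"
    using T by (subst has_sum_swap) simp
  then have "((\<lambda>r. of_nat r ^ k * (?q ^ r / (1 - ?q ^ r))) has_sum T) {0<..}"
  proof (rule has_sum_SigmaD)
    fix r :: nat assume "r \<in> {0<..}"
    then have "cmod (?q ^ r) < 1" using q by (simp add: norm_power power_less_one_iff)
    from has_sum_geometric_from_1[OF this]
    have "((\<lambda>m. (?q ^ r) ^ m) has_sum (?q ^ r / (1 - ?q ^ r))) {0<..}"
      by (simp add: atLeast_Suc_greaterThan)
    from has_sum_cmult_right[OF this, of "of_nat r ^ k"]
    show "((\<lambda>m. case (r, m) of (r, m) \<Rightarrow> ?f (m, r)) has_sum of_nat r ^ k * (?q ^ r / (1 - ?q ^ r))) {0<..}"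
      by (simp add: mult.commute flip: power_mult)
  qed
  with \<open>T = sigma_series k \<tau>\<close>
  show "((\<lambda>r. of_nat r ^ k * (?q ^ r / (1 - ?q ^ r))) has_sum sigma_series k \<tau>) {0<..}" by simp
qed

lemma summable_on_int_inverse_power_0:
  assumes "p \<ge> 2"
  shows "(\<lambda>n::int. inverse (of_int n ^ p :: complex)) summable_on UNIV"
proof (rule abs_summable_summable, rule summable_on_comparison_test)
  show "(\<lambda>n::int. 2 ^ p * norm (inverse ((\<i> + of_int n) ^ p))) summable_on UNIV"
    using summable_on_int_inverse_power[of \<i> p] assms
    by (intro summable_on_cmult_right) (simp add: summable_on_iff_abs_summable_on_complex)
  fix n :: int
  show "norm (inverse (of_int n ^ p :: complex)) \<le> 2 ^ p * norm (inverse ((\<i> + of_int n) ^ p))"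
  proof (cases "n = 0")
    case False
    have "cmod (\<i> + of_int n) \<le> 1 + \<bar>real_of_int n\<bar>"
      using norm_triangle_ineq[of \<i> "of_int n"] by simp
    also have "\<dots> \<le> 2 * \<bar>real_of_int n\<bar>" using False by auto
    finally have "cmod (\<i> + of_int n) ^ p \<le> (2 * \<bar>real_of_int n\<bar>) ^ p" by (intro power_mono) auto
    moreover have "\<i> + of_int n \<noteq> 0" by (auto simp: complex_eq_iff)
    ultimately have "inverse ((2 * \<bar>real_of_int n\<bar>) ^ p) \<le> inverse (cmod (\<i> + of_int n) ^ p)"
      by (intro le_imp_inverse_le) auto
    then have "2 ^ p * inverse ((2 * \<bar>real_of_int n\<bar>) ^ p) \<le> 2 ^ p * inverse (cmod (\<i> + of_int n) ^ p)"
      by (intro mult_left_mono) auto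
    moreover have "2 ^ p * inverse ((2 * \<bar>real_of_int n\<bar>) ^ p) = norm (inverse (of_int n ^ p :: complex))"
      by (simp add: norm_inverse norm_power power_mult_distrib)
    ultimately show ?thesis by (simp only: norm_inverse norm_power)
  qed (use assms in \<open>auto simp: power_0_left\<close>)
qed auto

text \<open>One row of the lattice sum. At z = 0 the term n = 0 drops out through
  \<open>inverse 0 = 0\<close>, so for even p \<ge> 2 the value there is 2 zeta(p) and the row m = 0
  needs no separate treatment.\<close>

definition eisenstein_row :: "nat \<Rightarrow> complex \<Rightarrow> complex" where
  "eisenstein_row p z = (\<Sum>\<^sub>\<infinity>n::int. inverse ((z + of_int n) ^ p))"

lemma eisenstein_row_uminus:
  assumes "even p"
  shows "eisenstein_row p (- z) = eisenstein_row p z"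
  unfolding eisenstein_row_def
proof (rule infsum_reindex_bij_witness[where i = uminus and j = uminus])
  fix n :: int
  have "(z + of_int (- n)) ^ p = (- (- z + of_int n)) ^ p" by simp
  also have "\<dots> = (- z + of_int n) ^ p" using assms by (rule power_minus_even)
  finally show "inverse ((z + of_int (- n)) ^ p) = inverse ((- z + of_int n) ^ p)" by simp
qed auto

text \<open>For m > 0 the row is the Lipschitz sum at m \<tau>, a polylogarithm of q^m. The exponent
  being even, the rows m and -m agree, whence the factor 2, and the Lambert series adds them
  up.\<close>

lemma eisenstein_rows:
  assumes "Im \<tau> > 0" "odd k"
  shows "(\<lambda>m::int. eisenstein_row (Suc k) (of_int m * \<tau>)) summable_on UNIV"
    and "(\<Sum>\<^sub>\<infinity>m::int. eisenstein_row (Suc k) (of_int m * \<tau>)) = eisenstein_row (Suc k) 0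
           + 2 * (2 * of_real pi * \<i>) ^ Suc k / fact k * sigma_series k \<tau>"
proof -
  let ?R = "\<lambda>m::int. eisenstein_row (Suc k) (of_int m * \<tau>)"
  define c :: complex where "c = (2 * of_real pi * \<i>) ^ Suc k / fact k"
  have k: "k > 0" "even (Suc k)" using assms by (auto intro: Nat.gr0I)
  have even: "?R (- m) = ?R m" for m
    using eisenstein_row_uminus[OF k(2), of "of_int m * \<tau>"] by simp
  have pos: "?R (int (Suc m)) = c * polylog_series k (nome \<tau> ^ Suc m)" for m
    using Lipschitz_formula[of "of_nat (Suc m) * \<tau>" k] assms
    unfolding eisenstein_row_def c_def by (simp add: nome_power del: of_nat_Suc power_Suc)
  have sums: "((\<lambda>m. ?R (int (Suc m))) has_sum c * sigma_series k \<tau>) UNIV"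
    unfolding pos by (intro has_sum_cmult_right lambert_series assms k)
  have 1: "(?R has_sum c * sigma_series k \<tau>) {0<..}"
    using sums by (rule has_sum_reindex_bij_witness[where j = "\<lambda>m. int (Suc m)" and i = "\<lambda>n. nat (n - 1)",
          THEN iffD1, rotated -1]) auto
  have 2: "(?R has_sum c * sigma_series k \<tau>) {..<0}"
    using 1 by (rule has_sum_reindex_bij_witness[where j = uminus and i = uminus,
          THEN iffD1, rotated -1]) (use even in auto)
  have 3: "(?R has_sum (c * sigma_series k \<tau> + c * sigma_series k \<tau>)) ({0<..} \<union> {..<0})"
    using 1 2 by (rule has_sum_Un_disjoint) auto
  have "(?R has_sum (?R 0 + (c * sigma_series k \<tau> + c * sigma_series k \<tau>))) (insert 0 ({0<..} \<union> {..<0}))"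
    by (rule has_sum_insert[OF _ 3]) auto
  moreover have "insert 0 ({0<..} \<union> {..<0}) = (UNIV :: int set)" by auto
  ultimately have *: "(?R has_sum (?R 0 + 2 * (c * sigma_series k \<tau>))) UNIV" by simp
  then show "?R summable_on UNIV" by (rule has_sum_imp_summable)
  show "infsum ?R UNIV = eisenstein_row (Suc k) 0
           + 2 * (2 * of_real pi * \<i>) ^ Suc k / fact k * sigma_series k \<tau>"
    using infsumI[OF *] by (simp add: c_def)
qed

lemma Im_neg_inverse: "Im (- 1 / \<tau>) = Im \<tau> / cmod \<tau> ^ 2"
  by (simp add: Im_divide cmod_power2)

lemma lattice_inverse_power_summable:
  assumes "Im \<tau> > 0"
  shows "(\<lambda>(m::int, n::int). inverse ((of_int m * \<tau> + of_int n) ^ 6)) summable_on UNIV"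
proof (rule abs_summable_summable, rule summable_on_comparison_test)
  define K where "K = (2 * (1 + (\<bar>Re \<tau>\<bar> + 1) / Im \<tau>)) ^ 3"
  show "(\<lambda>x. K ^ 2 * (case x of (m::int, n::int) \<Rightarrow>
      inverse ((1 + \<bar>real_of_int m\<bar> + \<bar>real_of_int n\<bar>) ^ 3))) summable_on UNIV"
    by (intro summable_on_cmult_right summable_on_lattice)
  fix x :: "int \<times> int"
  obtain m n where x: "x = (m, n)" by force
  define c where "c = inverse ((1 + \<bar>real_of_int m\<bar> + \<bar>real_of_int n\<bar>) ^ 3)"
  have c: "0 \<le> c" "c \<le> 1" by (auto simp: c_def intro!: inverse_le_1_iff[THEN iffD2] one_le_power)
  have "norm (inverse ((of_int m * \<tau> + of_int n) ^ 6)) = inverse (cmod (of_int m * \<tau> + of_int n) ^ 3) ^ 2"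
    by (simp add: norm_inverse norm_power power_inverse flip: power_mult)
  also have "\<dots> \<le> (K * c) ^ 2"
    using lattice_inverse_cube_bound[of "Im \<tau>" "\<bar>Re \<tau>\<bar>" \<tau> m n] assms
    unfolding K_def c_def by (intro power_mono) auto
  also have "\<dots> \<le> K ^ 2 * c"
    unfolding power_mult_distrib using c
    by (intro mult_left_mono) (auto simp: power2_eq_square mult_left_le)
  finally show "norm (case x of (m, n) \<Rightarrow> inverse ((of_int m * \<tau> + of_int n) ^ 6))
      \<le> K ^ 2 * (case x of (m, n) \<Rightarrow> inverse ((1 + \<bar>real_of_int m\<bar> + \<bar>real_of_int n\<bar>) ^ 3))"
    by (simp add: x c_def)
qed auto

lemma lattice_sum_6_eq:
  assumes "Im \<tau> > 0"
  shows "(\<Sum>\<^sub>\<infinity>(m::int, n::int). inverse ((of_int m * \<tau> + of_int n) ^ 6))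
    = eisenstein_row 6 0 - 16 * of_real pi ^ 6 / 15 * sigma_series 5 \<tau>"
proof -
  have "(\<Sum>\<^sub>\<infinity>(m::int, n::int). inverse ((of_int m * \<tau> + of_int n) ^ 6))
      = (\<Sum>\<^sub>\<infinity>m::int. eisenstein_row 6 (of_int m * \<tau>))"
    using infsum_Sigma'_banach[of "\<lambda>m n::int. inverse ((of_int m * \<tau> + of_int n) ^ 6)" UNIV "\<lambda>_. UNIV"]
      lattice_inverse_power_summable[OF assms] by (simp add: eisenstein_row_def)
  also have "\<dots> = eisenstein_row 6 0
      + 2 * (2 * of_real pi * \<i>) ^ 6 / fact 5 * sigma_series 5 \<tau>"
    using eisenstein_rows(2)[OF assms, of 5] by simp
  also have "(2 * of_real pi * \<i>) ^ 6 = ((2 * of_real pi * \<i>) ^ 2) ^ 3"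
    by (simp only: power_mult [symmetric]) simp
  also have "\<dots> = - 64 * of_real pi ^ 6"
    by (simp add: power_mult_distrib flip: power_mult)
  also have "eisenstein_row 6 0 + 2 * (- 64 * of_real pi ^ 6) / fact 5 * sigma_series 5 \<tau>
      = eisenstein_row 6 0 - 16 * of_real pi ^ 6 / 15 * sigma_series 5 \<tau>"
    by (simp add: fact_numeral)
  finally show ?thesis .
qed

text \<open>The value \<open>c = 1\<close>, i.e. \<open>\<zeta>(6) = \<pi>\<^sup>6/945\<close>, is itself a consequence of modularity: it
  follows from the first \<open>q\<close>-coefficient in the proof of \<open>Eis6_eq_forms\<close>.\<close>

lemma Eis6_modular_up_to_constant:
  obtains c :: complex where
    "\<And>\<tau>. Im \<tau> > 0 \<Longrightarrow> c - 504 * sigma_series 5 (- 1 / \<tau>) = \<tau> ^ 6 * (c - 504 * sigma_series 5 \<tau>)"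
proof -
  \<comment> \<open>The factor is the reciprocal of 2 zeta(6), here chosen because 945/2 times 16/15
    is 504.\<close>
  define c :: complex where "c = 945 / (2 * of_real pi ^ 6) * eisenstein_row 6 0"
  let ?G = "\<lambda>\<tau>. \<Sum>\<^sub>\<infinity>(m::int, n::int). inverse ((of_int m * \<tau> + of_int n :: complex) ^ 6)"
  have eq: "c - 504 * sigma_series 5 \<tau> = 945 / (2 * of_real pi ^ 6) * ?G \<tau>" if "Im \<tau> > 0" for \<tau>
    unfolding lattice_sum_6_eq[OF that] c_def by (simp add: field_simps)
  show ?thesis
  proof (rule that[of c])
    fix \<tau> :: complex assume \<tau>: "Im \<tau> > 0"
    then have \<tau>0: "\<tau> \<noteq> 0" by auto
    then have \<tau>': "Im (- 1 / \<tau>) > 0" using \<tau> by (subst Im_neg_inverse) auto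
    have "?G (- 1 / \<tau>) = (\<Sum>\<^sub>\<infinity>(m::int, n::int). \<tau> ^ 6 * inverse ((of_int m * \<tau> + of_int n) ^ 6))"
    proof (rule infsum_reindex_bij_witness[where j = "\<lambda>(m, n). (n, - m)" and i = "\<lambda>(m, n). (- n, m)"])
      fix x :: "int \<times> int"
      obtain m n where x: "x = (m, n)" by force
      have "of_int m * (- 1 / \<tau>) + of_int n = (of_int n * \<tau> - of_int m) / \<tau>"
        using \<tau>0 by (simp add: field_simps)
      then show "(case case x of (m, n) \<Rightarrow> (n, - m) of (m, n) \<Rightarrow> \<tau> ^ 6 * inverse ((of_int m * \<tau> + of_int n) ^ 6))
          = (case x of (m, n) \<Rightarrow> inverse ((of_int m * (- 1 / \<tau>) + of_int n) ^ 6))"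
        using \<tau>0 by (simp add: x power_divide inverse_eq_divide)
    qed auto
    also have "\<dots> = (\<Sum>\<^sub>\<infinity>x. \<tau> ^ 6 * (case x of (m::int, n::int) \<Rightarrow> inverse ((of_int m * \<tau> + of_int n) ^ 6)))"
      by (simp add: case_prod_unfold)
    also have "\<dots> = \<tau> ^ 6 * ?G \<tau>"
      by (rule infsum_cmult_right) (rule lattice_inverse_power_summable[OF \<tau>])
    finally show "c - 504 * sigma_series 5 (- 1 / \<tau>) = \<tau> ^ 6 * (c - 504 * sigma_series 5 \<tau>)"
      unfolding eq[OF \<tau>] eq[OF \<tau>'] by simp
  qed
qed


section \<open>Quasimodularity of the Eisenstein series of weight two\<close>

lemma summable_on_int_inverse_power_nonreal:
  assumes "Im z \<noteq> 0" "p \<ge> 2"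
  shows "(\<lambda>n::int. inverse ((z + of_int n) ^ p)) summable_on UNIV"
proof (cases "Im z > 0")
  case False
  with assms have "Im (- z) > 0" by simp
  from summable_on_int_inverse_power[OF this assms(2)]
  have "(\<lambda>n::int. (-1) ^ p * inverse ((- z + of_int n) ^ p)) summable_on UNIV"
    by (rule summable_on_cmult_right)
  then show ?thesis
  proof (rule summable_on_reindex_bij_witness[where i = uminus and j = uminus, THEN iffD1, rotated -1])
    fix n :: int
    have "(z + of_int (- n)) ^ p = (- (- z + of_int n)) ^ p" by simp
    also have "\<dots> = (-1) ^ p * (- z + of_int n) ^ p" by (rule power_minus)
    finally show "inverse ((z + of_int (- n)) ^ p) = (-1) ^ p * inverse ((- z + of_int n) ^ p)"
      by (cases "even p") (simp_all add: inverse_eq_divide)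
  qed auto
qed (use assms summable_on_int_inverse_power in auto)

lemma infsum_int_sums_split:
  fixes f :: "int \<Rightarrow> complex"
  assumes "f summable_on UNIV"
  shows "(\<lambda>n. f (int (Suc n)) + f (- int (Suc n))) sums (infsum f UNIV - f 0)"
proof -
  have s: "f summable_on A" for A by (rule summable_on_subset_banach[OF assms]) auto
  have "(\<lambda>n. f (int (Suc n))) summable_on UNIV"
    using s[of "{0<..}"]
    by (rule summable_on_reindex_bij_witness[where i = "\<lambda>n. int (Suc n)" and j = "\<lambda>n. nat (n - 1)",
          THEN iffD1, rotated -1]) auto
  moreover have "(\<lambda>n. f (- int (Suc n))) summable_on UNIV"
    using s[of "{..<0}"]
    by (rule summable_on_reindex_bij_witness[where i = "\<lambda>n. - int (Suc n)" and j = "\<lambda>n. nat (- n - 1)",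
          THEN iffD1, rotated -1]) auto
  ultimately have sum: "(\<lambda>n. f (int (Suc n)) + f (- int (Suc n))) summable_on UNIV"
    by (rule summable_on_add)
  then have "summable (\<lambda>n. f (int (Suc n)) + f (- int (Suc n)))"
    by (rule summable_on_imp_summable)
  then show ?thesis
    using infsum_int_split[OF assms] infsum_nat_eq_suminf[OF sum] by (simp add: sums_iff)
qed

text \<open>\<open>1/z\<^sup>2\<close> minus the telescoping term \<open>1/z - 1/(z+1)\<close> is \<open>1/(z\<^sup>2(z+1))\<close>, so that the double sum
  converges absolutely and may be evaluated in both orders.\<close>

definition eis2_term :: "complex \<Rightarrow> int \<Rightarrow> int \<Rightarrow> complex" where
  "eis2_term \<tau> m n = (if m = 0 then 0 else inverse ((of_int m * \<tau> + of_int n)\<^sup>2)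
     - (inverse (of_int m * \<tau> + of_int n) - inverse (of_int m * \<tau> + of_int (n + 1))))"

text \<open>With z = m \<tau> + n the term equals 1/(z^2 (z + 1)), and the modulus of this
  denominator is at least the cube of the smaller of the two moduli.\<close>

lemma norm_eis2_term_le:
  assumes "Im \<tau> > 0"
  shows "norm (eis2_term \<tau> m n) \<le> inverse (cmod (of_int m * \<tau> + of_int n) ^ 3)
           + inverse (cmod (of_int m * \<tau> + of_int (n + 1)) ^ 3)"
proof (cases "m = 0")
  case False
  define z where "z = of_int m * \<tau> + of_int n"
  have "Im z \<noteq> 0" "Im (z + 1) \<noteq> 0" using assms False by (auto simp: z_def)
  then have z: "z \<noteq> 0" "z + 1 \<noteq> 0" by force+
  have "eis2_term \<tau> m n = inverse (z\<^sup>2) - (inverse z - inverse (z + 1))"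
    using False by (simp add: eis2_term_def z_def add.assoc)
  also have "inverse z - inverse (z + 1) = z * inverse (z\<^sup>2 * (z + 1))"
    using z by (simp add: divide_simps power2_eq_square)
  also have "inverse (z\<^sup>2) = (z + 1) * inverse (z\<^sup>2 * (z + 1))"
    using z by simp
  finally have eq: "eis2_term \<tau> m n = inverse (z\<^sup>2 * (z + 1))"
    by (simp add: ring_distribs)
  define x y where "x = cmod z" and "y = cmod (z + 1)"
  have xy: "x > 0" "y > 0" using z by (auto simp: x_def y_def)
  have "inverse (x\<^sup>2 * y) \<le> inverse (x ^ 3) + inverse (y ^ 3)"
  proof (cases "x \<le> y")
    case True
    then have "x ^ 3 \<le> x\<^sup>2 * y" using xy by (simp add: power3_eq_cube power2_eq_square)
    then have "inverse (x\<^sup>2 * y) \<le> inverse (x ^ 3)" using xy by (intro le_imp_inverse_le) auto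
    also have "\<dots> \<le> inverse (x ^ 3) + inverse (y ^ 3)" using xy by simp
    finally show ?thesis .
  next
    case False
    then have "y ^ 3 \<le> x\<^sup>2 * y" using xy by (simp add: power3_eq_cube power2_eq_square mult_mono)
    then have "inverse (x\<^sup>2 * y) \<le> inverse (y ^ 3)" using xy by (intro le_imp_inverse_le) auto
    also have "\<dots> \<le> inverse (x ^ 3) + inverse (y ^ 3)" using xy by simp
    finally show ?thesis .
  qed
  then show ?thesis
    by (simp add: eq norm_inverse norm_mult norm_power x_def y_def z_def add.assoc)
qed (simp add: eis2_term_def)

lemma summable_eis2_term:
  assumes "Im \<tau> > 0"
  shows "(\<lambda>(m, n). eis2_term \<tau> m n) summable_on UNIV \<times> UNIV"
proof (rule abs_summable_summable, rule summable_on_comparison_test)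
  let ?c = "\<lambda>(m::int, n::int). inverse (cmod (of_int m * \<tau> + of_int n) ^ 3)"
  have 1: "?c summable_on UNIV \<times> UNIV"
    using lattice_inverse_cube_summable[OF assms] by simp
  then have 2: "(\<lambda>(m, n). ?c (m, n + 1)) summable_on UNIV \<times> UNIV"
    by (rule summable_on_reindex_bij_witness[where i = "\<lambda>(m, n). (m, n + 1)" and j = "\<lambda>(m, n). (m, n - 1)",
          THEN iffD1, rotated -1]) auto
  show "(\<lambda>x. ?c x + (\<lambda>(m, n). ?c (m, n + 1)) x) summable_on UNIV \<times> UNIV"
    by (rule summable_on_add[OF 1 2])
qed (use norm_eis2_term_le[OF assms] in auto)

lemma inverse_of_nat_shift_tendsto_0:
  "(\<lambda>N. inverse (z + of_nat N :: complex)) \<longlonglongrightarrow> 0" "(\<lambda>N. inverse (z - of_nat N :: complex)) \<longlonglongrightarrow> 0"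
proof -
  show *: "(\<lambda>N. inverse (z + of_nat N :: complex)) \<longlonglongrightarrow> 0" for z
    by (rule filterlim_compose[OF tendsto_inverse_0])
       (intro tendsto_add_filterlim_at_infinity[OF tendsto_const] tendsto_of_nat)
  have "(\<lambda>N. - inverse (- z + of_nat N :: complex)) \<longlonglongrightarrow> - 0" by (intro tendsto_minus *)
  moreover have "- inverse (- z + of_nat N :: complex) = inverse (z - of_nat N)" for N
    by (subst inverse_minus_eq [symmetric]) simp
  ultimately show "(\<lambda>N. inverse (z - of_nat N :: complex)) \<longlonglongrightarrow> 0" by simp
qed

text \<open>In a row the telescoping correction has limit 0 at both ends and sums to 0, so summation
  by rows sees only the inverse squares.\<close>

lemma infsum_eis2_term_row:
  assumes "Im \<tau> > 0" "m \<noteq> 0"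
  shows "(\<Sum>\<^sub>\<infinity>n. eis2_term \<tau> m n) = eisenstein_row 2 (of_int m * \<tau>)"
proof -
  let ?z = "of_int m * \<tau>"
  have 1: "(\<lambda>n::int. inverse ((?z + of_int n)\<^sup>2)) summable_on UNIV"
    by (rule summable_on_int_inverse_power_nonreal) (use assms in auto)
  have 2: "eis2_term \<tau> m summable_on UNIV"
    using summable_on_SigmaD1[OF summable_eis2_term[OF assms(1)], of m] by simp
  let ?f = "\<lambda>n. inverse (?z + of_int n)"
  have eq: "eis2_term \<tau> m n = inverse ((?z + of_int n)\<^sup>2) - (?f n - ?f (n + 1))" for n
    using assms by (simp add: eis2_term_def)
  have "(\<lambda>n. inverse ((?z + of_int n)\<^sup>2) + - eis2_term \<tau> m n) summable_on UNIV"
    by (intro summable_on_add 1 summable_on_uminus[THEN iffD2] 2)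
  then have 3: "(\<lambda>n. ?f n - ?f (n + 1)) summable_on UNIV" by (simp add: eq)
  then have 4: "(\<Sum>\<^sub>\<infinity>n. ?f n - ?f (n + 1)) = 0 - 0"
    by (rule infsum_int_telescope[where f = ?f])
       (use inverse_of_nat_shift_tendsto_0[of ?z] in auto)
  have "(\<Sum>\<^sub>\<infinity>n. inverse ((?z + of_int n)\<^sup>2)) = (\<Sum>\<^sub>\<infinity>n. eis2_term \<tau> m n + (?f n - ?f (n + 1)))"
    by (simp add: eq)
  also have "\<dots> = (\<Sum>\<^sub>\<infinity>n. eis2_term \<tau> m n) + 0"
    by (simp only: infsum_add[OF 2 3] 4 diff_self)
  finally show ?thesis by (simp add: eisenstein_row_def)
qed

text \<open>For nonreal z and for z = 0 this is the symmetric sum of 1/(z + m) over the integers m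
  other than 0. The omitted term corresponds to the row m = 0, which \<open>eis2_term\<close> leaves
  out.\<close>

definition shifted_cot :: "complex \<Rightarrow> complex" where
  "shifted_cot z = of_real pi * cot (of_real pi * z) - inverse z"

lemma shifted_cot_uminus: "shifted_cot (- z) = - shifted_cot z"
  by (simp add: shifted_cot_def cot_def)

text \<open>Since q^N tends to 0, the cotangent tends to -i in the direction of the cusp. This
  nonzero limit is the source of the non-modular part of \<open>Eis2\<close>.\<close>

lemma shifted_cot_tendsto:
  assumes "Im z > 0"
  shows "(\<lambda>N. shifted_cot (of_nat N * z)) \<longlonglongrightarrow> - of_real pi * \<i>"
proof -
  have q: "cmod (nome z) < 1" using assms by (rule norm_nome_less_1)
  have "(\<lambda>N. nome z ^ N) \<longlonglongrightarrow> 0" using q by (rule LIMSEQ_power_zero)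
  moreover have "(\<lambda>N. inverse (of_nat N) * inverse z) \<longlonglongrightarrow> 0 * inverse z"
    by (intro tendsto_mult tendsto_const lim_inverse_n)
  ultimately have "(\<lambda>N. of_real pi * \<i> - 2 * of_real pi * \<i> * (1 / (1 - nome z ^ N))
       - inverse (of_nat N) * inverse z)
     \<longlonglongrightarrow> of_real pi * \<i> - 2 * of_real pi * \<i> * (1 / (1 - 0)) - 0 * inverse z"
    by (intro tendsto_diff tendsto_mult tendsto_divide tendsto_const lim_inverse_n) auto
  then have "(\<lambda>N. of_real pi * \<i> - 2 * of_real pi * \<i> * (1 / (1 - nome z ^ N))
       - inverse (of_nat N) * inverse z) \<longlonglongrightarrow> - of_real pi * \<i>" by (simp add: mult.commute)
  then show ?thesis
  proof (rule Lim_transform_eventually)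
    show "\<forall>\<^sub>F N in sequentially. of_real pi * \<i> - 2 * of_real pi * \<i> * (1 / (1 - nome z ^ N))
       - inverse (of_nat N) * inverse z = shifted_cot (of_nat N * z)"
      using eventually_gt_at_top[of 0]
    proof eventually_elim
      case (elim N)
      then have "Im (of_nat N * z) > 0" using assms by simp
      from pi_cot_eq_polylog[OF this] show ?case
        using norm_nome_less_1[OF \<open>Im (of_nat N * z) > 0\<close>]
        by (simp add: shifted_cot_def polylog_series_0 nome_power)
    qed
  qed
qed

text \<open>Writing m \<tau> + n = \<tau> (w + m) with w = n/\<tau> turns a column into a row for w.
  The term m = 0 is absent: it is subtracted from the inverse squares, and it is why
  \<open>shifted_cot\<close> appears in place of the full cotangent.\<close>

lemma infsum_eis2_term_column:
  assumes "Im \<tau> > 0"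
  shows "(\<Sum>\<^sub>\<infinity>m. eis2_term \<tau> m n)
    = (eisenstein_row 2 (of_int n / \<tau>) - inverse ((of_int n / \<tau>)\<^sup>2)) / \<tau>\<^sup>2
      - (shifted_cot (of_int n / \<tau>) / \<tau> - shifted_cot (of_int (n + 1) / \<tau>) / \<tau>)"
proof -
  have \<tau>: "\<tau> \<noteq> 0" using assms by auto
  define w where "w = (\<lambda>n::int. of_int n / \<tau>)"
  have w: "Im (w n) \<noteq> 0 \<or> w n = 0" for n
  proof -
    have "Im (w n) = - of_int n * (Im \<tau> / cmod \<tau> ^ 2)"
      by (simp add: w_def Im_divide cmod_power2)
    then show ?thesis using assms \<tau> by (auto simp: w_def)
  qed
  have plus: "of_int (int (Suc M)) * \<tau> + of_int n = \<tau> * (w n + of_nat (Suc M))" for M n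
    using \<tau> by (simp add: w_def field_simps)
  have minus: "of_int (- int (Suc M)) * \<tau> + of_int n = \<tau> * (w n - of_nat (Suc M))" for M n
    using \<tau> by (simp add: w_def field_simps)
  have "(\<lambda>(n, m). eis2_term \<tau> m n) summable_on UNIV \<times> UNIV"
    using summable_on_swap[of "\<lambda>(m, n). eis2_term \<tau> m n" UNIV UNIV] summable_eis2_term[OF assms]
    by simp
  then have "(\<lambda>m. eis2_term \<tau> m n) summable_on UNIV"
    using summable_on_SigmaD1[of "\<lambda>n m. eis2_term \<tau> m n" UNIV "\<lambda>_. UNIV" n] by simp
  from infsum_int_sums_split[OF this]
  have L: "(\<lambda>M. eis2_term \<tau> (int (Suc M)) n + eis2_term \<tau> (- int (Suc M)) n) sums (\<Sum>\<^sub>\<infinity>m. eis2_term \<tau> m n)"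
    by (simp add: eis2_term_def)
  have "(\<lambda>k::int. inverse ((w n + of_int k)\<^sup>2)) summable_on UNIV"
    using w[of n] summable_on_int_inverse_power_nonreal[of "w n" 2] summable_on_int_inverse_power_0[of 2]
    by auto
  from infsum_int_sums_split[OF this]
  have S1: "(\<lambda>M. inverse ((w n + of_nat (Suc M))\<^sup>2) + inverse ((w n - of_nat (Suc M))\<^sup>2))
      sums (eisenstein_row 2 (w n) - inverse ((w n)\<^sup>2))"
    unfolding eisenstein_row_def
    by (simp only: of_int_minus of_int_of_nat_eq add_uminus_conv_diff of_int_0 add_0_right)
  have S2: "(\<lambda>M. inverse (w n + of_nat (Suc M)) + inverse (w n - of_nat (Suc M))) sums shifted_cot (w n)" for n
    unfolding shifted_cot_def by (rule cot_partial_fractions) (rule w)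
  have "(\<lambda>M. (inverse ((w n + of_nat (Suc M))\<^sup>2) + inverse ((w n - of_nat (Suc M))\<^sup>2)) / \<tau>\<^sup>2
      - ((inverse (w n + of_nat (Suc M)) + inverse (w n - of_nat (Suc M))) / \<tau>
         - (inverse (w (n + 1) + of_nat (Suc M)) + inverse (w (n + 1) - of_nat (Suc M))) / \<tau>))
      sums ((eisenstein_row 2 (w n) - inverse ((w n)\<^sup>2)) / \<tau>\<^sup>2
        - (shifted_cot (w n) / \<tau> - shifted_cot (w (n + 1)) / \<tau>))"
    by (intro sums_diff sums_divide S1 S2)
  moreover have "(inverse ((w n + of_nat (Suc M))\<^sup>2) + inverse ((w n - of_nat (Suc M))\<^sup>2)) / \<tau>\<^sup>2
      - ((inverse (w n + of_nat (Suc M)) + inverse (w n - of_nat (Suc M))) / \<tau>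
         - (inverse (w (n + 1) + of_nat (Suc M)) + inverse (w (n + 1) - of_nat (Suc M))) / \<tau>)
      = eis2_term \<tau> (int (Suc M)) n + eis2_term \<tau> (- int (Suc M)) n" for M
  proof -
    have nz: "int (Suc M) \<noteq> 0" "- int (Suc M) \<noteq> 0" by simp_all
    show ?thesis
      unfolding eis2_term_def if_not_P[OF nz(1)] if_not_P[OF nz(2)] plus minus
        power_mult_distrib inverse_mult_distrib
      by (simp add: divide_inverse algebra_simps)
  qed
  ultimately have "(\<lambda>M. eis2_term \<tau> (int (Suc M)) n + eis2_term \<tau> (- int (Suc M)) n)
      sums ((eisenstein_row 2 (w n) - inverse ((w n)\<^sup>2)) / \<tau>\<^sup>2
        - (shifted_cot (w n) / \<tau> - shifted_cot (w (n + 1)) / \<tau>))"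
    by (simp only:)
  from sums_unique2[OF L this] show ?thesis by (simp add: w_def)
qed

lemma eisenstein_row_2_0: "eisenstein_row 2 0 = of_real (pi\<^sup>2 / 3)"
proof -
  have "(\<lambda>n. inverse (of_int (int (Suc n)) ^ 2) + inverse (of_int (- int (Suc n)) ^ 2) :: complex)
      sums (eisenstein_row 2 0 - 0)"
    using infsum_int_sums_split[OF summable_on_int_inverse_power_0[of 2]]
    by (simp add: eisenstein_row_def)
  moreover have "(\<lambda>n. of_real (2 * (1 / (real n + 1)\<^sup>2)) :: complex) sums of_real (2 * (pi\<^sup>2 / 6))"
    using inverse_squares_sums by (intro sums_of_real sums_mult) (simp add: add.commute)
  moreover have "inverse (of_int (int (Suc n)) ^ 2) + inverse (of_int (- int (Suc n)) ^ 2)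
      = (of_real (2 * (1 / (real n + 1)\<^sup>2)) :: complex)" for n
    by (simp only: of_int_minus power2_minus of_int_of_nat_eq)
       (simp add: inverse_eq_divide add.commute)
  ultimately show ?thesis by (auto dest: sums_unique2)
qed

lemma eisenstein_rows_2:
  assumes "Im \<tau> > 0"
  shows "(\<lambda>m::int. eisenstein_row 2 (of_int m * \<tau>)) summable_on UNIV"
    and "(\<Sum>\<^sub>\<infinity>m::int. eisenstein_row 2 (of_int m * \<tau>)) = of_real pi ^ 2 / 3 * Eis2 \<tau>"
  using eisenstein_rows[OF assms, of 1]
  by (simp_all add: eisenstein_row_2_0 Eis2_eq numeral_2_eq_2 [symmetric] power_mult_distrib algebra_simps)

text \<open>Rows give the value at \<tau>, columns the value at -1/\<tau>, and the missing row m = 0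
  costs 2 zeta(2) in either order. In the column order the telescoping cotangents have limits of
  opposite sign at the two ends, which leaves -2 pi i/\<tau>; multiplied by 3 \<tau>^2/pi^2 this is
  the correction term.\<close>

theorem Eis2_neg_inverse:
  assumes "Im \<tau> > 0"
  shows "Eis2 (- 1 / \<tau>) = \<tau>\<^sup>2 * Eis2 \<tau> - 6 * \<i> * \<tau> / of_real pi"
proof -
  have \<tau>: "\<tau> \<noteq> 0" using assms by auto
  define z where "z = - 1 / \<tau>"
  have z: "Im z > 0" "of_int n / \<tau> = - (of_int n * z)" for n
    using \<tau> assms unfolding z_def Im_neg_inverse by (auto simp: Im_neg_inverse)
  let ?Z = "eisenstein_row 2 0"
  have "(\<Sum>\<^sub>\<infinity>m. \<Sum>\<^sub>\<infinity>n. eis2_term \<tau> m n) = (\<Sum>\<^sub>\<infinity>m\<in>-{0}. eisenstein_row 2 (of_int m * \<tau>))"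
    by (rule infsum_cong_neutral) (use infsum_eis2_term_row[OF assms] in \<open>auto simp: eis2_term_def\<close>)
  also have "\<dots> = (\<Sum>\<^sub>\<infinity>m. eisenstein_row 2 (of_int m * \<tau>)) - ?Z"
  proof -
    have "(\<Sum>\<^sub>\<infinity>m\<in>insert 0 (-{0::int}). eisenstein_row 2 (of_int m * \<tau>))
        = eisenstein_row 2 (of_int 0 * \<tau>) + (\<Sum>\<^sub>\<infinity>m\<in>-{0}. eisenstein_row 2 (of_int m * \<tau>))"
      by (rule infsum_insert) (auto intro: summable_on_subset_banach[OF eisenstein_rows_2(1)[OF assms]])
    moreover have "insert 0 (-{0::int}) = UNIV" by auto
    ultimately show ?thesis by simp
  qed
  finally have rows: "(\<Sum>\<^sub>\<infinity>m. \<Sum>\<^sub>\<infinity>n. eis2_term \<tau> m n) = of_real pi ^ 2 / 3 * Eis2 \<tau> - ?Z"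
    by (simp add: eisenstein_rows_2[OF assms])

  define v where "v = (\<lambda>n::int. (eisenstein_row 2 (of_int n * z) - \<tau>\<^sup>2 * inverse (of_int n ^ 2)) / \<tau>\<^sup>2)"
  define u where "u = (\<lambda>n::int. - (shifted_cot (of_int n * z) / \<tau>))"
  have col: "(\<Sum>\<^sub>\<infinity>m. eis2_term \<tau> m n) = v n - (u n - u (n + 1))" for n
    unfolding infsum_eis2_term_column[OF assms] z(2) shifted_cot_uminus v_def u_def
    using eisenstein_row_uminus[of 2 "of_int n * z"]
    by (simp add: z_def power_divide inverse_eq_divide)
  have swap: "(\<lambda>(n, m). eis2_term \<tau> m n) summable_on UNIV \<times> UNIV"
    using summable_on_swap[of "\<lambda>(m, n). eis2_term \<tau> m n" UNIV UNIV] summable_eis2_term[OF assms]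
    by simp
  have s1: "(\<lambda>n. v n - (u n - u (n + 1))) summable_on UNIV"
    using summable_on_Sigma_banach[OF swap] by (simp add: col)
  have v: "(v has_sum (of_real pi ^ 2 / 3 * Eis2 z + - (\<tau>\<^sup>2 * ?Z)) / \<tau>\<^sup>2) UNIV"
    unfolding v_def diff_conv_add_uminus
  proof (intro has_sum_divide_const has_sum_add has_sum_uminusI has_sum_cmult_right)
    show "((\<lambda>n::int. eisenstein_row 2 (of_int n * z)) has_sum of_real pi ^ 2 / 3 * Eis2 z) UNIV"
      using eisenstein_rows_2[OF z(1)] by (simp add: has_sum_iff)
    show "((\<lambda>n::int. inverse (of_int n ^ 2)) has_sum ?Z) UNIV"
      using summable_on_int_inverse_power_0[of 2] by (simp add: has_sum_iff eisenstein_row_def)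
  qed
  have "(\<lambda>n. v n + - (v n - (u n - u (n + 1)))) summable_on UNIV"
    by (intro summable_on_add has_sum_imp_summable[OF v] summable_on_uminus[THEN iffD2] s1)
  then have s2: "(\<lambda>n. u n - u (n + 1)) summable_on UNIV" by simp
  have lim: "(\<lambda>N. shifted_cot (of_nat N * z)) \<longlonglongrightarrow> - of_real pi * \<i>"
    by (rule shifted_cot_tendsto) (rule z)
  have "(\<Sum>\<^sub>\<infinity>n. u n - u (n + 1)) = (- of_real pi * \<i>) / \<tau> - - ((- of_real pi * \<i>) / \<tau>)"
  proof (rule infsum_int_telescope[OF s2])
    show "(\<lambda>N. u (int N)) \<longlonglongrightarrow> - ((- of_real pi * \<i>) / \<tau>)"
      unfolding u_def of_int_of_nat_eq by (intro tendsto_minus tendsto_divide lim tendsto_const \<tau>)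
    have "(\<lambda>N. shifted_cot (of_nat N * z) / \<tau>) \<longlonglongrightarrow> (- of_real pi * \<i>) / \<tau>"
      by (intro tendsto_divide lim tendsto_const \<tau>)
    then show "(\<lambda>N. u (- int N)) \<longlonglongrightarrow> (- of_real pi * \<i>) / \<tau>"
      by (simp add: u_def shifted_cot_uminus)
  qed
  then have cot: "(\<Sum>\<^sub>\<infinity>n. u n - u (n + 1)) = - 2 * of_real pi * \<i> / \<tau>" by simp
  have "(\<Sum>\<^sub>\<infinity>n. v n) = (\<Sum>\<^sub>\<infinity>n. (v n - (u n - u (n + 1))) + (u n - u (n + 1)))" by simp
  also have "\<dots> = (\<Sum>\<^sub>\<infinity>n. \<Sum>\<^sub>\<infinity>m. eis2_term \<tau> m n) + - 2 * of_real pi * \<i> / \<tau>"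
    by (subst infsum_add[OF s1 s2]) (simp add: cot col)
  also have "(\<Sum>\<^sub>\<infinity>n. \<Sum>\<^sub>\<infinity>m. eis2_term \<tau> m n) = of_real pi ^ 2 / 3 * Eis2 \<tau> - ?Z"
    using infsum_swap_banach[OF summable_eis2_term[OF assms]] rows by simp
  finally have "(of_real pi ^ 2 / 3 * Eis2 z + - (\<tau>\<^sup>2 * ?Z)) / \<tau>\<^sup>2
      = of_real pi ^ 2 / 3 * Eis2 \<tau> - ?Z + - 2 * of_real pi * \<i> / \<tau>"
    using infsumI[OF v] by simp
  then have "of_real pi * (of_real pi * Eis2 z + 6 * \<i> * \<tau>) = of_real pi * (of_real pi * (\<tau>\<^sup>2 * Eis2 \<tau>))"
    using \<tau> by (simp add: field_simps power2_eq_square)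
  then have "of_real pi * Eis2 z + 6 * \<i> * \<tau> = of_real pi * (\<tau>\<^sup>2 * Eis2 \<tau>)"
    by (simp only: mult_cancel_left) simp
  then show ?thesis
    unfolding z_def [symmetric] by (simp add: field_simps)
qed


section \<open>The eta function and forms of level two\<close>

lemma nome_surj:
  assumes "0 < cmod q" "cmod q < 1"
  obtains \<tau> where "Im \<tau> > 0" "nome \<tau> = q"
proof
  let ?\<tau> = "Ln q / (2 * of_real pi * \<i>)"
  have "Im ?\<tau> = - ln (cmod q) / (2 * pi)"
    using assms by (simp add: Im_divide power2_eq_square)
  then show "Im ?\<tau> > 0" using assms by (simp add: divide_neg_pos)
  show "nome ?\<tau> = q" using assms by (simp add: nome_def exp_Ln)
qed

text \<open>The series of \<open>sigma_series\<close> in the variable q, so that it can be evaluated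
  and differentiated at the cusp q = 0, which \<open>nome\<close> never attains.\<close>

definition sigma_fun :: "nat \<Rightarrow> complex \<Rightarrow> complex" where
  "sigma_fun k q = (\<Sum>n. of_nat (divisor_sigma k (Suc n)) * q ^ Suc n)"

lemma sigma_series_eq: "sigma_series k \<tau> = sigma_fun k (nome \<tau>)"
  by (simp add: sigma_series_def sigma_fun_def)

lemma sigma_fun_sums:
  assumes "cmod q < 1" "k > 0"
  shows "(\<lambda>n. of_nat (divisor_sigma k (Suc n)) * q ^ Suc n) sums sigma_fun k q"
proof (cases "q = 0")
  case False
  with assms obtain \<tau> where "Im \<tau> > 0" "nome \<tau> = q"
    using nome_surj[of q] by auto
  with lambert_series(3)[of \<tau> k] assms show ?thesis
    unfolding sigma_fun_def by (auto intro: summable_sums)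
qed (simp add: sigma_fun_def)

lemma sigma_fun_power_series:
  assumes "cmod q < 1" "k > 0"
  shows "(\<lambda>n. (if n = 0 then 0 else of_nat (divisor_sigma k n)) * q ^ n) sums sigma_fun k q"
proof -
  define f where "f = (\<lambda>n. (if n = 0 then 0 else of_nat (divisor_sigma k n)) * q ^ n)"
  have "(\<lambda>n. f (Suc n)) sums sigma_fun k q"
    using sigma_fun_sums[OF assms] by (simp add: f_def)
  then have "f sums (sigma_fun k q + f 0)" by (simp only: sums_Suc_iff)
  then show ?thesis by (simp add: f_def)
qed

lemma sigma_fun_holomorphic:
  assumes "k > 0"
  shows "sigma_fun k holomorphic_on ball 0 1"
proof (rule power_series_holomorphic)
  fix q :: complex assume "q \<in> ball 0 1"
  then have "cmod q < 1" by simp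
  from sigma_fun_power_series[OF this assms]
  show "(\<lambda>n. (if n = 0 then 0 else of_nat (divisor_sigma k n)) * (q - 0) ^ n) sums sigma_fun k q"
    by simp
qed

lemma sigma_fun_0 [simp]: "sigma_fun k 0 = 0"
  by (simp add: sigma_fun_def)

lemma deriv_sigma_fun_0:
  assumes "k > 0"
  shows "deriv (sigma_fun k) 0 = 1"
proof -
  let ?a = "\<lambda>n. if n = 0 then 0 else of_nat (divisor_sigma k n) :: complex"
  have sums: "(\<lambda>n. ?a n * q ^ n) sums sigma_fun k q" if "cmod q < 1" for q
    using sigma_fun_power_series[OF that assms] .
  have "((\<lambda>q. \<Sum>n. ?a n * q ^ n) has_field_derivative (\<Sum>n. diffs ?a n * 0 ^ n)) (at 0)"
    by (rule termdiffs_strong'[where K = 1]) (use sums in \<open>auto simp: sums_iff\<close>)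
  then have "(sigma_fun k has_field_derivative (\<Sum>n. diffs ?a n * 0 ^ n)) (at 0)"
    by (rule has_field_derivative_transform_within_open[where S = "ball 0 1"])
       (use sums in \<open>auto simp: sums_iff\<close>)
  moreover have "(\<Sum>n. diffs ?a n * 0 ^ n) = 1"
    by (simp add: powser_zero diffs_def divisor_sigma_def)
  ultimately show ?thesis by (simp add: DERIV_imp_deriv)
qed

definition euler_fun :: "complex \<Rightarrow> complex" where
  "euler_fun q = (\<Prod>n. 1 - q ^ Suc n)"

lemma one_minus_power_nonzero: "cmod q < 1 \<Longrightarrow> 1 - q ^ Suc n \<noteq> 0"
  by (metis norm_one norm_power power_Suc_less_one order_less_irrefl eq_iff_diff_eq_0 norm_ge_zero
      power_less_one_iff zero_less_Suc)

lemma euler_fun_convergent_prod: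
  assumes "cmod q < 1"
  shows "convergent_prod (\<lambda>n. 1 - q ^ Suc n)"
proof -
  have "summable (\<lambda>n. norm q ^ Suc n)"
    using assms by (subst summable_Suc_iff) (simp add: summable_geometric)
  then have "summable (\<lambda>n. norm ((1 - q ^ Suc n) - 1))"
    by (simp add: norm_mult norm_power)
  then show ?thesis
    by (intro abs_convergent_prod_imp_convergent_prod summable_imp_abs_convergent_prod)
qed

lemma euler_fun_nonzero: "cmod q < 1 \<Longrightarrow> euler_fun q \<noteq> 0"
  unfolding euler_fun_def
  by (intro prodinf_nonzero euler_fun_convergent_prod one_minus_power_nonzero)

lemma euler_fun_uniform_limit:
  assumes "r < 1"
  shows "uniform_limit (cball 0 r) (\<lambda>n q. \<Prod>k<n. 1 - q ^ Suc k) euler_fun sequentially"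
proof (cases "r < 0")
  case False
  have "uniformly_convergent_on (cball 0 r) (\<lambda>n q::complex. \<Prod>k<n. 1 - q ^ Suc k)"
  proof (rule uniformly_convergent_on_prod')
    have "summable (\<lambda>n. r ^ Suc n)"
      using assms False by (subst summable_Suc_iff) (simp add: summable_geometric)
    then show "uniformly_convergent_on (cball 0 r) (\<lambda>N q::complex. \<Sum>n<N. norm (1 - q ^ Suc n - 1))"
      by (rule Weierstrass_m_test'[rotated])
         (auto simp: norm_mult norm_power mult_mono power_mono simp del: power_Suc)
  qed (auto intro!: continuous_intros)
  then obtain l where l: "uniform_limit (cball 0 r) (\<lambda>n q::complex. \<Prod>k<n. 1 - q ^ Suc k) l sequentially"
    unfolding uniformly_convergent_on_def by blast
  have "l q = euler_fun q" if "q \<in> cball 0 r" for q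
  proof -
    have "(\<lambda>n. \<Prod>k<n. 1 - q ^ Suc k) \<longlonglongrightarrow> l q"
      using l that by (rule tendsto_uniform_limitI)
    moreover have "(\<lambda>n. \<Prod>k<n. 1 - q ^ Suc k) \<longlonglongrightarrow> euler_fun q"
      unfolding euler_fun_def
      using convergent_prod_LIMSEQ[OF euler_fun_convergent_prod[of q]] that assms
      by (subst LIMSEQ_lessThan_iff_atMost) auto
    ultimately show ?thesis by (rule LIMSEQ_unique)
  qed
  then show ?thesis
    using l uniform_limit_cong'[of "cball 0 r"] by (metis (no_types, lifting))
qed (auto simp: uniform_limit_iff)

lemma euler_fun_holomorphic: "euler_fun holomorphic_on ball 0 1"
proof (rule holomorphic_uniform_sequence[where f = "\<lambda>n q. \<Prod>k<n. 1 - q ^ Suc k"])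
  fix q :: complex assume q: "q \<in> ball 0 1"
  define d where "d = (1 - cmod q) / 2"
  have "cball q d \<subseteq> cball 0 ((1 + cmod q) / 2)"
    by (rule subset_trans[OF cball_subset_cball_iff[THEN iffD2]])
       (use q in \<open>auto simp: d_def field_simps dist_norm\<close>)
  moreover have "cball 0 ((1 + cmod q) / 2) \<subseteq> ball (0::complex) 1"
    using q by (auto simp: cball_subset_ball_iff)
  moreover have "uniform_limit (cball 0 ((1 + cmod q) / 2)) (\<lambda>n q. \<Prod>k<n. 1 - q ^ Suc k) euler_fun sequentially"
    by (rule euler_fun_uniform_limit) (use q in auto)
  moreover have "d > 0" using q by (simp add: d_def)
  ultimately show "\<exists>d>0. cball q d \<subseteq> ball 0 1 \<and>
      uniform_limit (cball q d) (\<lambda>n q. \<Prod>k<n. 1 - q ^ Suc k) euler_fun sequentially"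
    by (meson uniform_limit_on_subset subset_trans)
qed (auto intro!: holomorphic_intros)

lemma euler_fun_0 [simp]: "euler_fun 0 = 1"
  by (simp add: euler_fun_def)

text \<open>The logarithmic derivative of the product, multiplied by -q, is the sum of n q^n/(1 -
  q^n), the Lambert series for sigma_1.\<close>

lemma deriv_euler_fun_nome:
  assumes "Im \<tau> > 0"
  shows "nome \<tau> * deriv euler_fun (nome \<tau>) = - sigma_fun 1 (nome \<tau>) * euler_fun (nome \<tau>)"
proof -
  let ?q = "nome \<tau>"
  have q: "cmod ?q < 1" using assms by (rule norm_nome_less_1)
  define r where "r = (1 + cmod ?q) / 2"
  have r: "cmod ?q < r" "r < 1" using q by (auto simp: r_def)
  have "(\<lambda>k. deriv (\<lambda>q. 1 - q ^ Suc k) ?q / (1 - ?q ^ Suc k)) sums (deriv euler_fun ?q / euler_fun ?q)"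
  proof (rule logderiv_prodinf_complex_uniform_limit[where A = "ball 0 r"])
    show "uniform_limit (ball 0 r) (\<lambda>n q. \<Prod>k<n. 1 - q ^ Suc k) euler_fun sequentially"
      by (rule uniform_limit_on_subset[OF euler_fun_uniform_limit[OF r(2)]]) auto
  qed (use r q euler_fun_nonzero in \<open>auto intro!: holomorphic_intros simp del: power_Suc\<close>)
  moreover have "deriv (\<lambda>q. 1 - q ^ Suc k) ?q = - (of_nat (Suc k) * ?q ^ k)" for k
    by (rule DERIV_imp_deriv) (auto intro!: derivative_eq_intros simp: algebra_simps simp del: power_Suc)
  ultimately have "(\<lambda>k. - (of_nat (Suc k) * ?q ^ k) / (1 - ?q ^ Suc k)) sums (deriv euler_fun ?q / euler_fun ?q)"
    by (simp only:)
  from sums_mult[OF this, of "- ?q"]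
  have "(\<lambda>k. - ?q * (- (of_nat (Suc k) * ?q ^ k) / (1 - ?q ^ Suc k))) sums (- ?q * (deriv euler_fun ?q / euler_fun ?q))" .
  moreover have "- ?q * (- (of_nat (Suc k) * ?q ^ k) / (1 - ?q ^ Suc k))
      = of_nat (Suc k) ^ 1 * (?q ^ Suc k / (1 - ?q ^ Suc k))" for k
    by (simp add: mult_ac del: of_nat_Suc)
  ultimately have "(\<lambda>k. of_nat (Suc k) ^ 1 * (?q ^ Suc k / (1 - ?q ^ Suc k))) sums (- ?q * (deriv euler_fun ?q / euler_fun ?q))"
    by (simp only:)
  moreover have "(\<lambda>k. of_nat (Suc k) ^ 1 * (?q ^ Suc k / (1 - ?q ^ Suc k))) sums sigma_series 1 \<tau>"
    using lambert_series(2)[OF assms, of 1] by (intro has_sum_imp_sums) (subst has_sum_Suc_iff, simp)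
  ultimately have "- ?q * (deriv euler_fun ?q / euler_fun ?q) = sigma_fun 1 ?q"
    unfolding sigma_series_eq by (rule sums_unique2)
  then have "- (?q * deriv euler_fun ?q) = sigma_fun 1 ?q * euler_fun ?q"
    using euler_fun_nonzero[OF q] by (simp add: field_simps)
  then show ?thesis by (metis minus_minus minus_mult_left)
qed

text \<open>The eighth power is the smallest for which inversion produces no root of unity, as
  (\<tau>/i)^4 = \<tau>^4; all forms below are built from eighth powers. The factor q^(1/3) is
  \<open>nome (\<tau> / 3)\<close>.\<close>

definition eta8 :: "complex \<Rightarrow> complex" where
  "eta8 \<tau> = nome (\<tau> / 3) * euler_fun (nome \<tau>) ^ 8"

lemma dedekind_eta_power_8: "dedekind_eta \<tau> ^ 8 = eta8 \<tau>"
  by (simp add: dedekind_eta_def eta8_def euler_fun_def power_mult_distrib nome_power)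

lemma eta8_nonzero: "Im \<tau> > 0 \<Longrightarrow> eta8 \<tau> \<noteq> 0"
  by (simp add: eta8_def euler_fun_nonzero norm_nome_less_1)

lemma has_field_derivative_eta8:
  assumes "Im \<tau> > 0"
  shows "(eta8 has_field_derivative (2 * of_real pi * \<i> / 3 * Eis2 \<tau> * eta8 \<tau>)) (at \<tau>)"
proof -
  let ?q = "nome \<tau>" and ?c = "2 * of_real pi * \<i>"
  have q: "?q \<in> ball 0 1" using assms norm_nome_less_1 by simp
  have "(euler_fun has_field_derivative deriv euler_fun ?q) (at ?q)"
    by (rule holomorphic_derivI[OF euler_fun_holomorphic _ q]) simp
  then have "((\<lambda>\<tau>. euler_fun (nome \<tau>)) has_field_derivative
      deriv euler_fun ?q * (?c * 1 * ?q)) (at \<tau>)"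
    by (rule DERIV_chain2[where g = nome]) (rule has_field_derivative_nome[OF DERIV_ident])
  also have "deriv euler_fun ?q * (?c * 1 * ?q) = ?c * (?q * deriv euler_fun ?q)" by (simp only: mult_ac mult_1)
  also have "\<dots> = - ?c * sigma_fun 1 ?q * euler_fun ?q"
    by (simp only: deriv_euler_fun_nome[OF assms] mult_minus_left mult_minus_right mult.assoc)
  finally have d: "((\<lambda>\<tau>. euler_fun (nome \<tau>)) has_field_derivative (- ?c * sigma_fun 1 ?q * euler_fun ?q)) (at \<tau>)" .
  have d1: "((\<lambda>\<tau>. nome (\<tau> / 3)) has_field_derivative ?c * (1 / 3) * nome (\<tau> / 3)) (at \<tau>)"
    by (rule has_field_derivative_nome) (auto intro!: derivative_eq_intros)
  have d2: "((\<lambda>\<tau>. euler_fun (nome \<tau>) ^ 8) has_field_derivative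
      of_nat 8 * ((- ?c * sigma_fun 1 ?q * euler_fun ?q) * euler_fun ?q ^ 7)) (at \<tau>)"
    using DERIV_power[OF d, of 8] by simp
  have eq: "?c * (1 / 3) * nome (\<tau> / 3) * euler_fun ?q ^ 8
      + of_nat 8 * ((- ?c * sigma_fun 1 ?q * euler_fun ?q) * euler_fun ?q ^ 7) * nome (\<tau> / 3)
      = 2 * of_real pi * \<i> / 3 * Eis2 \<tau> * eta8 \<tau>"
  proof -
    have key: "c * (1 / 3) * n * e ^ 8 + 8 * ((- c * s * e) * e ^ 7) * n = c / 3 * (1 - 24 * s) * (n * e ^ 8)"
      for c n s e :: complex
    proof -
      have "e ^ 8 = e * e ^ 7" by (simp flip: power_Suc)
      then show ?thesis by (simp add: algebra_simps)
    qed
    show ?thesis unfolding Eis2_eq sigma_series_eq eta8_def of_nat_numeral by (rule key)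
  qed
  from DERIV_cong[OF DERIV_mult[OF d1 d2] eq] show ?thesis by (simp only: eta8_def [abs_def])
qed

lemma convex_upper_half_plane: "convex {\<tau>. Im \<tau> > 0}" and open_upper_half_plane: "open {\<tau>. Im \<tau> > 0}"
  by (simp_all add: convex_halfspace_Im_gt open_halfspace_Im_gt)

text \<open>The quotient of the two sides has derivative 0: the inhomogeneous term in the law of
  \<open>Eis2\<close> is exactly what the factor \<tau>^4 contributes. The constant is found at the
  fixed point i, where i^4 = 1.\<close>

theorem eta8_neg_inverse:
  assumes "Im \<tau> > 0"
  shows "eta8 (- 1 / \<tau>) = \<tau> ^ 4 * eta8 \<tau>"
proof -
  let ?c = "2 * of_real pi * \<i> / 3"
  have aux: "P * y * r * (u * x) - y * (4 * v * x + u * (Q * x)) = 0"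
    if "P * r * u = 4 * v + u * Q" for P Q r u v x y :: complex
  proof -
    have "P * y * r * (u * x) = (P * r * u) * (y * x)" by simp
    then show ?thesis unfolding that by (simp add: algebra_simps)
  qed
  define g where "g = (\<lambda>\<tau>. eta8 (- 1 / \<tau>) / (\<tau> ^ 4 * eta8 \<tau>))"
  have "(g has_field_derivative 0) (at \<tau> within {\<tau>. Im \<tau> > 0})" if "\<tau> \<in> {\<tau>. Im \<tau> > 0}" for \<tau>
  proof -
    have \<tau>: "Im \<tau> > 0" using that by simp
    then have nz: "\<tau> \<noteq> 0" "eta8 \<tau> \<noteq> 0" using eta8_nonzero by auto
    have \<tau>': "Im (- 1 / \<tau>) > 0" using \<tau> nz by (subst Im_neg_inverse) auto
    have "((\<lambda>\<tau>. eta8 (- 1 / \<tau>)) has_field_derivative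
        (?c * Eis2 (- 1 / \<tau>) * eta8 (- 1 / \<tau>)) * (1 / \<tau>\<^sup>2)) (at \<tau>)"
      by (rule DERIV_chain2[where f = eta8 and g = "\<lambda>\<tau>. - 1 / \<tau>"], rule has_field_derivative_eta8[OF \<tau>'])
         (use nz in \<open>auto intro!: derivative_eq_intros simp: power2_eq_square\<close>)
    moreover have "((\<lambda>\<tau>. \<tau> ^ 4 * eta8 \<tau>) has_field_derivative
        4 * \<tau> ^ 3 * eta8 \<tau> + \<tau> ^ 4 * (?c * Eis2 \<tau> * eta8 \<tau>)) (at \<tau>)"
      by (rule derivative_eq_intros has_field_derivative_eta8 \<tau> refl)+ simp
    ultimately have "(g has_field_derivative
       ((?c * Eis2 (- 1 / \<tau>) * eta8 (- 1 / \<tau>)) * (1 / \<tau>\<^sup>2) * (\<tau> ^ 4 * eta8 \<tau>)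
         - eta8 (- 1 / \<tau>) * (4 * \<tau> ^ 3 * eta8 \<tau> + \<tau> ^ 4 * (?c * Eis2 \<tau> * eta8 \<tau>)))
        / ((\<tau> ^ 4 * eta8 \<tau>) * (\<tau> ^ 4 * eta8 \<tau>))) (at \<tau>)"
      unfolding g_def by (rule DERIV_divide) (use nz in auto)
    moreover have "?c * Eis2 (- 1 / \<tau>) * (1 / \<tau>\<^sup>2) * \<tau> ^ 4 = 4 * \<tau> ^ 3 + \<tau> ^ 4 * (?c * Eis2 \<tau>)"
      unfolding Eis2_neg_inverse[OF \<tau>] using nz
      by (simp add: field_simps power2_eq_square power3_eq_cube power4_eq_xxxx)
    then have "(?c * Eis2 (- 1 / \<tau>) * eta8 (- 1 / \<tau>)) * (1 / \<tau>\<^sup>2) * (\<tau> ^ 4 * eta8 \<tau>)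
         - eta8 (- 1 / \<tau>) * (4 * \<tau> ^ 3 * eta8 \<tau> + \<tau> ^ 4 * (?c * Eis2 \<tau> * eta8 \<tau>)) = 0"
      by (rule aux)
    ultimately show ?thesis by (simp add: has_field_derivative_at_within)
  qed
  from has_field_derivative_zero_constant[OF convex_upper_half_plane this]
  obtain C where C: "\<And>\<tau>. Im \<tau> > 0 \<Longrightarrow> g \<tau> = C" by auto
  have "C = g \<i>" using C[of \<i>] by simp
  also have "\<dots> = 1" using eta8_nonzero[of \<i>] by (simp add: g_def)
  finally have "g \<tau> = 1" using C assms by simp
  moreover have "\<tau> \<noteq> 0" "eta8 \<tau> \<noteq> 0" using assms eta8_nonzero by auto
  ultimately show ?thesis by (simp add: g_def field_simps)
qed


section \<open>A vanishing criterion\<close>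

lemma Im_fricke: "Im (- 1 / (2 * \<tau>)) = Im \<tau> / (2 * cmod \<tau> ^ 2)"
proof -
  have "Im (- 1 / (2 * \<tau>)) = Im (2 * \<tau>) / cmod (2 * \<tau>) ^ 2" by (rule Im_neg_inverse)
  then show ?thesis by (simp add: norm_mult power2_eq_square)
qed

lemma Im_fricke_pos:
  assumes "Im \<tau> > 0"
  shows "Im (- 1 / (2 * \<tau>)) > 0"
proof -
  have "\<tau> \<noteq> 0" using assms by auto
  then show ?thesis using assms by (subst Im_fricke) auto
qed

text \<open>The codomain is arbitrary because this is also applied to predicates, in the reduction
  of roots.\<close>

lemma periodic_shift_int:
  assumes "\<And>\<tau>. Im \<tau> > 0 \<Longrightarrow> f (\<tau> + 1) = f \<tau>" "Im \<tau> > 0"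
  shows "f (\<tau> + of_int n) = (f \<tau> :: 'a)"
proof (induction n rule: int_induct[where k = 0])
  case (step1 i)
  have "f (\<tau> + of_int (i + 1)) = f ((\<tau> + of_int i) + 1)" by (simp add: add_ac)
  also have "\<dots> = f (\<tau> + of_int i)" by (rule assms(1)) (use assms(2) in simp)
  finally show ?case using step1 by simp
next
  case (step2 i)
  have "f (\<tau> + of_int i) = f ((\<tau> + of_int (i - 1)) + 1)" by (simp add: add_ac)
  also have "\<dots> = f (\<tau> + of_int (i - 1))" by (rule assms(1)) (use assms(2) in simp)
  finally show ?case using step2 by simp
qed simp

text \<open>For \<open>\<bar>Re \<tau>\<bar> \<le> 1/2\<close> and \<open>Im \<tau> < 1/4\<close> the involution \<open>\<tau> \<mapsto> -1/(2\<tau>)\<close> multiplies the imaginary part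
  by at least \<open>8/5\<close>, so every orbit meets the strip \<open>\<bar>Re \<tau>\<bar> \<le> 1/2\<close>, \<open>Im \<tau> \<ge> 1/4\<close>.\<close>

lemma fricke_reduction:
  fixes f :: "complex \<Rightarrow> complex"
  assumes T: "\<And>\<tau>. Im \<tau> > 0 \<Longrightarrow> f (\<tau> + 1) = f \<tau>"
    and W: "\<And>\<tau>. Im \<tau> > 0 \<Longrightarrow> norm (f (- 1 / (2 * \<tau>))) = norm (f \<tau>)"
    and "Im \<tau> > 0"
  obtains \<tau>' where "\<bar>Re \<tau>'\<bar> \<le> 1/2" "Im \<tau>' \<ge> 1/4" "norm (f \<tau>') = norm (f \<tau>)"
proof -
  have *: "\<exists>\<tau>'. \<bar>Re \<tau>'\<bar> \<le> 1/2 \<and> Im \<tau>' \<ge> 1/4 \<and> norm (f \<tau>') = norm (f \<tau>)"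
    if "Im \<tau> > 0" "Im \<tau> * (8/5) ^ n \<ge> 1/4" for \<tau> n
    using that
  proof (induction n arbitrary: \<tau>)
    case (0 \<tau>)
    define \<tau>' where "\<tau>' = \<tau> + of_int (- round (Re \<tau>))"
    have "f \<tau>' = f \<tau>" unfolding \<tau>'_def by (rule periodic_shift_int[where f = f, OF T]) (use 0 in auto)
    moreover have "\<bar>Re \<tau>'\<bar> \<le> 1/2"
      using of_int_round_abs_le[of "Re \<tau>"] by (simp add: \<tau>'_def abs_minus_commute)
    ultimately show ?case using 0 by (intro exI[of _ \<tau>']) (auto simp: \<tau>'_def)
  next
    case (Suc n \<tau>)
    define \<tau>' where "\<tau>' = \<tau> + of_int (- round (Re \<tau>))"
    have f: "f \<tau>' = f \<tau>" unfolding \<tau>'_def by (rule periodic_shift_int[where f = f, OF T]) (use Suc in auto)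
    have re: "\<bar>Re \<tau>'\<bar> \<le> 1/2"
      using of_int_round_abs_le[of "Re \<tau>"] by (simp add: \<tau>'_def abs_minus_commute)
    have im: "Im \<tau>' = Im \<tau>" by (simp add: \<tau>'_def)
    show ?case
    proof (cases "Im \<tau> \<ge> 1/4")
      case True
      then show ?thesis using re f im by (intro exI[of _ \<tau>']) auto
    next
      case False
      have "(Re \<tau>')\<^sup>2 \<le> (1/2)\<^sup>2" using re by (intro abs_le_square_iff[THEN iffD1]) auto
      moreover have "(Im \<tau>')\<^sup>2 \<le> (1/4)\<^sup>2" using False Suc.prems im by (intro power_mono) auto
      ultimately have "cmod \<tau>' ^ 2 \<le> 5/16" by (simp add: cmod_power2 power_divide)
      moreover have "cmod \<tau>' > 0" using Suc.prems im by auto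
      ultimately have "Im \<tau>' / (2 * cmod \<tau>' ^ 2) \<ge> Im \<tau>' / (2 * (5/16))"
        using Suc.prems im by (intro divide_left_mono) auto
      then have ge: "Im (- 1 / (2 * \<tau>')) \<ge> Im \<tau> * (8/5)" unfolding Im_fricke im by simp
      then have "Im (- 1 / (2 * \<tau>')) * (8/5) ^ n \<ge> Im \<tau> * (8/5) * (8/5) ^ n"
        by (intro mult_right_mono) auto
      then have "Im (- 1 / (2 * \<tau>')) * (8/5) ^ n \<ge> 1/4" using Suc.prems by (simp add: mult.assoc)
      from Suc.IH[OF _ this] obtain \<tau>'' where
        "\<bar>Re \<tau>''\<bar> \<le> 1/2" "Im \<tau>'' \<ge> 1/4" "norm (f \<tau>'') = norm (f (- 1 / (2 * \<tau>')))"
        using Im_fricke_pos[of \<tau>'] Suc.prems im by auto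
      then show ?thesis using W[of \<tau>'] Suc.prems im f by (intro exI[of _ \<tau>'']) auto
    qed
  qed
  obtain n where "(1/4) / Im \<tau> < (8/5) ^ n" using real_arch_pow[of "8/5"] by auto
  then have "Im \<tau> * (8/5) ^ n \<ge> 1/4" using assms(3) by (simp add: field_simps)
  with * assms(3) that show ?thesis by blast
qed

text \<open>If \<open>f \<tau>0\<close> were nonzero, values near the cusp would be smaller in
  modulus, so by reduction the supremum over the half-plane would be attained on a compact
  rectangle. The function would then be constant, against its smaller values near the cusp.\<close>

lemma fricke_liouville:
  fixes f :: "complex \<Rightarrow> complex"
  assumes holo: "f holomorphic_on {\<tau>. Im \<tau> > 0}"
    and T: "\<And>\<tau>. Im \<tau> > 0 \<Longrightarrow> f (\<tau> + 1) = f \<tau>"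
    and W: "\<And>\<tau>. Im \<tau> > 0 \<Longrightarrow> norm (f (- 1 / (2 * \<tau>))) = norm (f \<tau>)"
    and cusp: "\<And>\<epsilon>. \<epsilon> > 0 \<Longrightarrow> \<exists>Y. \<forall>\<tau>. Im \<tau> > Y \<longrightarrow> norm (f \<tau>) < \<epsilon>"
    and pos0: "Im \<tau>0 > 0"
  shows "f \<tau>0 = 0"
proof (rule ccontr)
  assume nz: "f \<tau>0 \<noteq> 0"
  then obtain Y0 where Y0: "\<And>\<tau>. Im \<tau> > Y0 \<Longrightarrow> norm (f \<tau>) < norm (f \<tau>0)"
    using cusp[of "norm (f \<tau>0)"] by auto
  define Y where "Y = max 1 Y0"
  have Y: "norm (f \<tau>) < norm (f \<tau>0)" if "Im \<tau> > Y" for \<tau> using Y0 that by (auto simp: Y_def)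
  define K where "K = cbox (Complex (-1/2) (1/4)) (Complex (1/2) Y)"
  have K: "\<tau> \<in> K \<longleftrightarrow> \<bar>Re \<tau>\<bar> \<le> 1/2 \<and> 1/4 \<le> Im \<tau> \<and> Im \<tau> \<le> Y" for \<tau>
    by (auto simp: K_def in_cbox_complex_iff)
  have "compact K" by (simp add: K_def compact_cbox)
  moreover have "K \<noteq> {}" using K[of "Complex 0 1"] by (auto simp: Y_def)
  moreover have "continuous_on K (\<lambda>\<tau>. norm (f \<tau>))"
    by (intro continuous_on_norm continuous_on_subset[OF holomorphic_on_imp_continuous_on[OF holo]])
       (auto simp: K)
  ultimately obtain \<xi> where \<xi>: "\<xi> \<in> K" "\<And>\<tau>. \<tau> \<in> K \<Longrightarrow> norm (f \<tau>) \<le> norm (f \<xi>)"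
    using continuous_attains_sup[of K "\<lambda>\<tau>. norm (f \<tau>)"] by auto
  have le0: "norm (f \<tau>0) \<le> norm (f \<xi>)"
  proof -
    obtain \<tau>' where \<tau>': "\<bar>Re \<tau>'\<bar> \<le> 1/2" "Im \<tau>' \<ge> 1/4" "norm (f \<tau>') = norm (f \<tau>0)"
      using fricke_reduction[where f = f, OF T W \<open>Im \<tau>0 > 0\<close>] by blast
    then have "\<tau>' \<in> K" using Y[of \<tau>'] by (force simp: K)
    with \<xi> \<tau>' show ?thesis by metis
  qed
  have le: "norm (f \<tau>) \<le> norm (f \<xi>)" if pos: "Im \<tau> > 0" for \<tau>
  proof -
    obtain \<tau>' where \<tau>': "\<bar>Re \<tau>'\<bar> \<le> 1/2" "Im \<tau>' \<ge> 1/4" "norm (f \<tau>') = norm (f \<tau>)"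
      using fricke_reduction[where f = f, OF T W pos] by blast
    show ?thesis
    proof (cases "Im \<tau>' \<le> Y")
      case True
      then show ?thesis using \<tau>' \<xi> K by metis
    next
      case False
      then show ?thesis using Y[of \<tau>'] \<tau>' le0 by auto
    qed
  qed
  have "f constant_on {\<tau>. Im \<tau> > 0}"
  proof (rule maximum_modulus_principle[OF holo _ _ _ order_refl])
    show "connected {\<tau>. Im \<tau> > 0}" by (rule convex_connected) (rule convex_upper_half_plane)
    show "\<xi> \<in> {\<tau>. Im \<tau> > 0}" using \<xi>(1) by (auto simp: K)
  qed (use le open_upper_half_plane in auto)
  then obtain c where c: "\<And>\<tau>. Im \<tau> > 0 \<Longrightarrow> f \<tau> = c" by (auto simp: constant_on_def)
  have "f (Complex 0 (Y + 1)) = f \<tau>0" using c \<open>Im \<tau>0 > 0\<close> by (simp add: Y_def)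
  with Y[of "Complex 0 (Y + 1)"] show False by simp
qed

lemma nome_small:
  assumes "\<delta> > 0"
  obtains Y where "Y > 0" "\<And>\<tau>. Im \<tau> > Y \<Longrightarrow> cmod (nome \<tau>) < \<delta>"
proof
  let ?Y = "max 1 (- ln \<delta> / (2 * pi))"
  show "?Y > 0" by simp
  fix \<tau> assume "Im \<tau> > ?Y"
  then have "- 2 * pi * Im \<tau> < ln \<delta>" by (simp add: field_simps)
  then have "exp (- 2 * pi * Im \<tau>) < exp (ln \<delta>)" by (simp only: exp_less_cancel_iff)
  then show "cmod (nome \<tau>) < \<delta>" using assms by (simp add: norm_nome)
qed

lemma holomorphic_factor_zero_at_0:
  assumes "h holomorphic_on ball 0 r" "r > 0" "h 0 = (0 :: complex)"
  obtains k where "k holomorphic_on ball 0 r" "\<And>z. z \<in> ball 0 r \<Longrightarrow> h z = z * k z"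
proof
  show "(\<lambda>z. if z = 0 then deriv h 0 else (h z - h 0) / (z - 0)) holomorphic_on ball 0 r"
    by (rule pole_lemma) (use assms in auto)
qed (use assms in auto)

section \<open>Forms of weight four, the quasimodular form E and their q-expansions\<close>

definition form_a :: "complex \<Rightarrow> complex" where
  "form_a \<tau> = eta8 \<tau> ^ 2 / eta8 (2 * \<tau>)"

text \<open>The involution sends a to 64 b and b to a/64, up to the factor (2 \<tau>^2)^2, so a + 64
  b and a - 64 b have signs +1 and -1. At the cusp a is 1 and b has a simple zero.\<close>

definition form_b :: "complex \<Rightarrow> complex" where
  "form_b \<tau> = eta8 (2 * \<tau>) ^ 2 / eta8 \<tau>"

text \<open>This is the logarithmic derivative of \<open>form_a \<tau> * form_b \<tau>\<close>
  divided by 2 pi i; for the group with the involution it takes over the role of E_2.\<close>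

definition E_fun :: "complex \<Rightarrow> complex" where
  "E_fun \<tau> = (Eis2 \<tau> + 2 * Eis2 (2 * \<tau>)) / 3"

lemma form_ab_nonzero:
  assumes "Im \<tau> > 0"
  shows "form_a \<tau> \<noteq> 0" "form_b \<tau> \<noteq> 0"
  using assms eta8_nonzero[of \<tau>] eta8_nonzero[of "2 * \<tau>"] by (simp_all add: form_a_def form_b_def)

lemma form_b_eq: "Im \<tau> > 0 \<Longrightarrow> form_b \<tau> = t_fun \<tau> * form_a \<tau>"
proof -
  assume \<tau>: "Im \<tau> > 0"
  have "t_fun \<tau> = ((dedekind_eta (2 * \<tau>) / dedekind_eta \<tau>) ^ 8) ^ 3"
    by (simp add: t_fun_def flip: power_mult)
  also have "\<dots> = (eta8 (2 * \<tau>) / eta8 \<tau>) ^ 3"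
    by (simp add: power_divide dedekind_eta_power_8)
  finally show ?thesis
    using \<tau> eta8_nonzero[of \<tau>] eta8_nonzero[of "2 * \<tau>"]
    by (simp add: form_a_def form_b_def field_simps power2_eq_square power3_eq_cube)
qed

lemma fricke_double: "2 * (- 1 / (2 * \<tau>)) = - 1 / (\<tau> :: complex)"
  by simp

lemma eta8_fricke:
  assumes "Im \<tau> > 0"
  shows "eta8 (- 1 / (2 * \<tau>)) = 16 * \<tau> ^ 4 * eta8 (2 * \<tau>)"
  using eta8_neg_inverse[of "2 * \<tau>"] assms by (simp add: power_mult_distrib)

lemma form_a_fricke:
  assumes "Im \<tau> > 0"
  shows "form_a (- 1 / (2 * \<tau>)) = 256 * \<tau> ^ 4 * form_b \<tau>"
proof -
  have "\<tau> \<noteq> 0" "eta8 \<tau> \<noteq> 0" using assms eta8_nonzero by auto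
  then show ?thesis
    unfolding form_a_def form_b_def fricke_double eta8_fricke[OF assms] eta8_neg_inverse[OF assms]
    by (simp add: field_simps power2_eq_square)
qed

lemma form_b_fricke:
  assumes "Im \<tau> > 0"
  shows "form_b (- 1 / (2 * \<tau>)) = \<tau> ^ 4 / 16 * form_a \<tau>"
proof -
  have "\<tau> \<noteq> 0" "eta8 (2 * \<tau>) \<noteq> 0" using assms eta8_nonzero by auto
  then show ?thesis
    unfolding form_a_def form_b_def fricke_double eta8_fricke[OF assms] eta8_neg_inverse[OF assms]
    by (simp add: field_simps power2_eq_square)
qed

lemma Eis2_fricke:
  assumes "Im \<tau> > 0"
  shows "Eis2 (- 1 / (2 * \<tau>)) = 4 * \<tau>\<^sup>2 * Eis2 (2 * \<tau>) - 12 * \<i> * \<tau> / of_real pi"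
  using Eis2_neg_inverse[of "2 * \<tau>"] assms by (simp add: power_mult_distrib)

lemma J_fun_fricke:
  assumes "Im \<tau> > 0"
  shows "J_fun (- 1 / (2 * \<tau>)) = - 2 * \<tau>\<^sup>2 * J_fun \<tau>"
  unfolding J_fun_def fricke_double Eis2_fricke[OF assms] Eis2_neg_inverse[OF assms]
  by (simp add: field_simps)

lemma E_fun_fricke:
  assumes "Im \<tau> > 0"
  shows "E_fun (- 1 / (2 * \<tau>)) = 2 * \<tau>\<^sup>2 * E_fun \<tau> - 8 * \<i> * \<tau> / of_real pi"
  unfolding E_fun_def fricke_double Eis2_fricke[OF assms] Eis2_neg_inverse[OF assms]
  by (simp add: field_simps)

lemma nome_double: "nome (2 * \<tau>) = nome \<tau> ^ 2"
  by (simp add: nome_power)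

text \<open>These are the same forms as functions of q. They are holomorphic at q = 0 too, so
  behaviour at the cusp becomes that of a power series at the centre of the unit disc.\<close>

definition qE2 :: "complex \<Rightarrow> complex" where "qE2 q = 1 - 24 * sigma_fun 1 q"
definition qJ :: "complex \<Rightarrow> complex" where "qJ q = 2 * qE2 (q\<^sup>2) - qE2 q"
definition qE :: "complex \<Rightarrow> complex" where "qE q = (qE2 q + 2 * qE2 (q\<^sup>2)) / 3"
definition qa :: "complex \<Rightarrow> complex" where "qa q = euler_fun q ^ 16 / euler_fun (q\<^sup>2) ^ 8"
definition qb :: "complex \<Rightarrow> complex" where "qb q = q * (euler_fun (q\<^sup>2) ^ 16 / euler_fun q ^ 8)"

lemma q_expansions:
  shows "J_fun \<tau> = qJ (nome \<tau>)" "E_fun \<tau> = qE (nome \<tau>)"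
    "form_a \<tau> = qa (nome \<tau>)" "form_b \<tau> = qb (nome \<tau>)"
proof -
  show "J_fun \<tau> = qJ (nome \<tau>)" "E_fun \<tau> = qE (nome \<tau>)"
    by (simp_all add: J_fun_def E_fun_def qJ_def qE_def qE2_def Eis2_eq sigma_series_eq nome_double)
  \<comment> \<open>The fractional powers of q disappear: q^(2/3) / q^(2/3) in
    \<open>form_a\<close>, and q^(4/3) / q^(1/3) = q in \<open>form_b\<close>.\<close>
  have n: "nome (2 * \<tau> / 3) = nome (\<tau> / 3) ^ 2" using nome_double[of "\<tau> / 3"] by simp
  have n3: "nome (\<tau> / 3) ^ 3 = nome \<tau>" by (simp add: nome_power)
  show "form_a \<tau> = qa (nome \<tau>)"
    by (simp add: form_a_def eta8_def qa_def nome_double n power_mult_distrib flip: power_mult)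
  show "form_b \<tau> = qb (nome \<tau>)"
    unfolding form_b_def eta8_def qb_def nome_double n
    by (simp add: power_mult_distrib divide_simps n3 [symmetric] eval_nat_numeral flip: power_mult)
qed

lemma q_holomorphic:
  "qE2 holomorphic_on ball 0 1" "qJ holomorphic_on ball 0 1" "qE holomorphic_on ball 0 1"
  "qa holomorphic_on ball 0 1" "qb holomorphic_on ball 0 1"
proof -
  have sq: "q\<^sup>2 \<in> ball 0 1" if "q \<in> ball 0 1" for q :: complex
    using that by (simp add: norm_power power_less_one_iff abs_square_less_1)
  have h: "(\<lambda>q. q\<^sup>2) holomorphic_on ball (0::complex) 1" "(\<lambda>q. q\<^sup>2) ` ball (0::complex) 1 \<subseteq> ball 0 1"
    using sq by (auto intro!: holomorphic_intros)
  show E2: "qE2 holomorphic_on ball 0 1"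
    unfolding qE2_def by (intro holomorphic_intros sigma_fun_holomorphic) simp
  have E2': "(\<lambda>q. qE2 (q\<^sup>2)) holomorphic_on ball 0 1"
    using holomorphic_on_compose_gen[OF h(1) E2 h(2)] by (simp add: o_def)
  have eu': "(\<lambda>q. euler_fun (q\<^sup>2)) holomorphic_on ball 0 1"
    using holomorphic_on_compose_gen[OF h(1) euler_fun_holomorphic h(2)] by (simp add: o_def)
  show "qJ holomorphic_on ball 0 1" "qE holomorphic_on ball 0 1"
    unfolding qJ_def qE_def by (intro holomorphic_intros E2 E2'; simp)+
  show "qa holomorphic_on ball 0 1" "qb holomorphic_on ball 0 1"
    unfolding qa_def qb_def
    by (intro holomorphic_intros euler_fun_holomorphic eu';
        use euler_fun_nonzero sq in \<open>force simp: dist_norm\<close>)+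
qed

lemma q_at_0 [simp]: "qE2 0 = 1" "qJ 0 = 1" "qE 0 = 1" "qa 0 = 1" "qb 0 = 0"
  by (simp_all add: qE2_def qJ_def qE_def qa_def qb_def)

lemma holomorphic_on_compose_nome:
  assumes "h holomorphic_on ball 0 1"
  shows "(\<lambda>\<tau>. h (nome \<tau>)) holomorphic_on {\<tau>. Im \<tau> > 0}"
proof -
  have "nome ` {\<tau>. Im \<tau> > 0} \<subseteq> ball 0 1" using norm_nome_less_1 by auto
  from holomorphic_on_compose_gen[OF _ assms this] show ?thesis
    by (simp add: o_def holomorphic_on_nome)
qed

lemma forms_holomorphic:
  "J_fun holomorphic_on {\<tau>. Im \<tau> > 0}" "E_fun holomorphic_on {\<tau>. Im \<tau> > 0}"
  "form_a holomorphic_on {\<tau>. Im \<tau> > 0}" "form_b holomorphic_on {\<tau>. Im \<tau> > 0}"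
  unfolding q_expansions[abs_def] by (intro holomorphic_on_compose_nome q_holomorphic)+

lemma forms_shift [simp]:
  "J_fun (\<tau> + 1) = J_fun \<tau>" "E_fun (\<tau> + 1) = E_fun \<tau>"
  "form_a (\<tau> + 1) = form_a \<tau>" "form_b (\<tau> + 1) = form_b \<tau>"
  by (simp_all add: q_expansions)

text \<open>The form \<open>\<eta>(\<tau>)\<^sup>8\<eta>(2\<tau>)\<^sup>8 = form_a \<tau> * form_b \<tau>\<close> of weight 8 has no zeros in the upper half-plane and
  a simple zero at the cusp. Dividing the fourth power of a form of weight \<open>2k\<close> by its \<open>k\<close>-th power
  gives an invariant function, which vanishes at the cusp.\<close>

lemma weight_vanishing:
  fixes f h :: "complex \<Rightarrow> complex"
  assumes holo: "f holomorphic_on {\<tau>. Im \<tau> > 0}"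
    and T: "\<And>\<tau>. Im \<tau> > 0 \<Longrightarrow> f (\<tau> + 1) = f \<tau>"
    and W: "\<And>\<tau>. Im \<tau> > 0 \<Longrightarrow> norm (f (- 1 / (2 * \<tau>))) = norm (2 * \<tau>\<^sup>2) ^ k * norm (f \<tau>)"
    and h: "h holomorphic_on ball 0 r" "r > 0"
    and cusp: "\<And>\<tau>. Im \<tau> > Y \<Longrightarrow> nome \<tau> \<in> ball 0 r \<Longrightarrow> f \<tau> = nome \<tau> ^ m * h (nome \<tau>)"
    and order: "k < 4 * m"
    and "Im \<tau> > 0"
  shows "f \<tau> = 0"
proof -
  define D where "D = (\<lambda>\<tau>. form_a \<tau> * form_b \<tau>)"
  define g where "g = (\<lambda>\<tau>. f \<tau> ^ 4 / D \<tau> ^ k)"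
  \<comment> \<open>The power series of D with its simple zero at the cusp divided out, a unit at q
    = 0.\<close>
  define u where "u = (\<lambda>q. qa q * (euler_fun (q\<^sup>2) ^ 16 / euler_fun q ^ 8))"
  have D0: "D \<tau> \<noteq> 0" if "Im \<tau> > 0" for \<tau>
    using form_ab_nonzero[OF that] by (simp add: D_def)
  have Du: "D \<tau> = nome \<tau> * u (nome \<tau>)" for \<tau>
    by (simp add: D_def q_expansions u_def qb_def)
  have u0: "u 0 = 1" by (simp add: u_def)
  have "g \<tau> = 0"
  proof (rule fricke_liouville[where f = g])
    show "g holomorphic_on {\<tau>. Im \<tau> > 0}"
      unfolding g_def D_def using form_ab_nonzero
      by (intro holomorphic_intros holo forms_holomorphic) auto
    show "g (\<tau> + 1) = g \<tau>" if "Im \<tau> > 0" for \<tau>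
      using T[OF that] by (simp add: g_def D_def)
    show "norm (g (- 1 / (2 * \<tau>))) = norm (g \<tau>)" if "Im \<tau> > 0" for \<tau>
    proof -
      have "\<tau> \<noteq> 0" using that by auto
      then have pos: "norm (2 * \<tau>\<^sup>2) ^ 4 > 0" by simp
      have "D (- 1 / (2 * \<tau>)) = (2 * \<tau>\<^sup>2) ^ 4 * D \<tau>"
        unfolding D_def form_a_fricke[OF that] form_b_fricke[OF that]
        by (simp add: power_mult_distrib flip: power_mult power_add)
      then have "norm (D (- 1 / (2 * \<tau>))) = norm (2 * \<tau>\<^sup>2) ^ 4 * norm (D \<tau>)"
        by (simp only: norm_mult norm_power)
      then have "norm (g (- 1 / (2 * \<tau>)))
          = (norm (2 * \<tau>\<^sup>2) ^ k * norm (f \<tau>)) ^ 4 / (norm (2 * \<tau>\<^sup>2) ^ 4 * norm (D \<tau>)) ^ k"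
        unfolding g_def norm_divide norm_power[of _ 4] norm_power[of _ k] W[OF that] by simp
      also have "\<dots> = norm (f \<tau>) ^ 4 / norm (D \<tau>) ^ k"
      proof -
        have "(norm (2 * \<tau>\<^sup>2) ^ k) ^ 4 = (norm (2 * \<tau>\<^sup>2) ^ 4) ^ k"
          by (simp only: power_mult [symmetric] mult.commute)
        then show ?thesis using pos \<open>\<tau> \<noteq> 0\<close> by (simp only: power_mult_distrib) simp
      qed
      finally show ?thesis by (simp add: g_def norm_divide norm_power)
    qed
    show "\<exists>Y. \<forall>\<tau>. Im \<tau> > Y \<longrightarrow> norm (g \<tau>) < \<epsilon>" if "\<epsilon> > 0" for \<epsilon>
    proof -
      \<comment> \<open>The zero of f^4 of order at least 4 m outweighs the zero of order k of the
        denominator; the positive power of q that remains forces the limit 0.\<close>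
      define G where "G = (\<lambda>q. q ^ (4 * m - k) * (h q ^ 4 / u q ^ k))"
      have "isCont qa 0" "isCont euler_fun 0" "isCont euler_fun (0\<^sup>2)" "isCont h 0"
        using q_holomorphic(4) euler_fun_holomorphic h
        by (auto intro!: continuous_on_interior[OF holomorphic_on_imp_continuous_on])
      then have "isCont G 0"
        unfolding G_def u_def
        by (intro continuous_intros isCont_o2[of "0::complex" "\<lambda>q. q\<^sup>2" euler_fun]) simp_all
      then have "G \<midarrow>0\<rightarrow> G 0" by (simp add: isCont_def)
      moreover have "G 0 = 0" using order by (simp add: G_def)
      ultimately obtain \<delta> where \<delta>: "\<delta> > 0" "\<And>q. q \<noteq> 0 \<Longrightarrow> norm q < \<delta> \<Longrightarrow> norm (G q) < \<epsilon>"
        using \<open>\<epsilon> > 0\<close> unfolding LIM_def by (auto simp: dist_norm)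
      obtain Y' where Y': "Y' > 0" "\<And>\<tau>. Im \<tau> > Y' \<Longrightarrow> cmod (nome \<tau>) < min \<delta> r"
        using nome_small[of "min \<delta> r"] \<delta> h(2) by auto
      have "norm (g \<tau>) < \<epsilon>" if "Im \<tau> > max Y Y'" for \<tau>
      proof -
        have q: "cmod (nome \<tau>) < \<delta>" "nome \<tau> \<in> ball 0 r" using Y'(2)[of \<tau>] that by auto
        have "g \<tau> = nome \<tau> ^ (4 * m) * h (nome \<tau>) ^ 4 / (nome \<tau> ^ k * u (nome \<tau>) ^ k)"
          unfolding g_def Du using cusp[of \<tau>] that q
          by (simp add: power_mult_distrib mult.commute flip: power_mult)
        also have "nome \<tau> ^ (4 * m) = nome \<tau> ^ k * nome \<tau> ^ (4 * m - k)"
          using order by (simp flip: power_add)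
        finally have "g \<tau> = G (nome \<tau>)" by (simp add: G_def)
        then show ?thesis using \<delta>(2)[of "nome \<tau>"] q by simp
      qed
      then show ?thesis by blast
    qed
  qed fact
  then show ?thesis using D0[OF \<open>Im \<tau> > 0\<close>] by (simp add: g_def)
qed


section \<open>Relations between the forms\<close>

lemma has_field_derivative_compose_nome:
  assumes "h holomorphic_on ball 0 1" "Im \<tau> > 0"
  shows "((\<lambda>\<tau>. h (nome \<tau>)) has_field_derivative
           2 * of_real pi * \<i> * (nome \<tau> * deriv h (nome \<tau>))) (at \<tau>)"
proof -
  have q: "nome \<tau> \<in> ball 0 1" using assms norm_nome_less_1 by simp
  have "(h has_field_derivative deriv h (nome \<tau>)) (at (nome \<tau>))"
    by (rule holomorphic_derivI[OF assms(1) _ q]) simp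
  then have "((\<lambda>\<tau>. h (nome \<tau>)) has_field_derivative
      deriv h (nome \<tau>) * (2 * of_real pi * \<i> * 1 * nome \<tau>)) (at \<tau>)"
    by (rule DERIV_chain2[where g = nome]) (rule has_field_derivative_nome[OF DERIV_ident])
  moreover have "deriv h (nome \<tau>) * (2 * of_real pi * \<i> * 1 * nome \<tau>)
      = 2 * of_real pi * \<i> * (nome \<tau> * deriv h (nome \<tau>))"
    by (simp only: mult_ac mult_1)
  ultimately show ?thesis by (simp only:)
qed

text \<open>For k < 4, that is weight at most 6, order 1 is enough, so an identity between forms
  follows from its value at q = 0 alone. Giving the form through h makes periodicity and holomorphy
  at the cusp automatic.\<close>

lemma weight_vanishing_1:
  assumes h: "h holomorphic_on ball 0 1" "h 0 = 0"
    and W: "\<And>\<tau>. Im \<tau> > 0 \<Longrightarrow>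
      norm (h (nome (- 1 / (2 * \<tau>)))) = norm (2 * \<tau>\<^sup>2) ^ k * norm (h (nome \<tau>))"
    and "k < 4" "Im \<tau> > 0"
  shows "h (nome \<tau>) = 0"
proof -
  obtain h' where h': "h' holomorphic_on ball 0 1" "\<And>z. z \<in> ball 0 1 \<Longrightarrow> h z = z * h' z"
    using holomorphic_factor_zero_at_0[OF h(1) _ h(2)] by auto
  show ?thesis
  proof (rule weight_vanishing[where f = "\<lambda>\<tau>. h (nome \<tau>)" and h = h' and r = 1 and m = 1 and k = k])
    show "(\<lambda>\<tau>. h (nome \<tau>)) holomorphic_on {\<tau>. Im \<tau> > 0}"
      by (rule holomorphic_on_compose_nome) (rule h)
  qed (use assms h' in auto)
qed

text \<open>\<open>nome\<close> maps onto the punctured unit disc, and continuity reaches its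
  centre. The claim on the derivative serves to compare first q-coefficients.\<close>

lemma eq_0_on_disc:
  assumes "h holomorphic_on ball 0 1" "\<And>\<tau>. Im \<tau> > 0 \<Longrightarrow> h (nome \<tau>) = 0" "q \<in> ball 0 1"
  shows "h q = 0" "deriv h q = 0"
proof -
  have *: "h q = 0" if "q \<in> ball 0 1 - {0}" for q
    using nome_surj[of q] assms(2) that by auto
  have "h 0 = 0"
  proof (rule tendsto_unique)
    have "isCont h 0"
      using assms(1) by (intro continuous_on_interior[OF holomorphic_on_imp_continuous_on]) auto
    then show "h \<midarrow>0\<rightarrow> h 0" by (simp add: isCont_def)
    have "\<forall>\<^sub>F q in at 0. q \<in> ball 0 1 - {0 :: complex}"
      using eventually_at_ball'[of 1 "0::complex" UNIV] by (auto elim: eventually_mono)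
    then show "h \<midarrow>0\<rightarrow> 0" by (intro tendsto_eventually) (auto elim!: eventually_mono intro: *)
  qed simp
  with * have z: "h q = 0" if "q \<in> ball 0 1" for q using that by (cases "q = 0") auto
  then show "h q = 0" using assms(3) .
  have "((\<lambda>_. 0) has_field_derivative 0) (at q)" by simp
  then have "(h has_field_derivative 0) (at q)"
    by (rule has_field_derivative_transform_within_open[where S = "ball 0 1"]) (use z assms in auto)
  then show "deriv h q = 0" by (rule DERIV_imp_deriv)
qed

text \<open>Both sides have weight 4, constant term 1 and sign +1, the involution exchanging a and
  64 b; in weight 4 no more needs to be compared.\<close>

lemma J_squared:
  assumes "Im \<tau> > 0"
  shows "J_fun \<tau> ^ 2 = form_a \<tau> + 64 * form_b \<tau>"
proof -
  define h where "h = (\<lambda>q. qJ q ^ 2 - (qa q + 64 * qb q))"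
  have "h (nome \<tau>) = 0"
  proof (rule weight_vanishing_1[where k = 2])
    show "norm (h (nome (- 1 / (2 * \<tau>)))) = norm (2 * \<tau>\<^sup>2) ^ 2 * norm (h (nome \<tau>))" if "Im \<tau> > 0" for \<tau>
      unfolding h_def q_expansions [symmetric] J_fun_fricke[OF that] form_a_fricke[OF that] form_b_fricke[OF that]
      unfolding norm_power [symmetric] norm_mult [symmetric]
      by (rule arg_cong[of _ _ norm]) (simp add: algebra_simps power_mult_distrib flip: power_mult)
  qed (use assms in \<open>auto simp: h_def intro!: holomorphic_intros q_holomorphic\<close>)
  then show ?thesis by (simp add: h_def q_expansions)
qed

text \<open>The chain rule for f(-1/(2 \<tau>)) = g(\<tau>), whose inner derivative is 1/(2
  \<tau>^2).\<close>

lemma deriv_fricke: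
  assumes f: "f holomorphic_on {\<tau>. Im \<tau> > 0}" and "Im \<tau> > 0"
    and g: "\<And>\<tau>. Im \<tau> > 0 \<Longrightarrow> f (- 1 / (2 * \<tau>)) = g \<tau>"
    and g': "(g has_field_derivative g') (at \<tau>)"
  shows "deriv f (- 1 / (2 * \<tau>)) = 2 * \<tau>\<^sup>2 * g'"
proof -
  have "\<tau> \<noteq> 0" using assms by auto
  have W: "- 1 / (2 * \<tau>) \<in> {\<tau>. Im \<tau> > 0}" using Im_fricke_pos[OF assms(2)] by simp
  have "(f has_field_derivative deriv f (- 1 / (2 * \<tau>))) (at (- 1 / (2 * \<tau>)))"
    by (rule holomorphic_derivI[OF f open_upper_half_plane W])
  then have "((\<lambda>\<tau>. f (- 1 / (2 * \<tau>))) has_field_derivative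
      deriv f (- 1 / (2 * \<tau>)) * (1 / (2 * \<tau>\<^sup>2))) (at \<tau>)"
    by (rule DERIV_chain2[where g = "\<lambda>\<tau>. - 1 / (2 * \<tau>)"])
       (use \<open>\<tau> \<noteq> 0\<close> in \<open>auto intro!: derivative_eq_intros simp: power2_eq_square\<close>)
  moreover have "((\<lambda>\<tau>. f (- 1 / (2 * \<tau>))) has_field_derivative g') (at \<tau>)"
    by (rule has_field_derivative_transform_within_open[OF g' open_upper_half_plane])
       (use assms(2) g in auto)
  ultimately have "deriv f (- 1 / (2 * \<tau>)) * (1 / (2 * \<tau>\<^sup>2)) = g'" by (rule DERIV_unique)
  then show ?thesis using \<open>\<tau> \<noteq> 0\<close> by (auto simp: field_simps)
qed

lemma deriv_compose_nome:
  assumes "h holomorphic_on ball 0 1" "Im \<tau> > 0"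
  shows "deriv (\<lambda>\<tau>. h (nome \<tau>)) \<tau> = 2 * of_real pi * \<i> * (nome \<tau> * deriv h (nome \<tau>))"
  by (rule DERIV_imp_deriv) (rule has_field_derivative_compose_nome[OF assms])

lemma upper_half_plane_deriv:
  assumes "f holomorphic_on {\<tau>. Im \<tau> > 0}" "Im \<tau> > 0"
  shows "(f has_field_derivative deriv f \<tau>) (at \<tau>)"
  by (rule holomorphic_derivI[OF assms(1) open_upper_half_plane]) (use assms in simp)

text \<open>The derivative of a form of weight 2 fails to be modular by a term linear in the form,
  and a multiple of \<open>E_fun \<tau> * J_fun \<tau>\<close> removes it. What is left has weight 4
  and sign -1, like a - 64 b, and the constant terms match.\<close>

theorem deriv_J_fun:
  assumes "Im \<tau> > 0"
  shows "(J_fun has_field_derivative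
     of_real pi * \<i> / 2 * (E_fun \<tau> * J_fun \<tau> - (form_a \<tau> - 64 * form_b \<tau>))) (at \<tau>)"
proof -
  define h where "h = (\<lambda>q. 2 * of_real pi * \<i> * (q * deriv qJ q)
    - of_real pi * \<i> / 2 * (qE q * qJ q - (qa q - 64 * qb q)))"
  have h: "h (nome \<tau>) = deriv J_fun \<tau>
      - of_real pi * \<i> / 2 * (E_fun \<tau> * J_fun \<tau> - (form_a \<tau> - 64 * form_b \<tau>))" if "Im \<tau> > 0" for \<tau>
    unfolding h_def q_expansions[abs_def] deriv_compose_nome[OF q_holomorphic(2) that] ..
  have "h (nome \<tau>) = 0"
  proof (rule weight_vanishing_1[where k = 2])
    show "norm (h (nome (- 1 / (2 * \<tau>)))) = norm (2 * \<tau>\<^sup>2) ^ 2 * norm (h (nome \<tau>))" if "Im \<tau> > 0" for \<tau>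
    proof -
      have "\<tau> \<noteq> 0" using that by auto
      have "((\<lambda>\<tau>. - 2 * \<tau>\<^sup>2 * J_fun \<tau>) has_field_derivative
          (- 4 * \<tau> * J_fun \<tau> - 2 * \<tau>\<^sup>2 * deriv J_fun \<tau>)) (at \<tau>)"
        by (auto intro!: derivative_eq_intros upper_half_plane_deriv forms_holomorphic that)
      from deriv_fricke[OF forms_holomorphic(1) that J_fun_fricke this]
      have d: "deriv J_fun (- 1 / (2 * \<tau>)) = 2 * \<tau>\<^sup>2 * (- 4 * \<tau> * J_fun \<tau> - 2 * \<tau>\<^sup>2 * deriv J_fun \<tau>)" .
      have "h (nome (- 1 / (2 * \<tau>))) = - ((2 * \<tau>\<^sup>2) ^ 2 * h (nome \<tau>))"
        unfolding h[OF that] h[OF Im_fricke_pos[OF that]] d J_fun_fricke[OF that] E_fun_fricke[OF that]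
          form_a_fricke[OF that] form_b_fricke[OF that]
        using \<open>\<tau> \<noteq> 0\<close> by (simp add: field_simps eval_nat_numeral)
      then show ?thesis by (simp only: norm_minus_cancel norm_mult norm_power)
    qed
  qed (use assms in \<open>auto simp: h_def intro!: holomorphic_intros holomorphic_deriv q_holomorphic\<close>)
  then have "deriv J_fun \<tau> = of_real pi * \<i> / 2 * (E_fun \<tau> * J_fun \<tau> - (form_a \<tau> - 64 * form_b \<tau>))"
    unfolding h[OF assms] by simp
  with upper_half_plane_deriv[OF forms_holomorphic(1) assms] show ?thesis by simp
qed

text \<open>The inhomogeneous terms of E cancel between its derivative and its square; what is left
  has weight 4 and sign +1 and agrees with a multiple of J^2 at the cusp.\<close>

theorem deriv_E_fun:
  assumes "Im \<tau> > 0"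
  shows "(E_fun has_field_derivative of_real pi * \<i> / 4 * (E_fun \<tau> ^ 2 - J_fun \<tau> ^ 2)) (at \<tau>)"
proof -
  define h where "h = (\<lambda>q. 2 * of_real pi * \<i> * (q * deriv qE q)
    - of_real pi * \<i> / 4 * (qE q ^ 2 - qJ q ^ 2))"
  have h: "h (nome \<tau>) = deriv E_fun \<tau>
      - of_real pi * \<i> / 4 * (E_fun \<tau> ^ 2 - J_fun \<tau> ^ 2)" if "Im \<tau> > 0" for \<tau>
    unfolding h_def q_expansions[abs_def] deriv_compose_nome[OF q_holomorphic(3) that] ..
  have "h (nome \<tau>) = 0"
  proof (rule weight_vanishing_1[where k = 2])
    show "norm (h (nome (- 1 / (2 * \<tau>)))) = norm (2 * \<tau>\<^sup>2) ^ 2 * norm (h (nome \<tau>))" if "Im \<tau> > 0" for \<tau>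
    proof -
      have "\<tau> \<noteq> 0" using that by auto
      have "((\<lambda>\<tau>. 2 * \<tau>\<^sup>2 * E_fun \<tau> - 8 * \<i> * \<tau> / of_real pi) has_field_derivative
          (4 * \<tau> * E_fun \<tau> + 2 * \<tau>\<^sup>2 * deriv E_fun \<tau> - 8 * \<i> / of_real pi)) (at \<tau>)"
        by (auto intro!: derivative_eq_intros upper_half_plane_deriv forms_holomorphic that)
      from deriv_fricke[OF forms_holomorphic(2) that E_fun_fricke this]
      have d: "deriv E_fun (- 1 / (2 * \<tau>)) = 2 * \<tau>\<^sup>2 *
          (4 * \<tau> * E_fun \<tau> + 2 * \<tau>\<^sup>2 * deriv E_fun \<tau> - 8 * \<i> / of_real pi)" .
      have "h (nome (- 1 / (2 * \<tau>))) = (2 * \<tau>\<^sup>2) ^ 2 * h (nome \<tau>)"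
        unfolding h[OF that] h[OF Im_fricke_pos[OF that]] d J_fun_fricke[OF that] E_fun_fricke[OF that]
        using \<open>\<tau> \<noteq> 0\<close> by (simp add: field_simps eval_nat_numeral)
      then show ?thesis by (simp only: norm_mult norm_power)
    qed
  qed (use assms in \<open>auto simp: h_def intro!: holomorphic_intros holomorphic_deriv q_holomorphic\<close>)
  then have "deriv E_fun \<tau> = of_real pi * \<i> / 4 * (E_fun \<tau> ^ 2 - J_fun \<tau> ^ 2)"
    unfolding h[OF assms] by simp
  with upper_half_plane_deriv[OF forms_holomorphic(2) assms] show ?thesis by simp
qed

lemma has_field_derivative_eta8_double:
  assumes "Im \<tau> > 0"
  shows "((\<lambda>\<tau>. eta8 (2 * \<tau>)) has_field_derivative
           (4 * of_real pi * \<i> / 3 * Eis2 (2 * \<tau>) * eta8 (2 * \<tau>))) (at \<tau>)"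
proof -
  have "((\<lambda>\<tau>. eta8 (2 * \<tau>)) has_field_derivative
           (2 * of_real pi * \<i> / 3 * Eis2 (2 * \<tau>) * eta8 (2 * \<tau>)) * 2) (at \<tau>)"
    by (rule DERIV_chain2[where f = eta8 and g = "\<lambda>\<tau>. 2 * \<tau>"], rule has_field_derivative_eta8)
       (use assms in \<open>auto intro!: derivative_eq_intros\<close>)
  then show ?thesis by (simp add: field_simps)
qed

lemma deriv_form_a:
  assumes "Im \<tau> > 0"
  shows "(form_a has_field_derivative of_real pi * \<i> * (E_fun \<tau> - J_fun \<tau>) * form_a \<tau>) (at \<tau>)"
proof -
  have nz: "eta8 (2 * \<tau>) \<noteq> 0" using assms by (simp add: eta8_nonzero)
  have "((\<lambda>\<tau>. eta8 \<tau> ^ 2 / eta8 (2 * \<tau>)) has_field_derivative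
      (2 * eta8 \<tau> * (2 * of_real pi * \<i> / 3 * Eis2 \<tau> * eta8 \<tau>) * eta8 (2 * \<tau>)
        - eta8 \<tau> ^ 2 * (4 * of_real pi * \<i> / 3 * Eis2 (2 * \<tau>) * eta8 (2 * \<tau>)))
      / (eta8 (2 * \<tau>) * eta8 (2 * \<tau>))) (at \<tau>)"
    using DERIV_divide[OF DERIV_power[OF has_field_derivative_eta8[OF assms], of 2]
        has_field_derivative_eta8_double[OF assms] nz] by (simp add: mult_ac)
  then show ?thesis
    unfolding form_a_def[abs_def]
    by (rule DERIV_cong)
       (use nz in \<open>simp add: E_fun_def J_fun_def field_simps power2_eq_square\<close>)
qed

lemma deriv_form_b:
  assumes "Im \<tau> > 0"
  shows "(form_b has_field_derivative of_real pi * \<i> * (E_fun \<tau> + J_fun \<tau>) * form_b \<tau>) (at \<tau>)"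
proof -
  have nz: "eta8 \<tau> \<noteq> 0" using assms by (simp add: eta8_nonzero)
  have "((\<lambda>\<tau>. eta8 (2 * \<tau>) ^ 2 / eta8 \<tau>) has_field_derivative
      (2 * eta8 (2 * \<tau>) * (4 * of_real pi * \<i> / 3 * Eis2 (2 * \<tau>) * eta8 (2 * \<tau>)) * eta8 \<tau>
        - eta8 (2 * \<tau>) ^ 2 * (2 * of_real pi * \<i> / 3 * Eis2 \<tau> * eta8 \<tau>))
      / (eta8 \<tau> * eta8 \<tau>)) (at \<tau>)"
    using DERIV_divide[OF DERIV_power[OF has_field_derivative_eta8_double[OF assms], of 2]
        has_field_derivative_eta8[OF assms] nz] by (simp add: mult_ac)
  then show ?thesis
    unfolding form_b_def[abs_def]
    by (rule DERIV_cong)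
       (use nz in \<open>simp add: E_fun_def J_fun_def field_simps power2_eq_square\<close>)
qed

text \<open>The involution takes E_6(\<tau>) to 8 E_6(2 \<tau>), not to a multiple of itself.
  Therefore \<open>f\<close> is paired with \<open>g\<close>, the analogous difference for 2 \<tau>,
  and the criterion is applied to f + 8 g and f - 8 g, which have signs +1 and -1.\<close>

theorem Eis6_eq_forms:
  assumes "Im \<tau> > 0"
  shows "Eis6 \<tau> = J_fun \<tau> * (form_a \<tau> - 512 * form_b \<tau>)"
proof -
  obtain c :: complex where c: "\<And>\<tau>. Im \<tau> > 0 \<Longrightarrow>
      c - 504 * sigma_series 5 (- 1 / \<tau>) = \<tau> ^ 6 * (c - 504 * sigma_series 5 \<tau>)"
    using Eis6_modular_up_to_constant by blast
  define X where "X = (\<lambda>\<tau>. c - 504 * sigma_series 5 \<tau>)"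
  define f where "f = (\<lambda>\<tau>. X \<tau> - c * J_fun \<tau> * (form_a \<tau> - 512 * form_b \<tau>))"
  define g where "g = (\<lambda>\<tau>. X (2 * \<tau>) - c * J_fun \<tau> * (form_a \<tau> - 8 * form_b \<tau>))"
  have X1: "X (- 1 / \<tau>) = \<tau> ^ 6 * X \<tau>" if "Im \<tau> > 0" for \<tau>
    using c[OF that] by (simp add: X_def)
  have X2: "X (- 1 / (2 * \<tau>)) = 64 * \<tau> ^ 6 * X (2 * \<tau>)" if "Im \<tau> > 0" for \<tau>
    using X1[of "2 * \<tau>"] that by (simp add: power_mult_distrib)
  have fW: "f (- 1 / (2 * \<tau>)) = 64 * \<tau> ^ 6 * g \<tau>" if "Im \<tau> > 0" for \<tau>
    unfolding f_def g_def X2[OF that] J_fun_fricke[OF that] form_a_fricke[OF that] form_b_fricke[OF that]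
    by (simp add: field_simps eval_nat_numeral)
  have gW: "g (- 1 / (2 * \<tau>)) = \<tau> ^ 6 * f \<tau>" if "Im \<tau> > 0" for \<tau>
    unfolding f_def g_def fricke_double X1[OF that] J_fun_fricke[OF that] form_a_fricke[OF that]
      form_b_fricke[OF that]
    by (simp add: field_simps eval_nat_numeral)
  define hf where "hf = (\<lambda>q. (c - 504 * sigma_fun 5 q) - c * qJ q * (qa q - 512 * qb q))"
  define hg where "hg = (\<lambda>q. (c - 504 * sigma_fun 5 (q\<^sup>2)) - c * qJ q * (qa q - 8 * qb q))"
  have hfg: "f \<tau> = hf (nome \<tau>)" "g \<tau> = hg (nome \<tau>)" for \<tau>
    by (simp_all add: f_def g_def hf_def hg_def X_def q_expansions sigma_series_eq nome_double)
  have sq: "(\<lambda>q. q\<^sup>2) ` ball (0::complex) 1 \<subseteq> ball 0 1"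
    by (auto simp: norm_power power_less_one_iff abs_square_less_1)
  have holo: "hf holomorphic_on ball 0 1" "hg holomorphic_on ball 0 1"
  proof -
    have "(\<lambda>q. sigma_fun 5 (q\<^sup>2)) holomorphic_on ball 0 1"
      using holomorphic_on_compose_gen[OF _ sigma_fun_holomorphic[of 5] sq]
      by (simp add: o_def holomorphic_intros)
    then show "hf holomorphic_on ball 0 1" "hg holomorphic_on ball 0 1"
      unfolding hf_def hg_def by (auto intro!: holomorphic_intros q_holomorphic sigma_fun_holomorphic)
  qed
  have h0: "hf 0 = 0" "hg 0 = 0" by (simp_all add: hf_def hg_def)
  have p6: "norm (2 * \<tau>\<^sup>2 :: complex) ^ 3 * norm x = norm (8 * \<tau> ^ 6 * x)" for \<tau> x :: complex
    by (simp add: norm_mult norm_power power_mult_distrib flip: power_mult)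
  have plus: "hf (nome \<tau>) + 8 * hg (nome \<tau>) = 0" if "Im \<tau> > 0" for \<tau>
  proof (rule weight_vanishing_1[where k = 3 and h = "\<lambda>q. hf q + 8 * hg q"])
    show "norm (hf (nome (- 1 / (2 * \<tau>))) + 8 * hg (nome (- 1 / (2 * \<tau>))))
        = norm (2 * \<tau>\<^sup>2) ^ 3 * norm (hf (nome \<tau>) + 8 * hg (nome \<tau>))" if "Im \<tau> > 0" for \<tau>
      unfolding hfg [symmetric] fW[OF that] gW[OF that] p6
      by (rule arg_cong[of _ _ norm]) (simp add: algebra_simps)
  qed (use holo h0 that in \<open>auto intro!: holomorphic_intros\<close>)
  have minus: "hf (nome \<tau>) - 8 * hg (nome \<tau>) = 0" if "Im \<tau> > 0" for \<tau>
  proof (rule weight_vanishing_1[where k = 3 and h = "\<lambda>q. hf q - 8 * hg q"])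
    show "norm (hf (nome (- 1 / (2 * \<tau>))) - 8 * hg (nome (- 1 / (2 * \<tau>))))
        = norm (2 * \<tau>\<^sup>2) ^ 3 * norm (hf (nome \<tau>) - 8 * hg (nome \<tau>))" if "Im \<tau> > 0" for \<tau>
      unfolding hfg [symmetric] fW[OF that] gW[OF that] p6
      by (subst norm_minus_cancel [symmetric], rule arg_cong[of _ _ norm]) (simp add: algebra_simps)
  qed (use holo h0 that in \<open>auto intro!: holomorphic_intros\<close>)
  have hf0: "hf (nome \<tau>) = 0" if "Im \<tau> > 0" for \<tau>
    using plus[OF that] minus[OF that] by (simp add: algebra_simps) 
  have d: "(h has_field_derivative deriv h 0) (at 0)" if "h holomorphic_on ball 0 1" for h :: "complex \<Rightarrow> complex"
    by (rule holomorphic_derivI[OF that]) auto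
  \<comment> \<open>The coefficients of q: 24 for J and 1 for b give 48 - 64 = -16 for a, so the
    right side has c (24 - 16 - 512) = -504 c against -504 from sigma_5.\<close>
  have "c = 1"
  proof -
    have h2: "(\<lambda>q. qJ q ^ 2 - (qa q + 64 * qb q)) holomorphic_on ball 0 1"
      by (intro holomorphic_intros q_holomorphic)
    have "deriv (\<lambda>q. qJ q ^ 2 - (qa q + 64 * qb q)) 0 = 0"
      by (rule eq_0_on_disc(2)[OF h2]) (simp_all add: J_squared flip: q_expansions)
    moreover have "((\<lambda>q. qJ q ^ 2 - (qa q + 64 * qb q)) has_field_derivative
        (2 * deriv qJ 0 - (deriv qa 0 + 64 * deriv qb 0))) (at 0)"
      by (auto intro!: derivative_eq_intros d q_holomorphic)
    ultimately have eq1: "deriv qa 0 = 2 * deriv qJ 0 - 64 * deriv qb 0"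
      by (simp add: DERIV_imp_deriv)
    have E2: "deriv qE2 0 = -24"
      unfolding qE2_def by (rule DERIV_imp_deriv)
        (auto intro!: derivative_eq_intros d sigma_fun_holomorphic simp: deriv_sigma_fun_0[of 1, simplified])
    have "((\<lambda>q. qE2 (q\<^sup>2)) has_field_derivative deriv qE2 (0\<^sup>2) * 0) (at 0)"
      by (rule DERIV_chain2[where g = "\<lambda>q. q\<^sup>2"])
         (use d[OF q_holomorphic(1)] in \<open>auto intro!: derivative_eq_intros\<close>)
    then have "(qJ has_field_derivative 2 * 0 - deriv qE2 0) (at 0)"
      unfolding qJ_def[abs_def] by (intro DERIV_diff DERIV_cmult d q_holomorphic) simp
    then have J: "deriv qJ 0 = 24" using E2 by (simp add: DERIV_imp_deriv)
    have "isCont euler_fun 0" "isCont euler_fun (0\<^sup>2)"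
      using euler_fun_holomorphic by (auto intro!: continuous_on_interior[OF holomorphic_on_imp_continuous_on])
    then have "isCont (\<lambda>q. euler_fun (q\<^sup>2) ^ 16 / euler_fun q ^ 8) 0"
      by (intro continuous_intros isCont_o2[of "0::complex" "\<lambda>q. q\<^sup>2" euler_fun]) simp_all
    then have "(\<lambda>q. euler_fun (q\<^sup>2) ^ 16 / euler_fun q ^ 8) \<midarrow>0\<rightarrow> 1"
      by (simp add: isCont_def)
    then have "(\<lambda>q. (qb q - qb 0) / (q - 0)) \<midarrow>0\<rightarrow> 1"
      by (rule LIM_equal[THEN iffD1, rotated]) (simp add: qb_def)
    then have "(qb has_field_derivative 1) (at 0)"
      by (simp only: has_field_derivative_iff)
    then have b: "deriv qb 0 = 1" by (rule DERIV_imp_deriv)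
    have "deriv hf 0 = 0" by (rule eq_0_on_disc(2)[OF holo(1) hf0]) auto
    moreover have "(hf has_field_derivative
        (0 - 504 * 1 - ((c * deriv qJ 0) * (1 - 512 * 0) + (deriv qa 0 - 512 * deriv qb 0) * (c * 1)))) (at 0)"
      unfolding hf_def
      by (rule derivative_eq_intros d q_holomorphic sigma_fun_holomorphic | simp)+
         (simp add: deriv_sigma_fun_0)
    ultimately have "504 = 504 * c"
      using eq1 J b by (simp add: DERIV_imp_deriv algebra_simps)
    then show "c = 1" by simp
  qed
  then show ?thesis using hf0[OF assms] by (simp add: hf_def Eis6_eq sigma_series_eq q_expansions)
qed

corollary numerator_form:
  assumes "Im \<tau> > 0"
  shows "8 * J_fun \<tau> ^ 3 + Eis6 \<tau> = 9 * J_fun \<tau> * form_a \<tau>"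
proof -
  have "8 * J_fun \<tau> ^ 3 + Eis6 \<tau> = J_fun \<tau> * (8 * J_fun \<tau> ^ 2 + (form_a \<tau> - 512 * form_b \<tau>))"
    by (simp add: Eis6_eq_forms[OF assms] algebra_simps power2_eq_square power3_eq_cube)
  also have "\<dots> = 9 * J_fun \<tau> * form_a \<tau>"
    unfolding J_squared[OF assms] by (simp add: algebra_simps)
  finally show ?thesis .
qed


section \<open>Sums over quadratic forms\<close>

lemma infsum_holomorphic_on_ball:
  fixes f :: "'a \<Rightarrow> complex \<Rightarrow> complex"
  assumes "\<And>x. x \<in> X \<Longrightarrow> f x holomorphic_on S" "cball z r \<subseteq> S"
    and "\<And>x w. x \<in> X \<Longrightarrow> w \<in> cball z r \<Longrightarrow> norm (f x w) \<le> M x" "M summable_on X"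
  shows "(\<lambda>w. \<Sum>\<^sub>\<infinity>x\<in>X. f x w) holomorphic_on ball z r"
proof (rule holomorphic_uniform_limit)
  show "uniform_limit (cball z r) (\<lambda>A w. \<Sum>x\<in>A. f x w) (\<lambda>w. \<Sum>\<^sub>\<infinity>x\<in>X. f x w) (finite_subsets_at_top X)"
    by (rule Weierstrass_m_test_general) (use assms in auto)
  show "\<forall>\<^sub>F A in finite_subsets_at_top X. continuous_on (cball z r) (\<lambda>w. \<Sum>x\<in>A. f x w)
      \<and> (\<lambda>w. \<Sum>x\<in>A. f x w) holomorphic_on ball z r"
  proof (rule eventually_finite_subsets_at_top_weakI)
    fix A assume A: "A \<subseteq> X"
    have "(\<lambda>w. \<Sum>x\<in>A. f x w) holomorphic_on cball z r"
      by (intro holomorphic_on_sum holomorphic_on_subset[OF assms(1) assms(2)]) (use A in auto)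
    then show "continuous_on (cball z r) (\<lambda>w. \<Sum>x\<in>A. f x w)
      \<and> (\<lambda>w. \<Sum>x\<in>A. f x w) holomorphic_on ball z r"
      using holomorphic_on_imp_continuous_on holomorphic_on_subset[OF _ ball_subset_cball] by blast
  qed
qed (use assms in auto)

definition form_sum :: "int \<Rightarrow> int \<Rightarrow> complex \<Rightarrow> complex" where
  "form_sum d r \<tau> = (\<Sum>\<^sub>\<infinity>Q\<in>level2_forms d r. inverse (qf_at Q \<tau> ^ 3))"

lemma qf_at_eq [simp]: "qf_at (a, b, c) \<tau> = of_int a * \<tau>\<^sup>2 + of_int b * \<tau> + of_int c"
  by (simp add: qf_at_def)

lemma holomorphic_on_qf_at [holomorphic_intros]: "qf_at Q holomorphic_on A"
  by (cases Q) (auto simp: qf_at_def intro!: holomorphic_intros)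

text \<open>Both discriminants are treated at once. The bound \<bar>d\<bar> \<le> 8 keeps
  \<bar>d\<bar> below half of the threshold 16 used in the estimates, with equality allowed, and
  makes the reduction of forms descend; the condition on r makes the residue class of b stable under
  b -> -b.\<close>

locale level2 =
  fixes d r :: int
  assumes d: "- 8 \<le> d" "d < 0" and r: "[2 * r = 0] (mod 4)"
begin

abbreviation "forms \<equiv> level2_forms d r"

lemma forms_iff:
  "(a, b, c) \<in> forms \<longleftrightarrow> a > 0 \<and> b\<^sup>2 - 4 * a * c = d \<and> 2 dvd a \<and> [b = r] (mod 4)"
  by (simp add: level2_forms_def)

lemma discriminant_identity:
  assumes "(a, b, c) \<in> forms"
  shows "4 * of_int a * qf_at (a, b, c) \<tau> = (of_int (2 * a) * \<tau> + of_int b)\<^sup>2 - of_int d"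
proof -
  have "d = b\<^sup>2 - 4 * a * c" using assms by (simp add: forms_iff)
  then have "(of_int d :: complex) = of_int b ^ 2 - 4 * of_int a * of_int c" by simp
  then show ?thesis by (simp add: algebra_simps power2_eq_square)
qed

text \<open>With w = 2 a \<tau> + b one has 4 a Q = w^2 - d, and \<bar>d\<bar> \<le> 8 uses up at
  most half of \<bar>w\<bar>^2. Then \<bar>w\<bar> \<ge> 2 a Im \<tau> trades one factor
  \<bar>w\<bar> against the a on the left.\<close>

lemma qf_at_lower_bound:
  assumes Q: "(a, b, c) \<in> forms" and \<tau>: "Im \<tau> > 0"
    and w: "16 \<le> cmod (of_int (2 * a) * \<tau> + of_int b) ^ 2"
  shows "cmod (of_int (2 * a) * \<tau> + of_int b) * Im \<tau> / 4 \<le> cmod (qf_at (a, b, c) \<tau>)"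
proof -
  define x where "x = cmod (of_int (2 * a) * \<tau> + of_int b)"
  have a: "a > 0" using Q by (simp add: forms_iff)
  have "x ^ 2 - \<bar>real_of_int d\<bar> \<le> cmod ((of_int (2 * a) * \<tau> + of_int b)\<^sup>2 - of_int d)"
    using norm_triangle_ineq2[of "(of_int (2 * a) * \<tau> + of_int b)\<^sup>2" "of_int d"]
    by (simp add: x_def norm_power)
  also have "\<dots> = 4 * of_int a * cmod (qf_at (a, b, c) \<tau>)"
    unfolding discriminant_identity[OF Q, symmetric] using a by (simp add: norm_mult del: qf_at_eq)
  finally have 1: "x ^ 2 - \<bar>real_of_int d\<bar> \<le> 4 * of_int a * cmod (qf_at (a, b, c) \<tau>)" .
  have "x ^ 2 / 2 \<le> x ^ 2 - \<bar>real_of_int d\<bar>" using w d by (simp add: x_def)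
  moreover have "2 * of_int a * Im \<tau> \<le> x"
    using abs_Im_le_cmod[of "of_int (2 * a) * \<tau> + of_int b"] by (simp add: x_def)
  then have "x * (2 * of_int a * Im \<tau>) \<le> x ^ 2"
    unfolding power2_eq_square by (intro mult_left_mono) (auto simp: x_def)
  ultimately have "of_int a * (x * Im \<tau>) \<le> of_int a * (4 * cmod (qf_at (a, b, c) \<tau>))"
    using 1 by (simp add: mult_ac del: qf_at_eq)
  then have "x * Im \<tau> \<le> 4 * cmod (qf_at (a, b, c) \<tau>)" using a by (simp del: qf_at_eq)
  then show ?thesis by (simp add: x_def del: qf_at_eq)
qed

definition majorant :: "int \<times> int \<times> int \<Rightarrow> real" where
  "majorant = (\<lambda>(a, b, c). inverse ((1 + \<bar>real_of_int (2 * a)\<bar> + \<bar>real_of_int b\<bar>) ^ 3))"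

text \<open>The number of forms with given \<open>a\<close> and \<open>b\<close> is at most one, so the sum is dominated by a lattice sum.\<close>

lemma summable_majorant: "majorant summable_on forms"
proof -
  let ?\<phi> = "\<lambda>(a::int, b::int, c::int). (2 * a, b)"
  have inj: "inj_on ?\<phi> forms"
    by (auto simp: inj_on_def forms_iff)
  have "(\<lambda>(m::int, n::int). inverse ((1 + \<bar>real_of_int m\<bar> + \<bar>real_of_int n\<bar>) ^ 3)) summable_on ?\<phi> ` forms"
    by (rule summable_on_subset_banach[OF summable_on_lattice]) simp
  then show ?thesis
    unfolding summable_on_reindex[OF inj] by (simp add: majorant_def o_def case_prod_unfold)
qed

lemma inverse_cube_bound:
  assumes Q: "(a, b, c) \<in> forms" and y0: "y0 > 0" "X \<ge> 0" "\<bar>Re \<tau>\<bar> \<le> X" "y0 \<le> Im \<tau>"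
    and w: "16 \<le> cmod (of_int (2 * a) * \<tau> + of_int b) ^ 2"
  shows "norm (inverse (qf_at (a, b, c) \<tau> ^ 3))
           \<le> (4 / Im \<tau>) ^ 3 * ((2 * (1 + (X + 1) / y0)) ^ 3 * majorant (a, b, c))"
proof -
  define x where "x = cmod (of_int (2 * a) * \<tau> + of_int b)"
  have y: "Im \<tau> > 0" using y0 by simp
  have x: "x > 0" using w by (auto simp: x_def)
  have "(x * Im \<tau> / 4) ^ 3 \<le> cmod (qf_at (a, b, c) \<tau>) ^ 3"
    using qf_at_lower_bound[OF Q y w] x y unfolding x_def [symmetric] by (intro power_mono) auto
  then have "inverse (cmod (qf_at (a, b, c) \<tau>) ^ 3) \<le> inverse ((x * Im \<tau> / 4) ^ 3)"
    using x y by (intro le_imp_inverse_le) auto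
  also have "\<dots> = (4 / Im \<tau>) ^ 3 * inverse (x ^ 3)"
    using x y by (simp add: field_simps)
  also have "\<dots> \<le> (4 / Im \<tau>) ^ 3 * ((2 * (1 + (X + 1) / y0)) ^ 3 * majorant (a, b, c))"
    using lattice_inverse_cube_bound[OF y0, of "2 * a" b] y
    unfolding majorant_def x_def by (intro mult_left_mono) auto
  finally show ?thesis by (simp add: norm_inverse norm_power del: qf_at_eq)
qed

lemma finite_roots:
  assumes "Q \<in> forms"
  shows "finite {\<tau>. qf_at Q \<tau> = 0}"
proof -
  obtain a b c where Q: "Q = (a, b, c)" by (cases Q)
  have "finite {\<tau>. poly [:of_int c, of_int b, of_int a :: complex:] \<tau> = 0}"
    by (rule poly_roots_finite) (use assms in \<open>auto simp: Q forms_iff\<close>)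
  moreover have "poly [:of_int c, of_int b, of_int a:] \<tau> = qf_at Q \<tau>" for \<tau>
    by (simp add: Q power2_eq_square algebra_simps)
  ultimately show ?thesis by simp
qed

text \<open>Forms with large \<bar>2 a\<bar> + \<bar>b\<bar> satisfy \<bar>2 a \<tau> + b\<bar>
  \<ge> 4 uniformly near z, hence have no zero there, and their sum converges normally. Finitely
  many remain: those vanishing at z are kept as the singular part, the others go into G once the
  radius avoids their roots.\<close>

lemma local_expansion:
  assumes z: "Im z > 0"
  obtains \<epsilon> G where "\<epsilon> > 0" "ball z \<epsilon> \<subseteq> {\<tau>. Im \<tau> > 0}" "finite {Q \<in> forms. qf_at Q z = 0}"
    "G holomorphic_on ball z \<epsilon>" "\<And>\<tau>. \<tau> \<in> ball z \<epsilon> - {z} \<Longrightarrow> \<tau> \<notin> form_roots d r"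
    "\<And>\<tau>. \<tau> \<in> ball z \<epsilon> \<Longrightarrow> form_sum d r \<tau> = (\<Sum>Q | Q \<in> forms \<and> qf_at Q z = 0. inverse (qf_at Q \<tau> ^ 3)) + G \<tau>"
    "\<And>\<tau>. \<tau> \<in> ball z \<epsilon> \<Longrightarrow> (\<lambda>Q. inverse (qf_at Q \<tau> ^ 3)) summable_on forms"
proof -
  define y0 X K where "y0 = Im z / 2" and "X = \<bar>Re z\<bar> + Im z / 2" and "K = 1 + (X + 1) / y0"
  have pos: "y0 > 0" "X \<ge> 0" "K > 0" using z by (auto simp: y0_def X_def K_def intro!: add_pos_nonneg divide_nonneg_nonneg)
  \<comment> \<open>By the lattice bound, \<bar>2 a\<bar> + \<bar>b\<bar> \<ge> 4 K gives \<bar>2 a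
    \<tau> + b\<bar> \<ge> 4, whose square is the threshold 16.\<close>
  define N where "N = \<lceil>4 * K\<rceil>"
  define B0 where "B0 = {(a, b, c) \<in> forms. \<bar>2 * a\<bar> + \<bar>b\<bar> \<le> N}"
  have region: "\<bar>Re \<tau>\<bar> \<le> X" "y0 \<le> Im \<tau>" if "\<tau> \<in> cball z y0" for \<tau>
    using abs_Re_le_cmod[of "z - \<tau>"] abs_Im_le_cmod[of "z - \<tau>"] that
    by (auto simp: X_def y0_def dist_norm)
  have fin: "finite B0"
  proof (rule finite_subset)
    have "inj_on (\<lambda>(a::int, b::int, c::int). (a, b)) B0"
      by (auto simp: inj_on_def B0_def forms_iff)
    moreover have "(\<lambda>(a::int, b::int, c::int). (a, b)) ` B0 \<subseteq> {- N..N} \<times> {- N..N}"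
      by (auto simp: B0_def)
    then have "finite ((\<lambda>(a::int, b::int, c::int). (a, b)) ` B0)"
      by (rule finite_subset) auto
    ultimately show "finite B0" by (rule finite_imageD[rotated])
  qed auto
  have large: "16 \<le> cmod (of_int (2 * a) * \<tau> + of_int b) ^ 2"
    if "(a, b, c) \<in> forms - B0" "\<tau> \<in> cball z y0" for a b c \<tau>
  proof -
    have "\<bar>2 * a\<bar> + \<bar>b\<bar> > N" using that by (auto simp: B0_def)
    then have "4 * K \<le> real_of_int (\<bar>2 * a\<bar> + \<bar>b\<bar>)" unfolding N_def by linarith
    also have "\<dots> \<le> K * cmod (of_int (2 * a) * \<tau> + of_int b)"
      unfolding K_def by (rule lattice_norm_lower_bound[OF pos(1,2) region[OF that(2)]])
    finally have "4 \<le> cmod (of_int (2 * a) * \<tau> + of_int b)" using pos by simp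
    from power_mono[OF this, of 2] show ?thesis by simp
  qed
  have nz: "qf_at Q \<tau> \<noteq> 0" if "Q \<in> forms - B0" "\<tau> \<in> cball z y0" for Q \<tau>
  proof -
    obtain a b c where Q: "Q = (a, b, c)" by (cases Q)
    have y: "Im \<tau> > 0" using region[OF that(2)] pos by simp
    have l: "16 \<le> cmod (of_int (2 * a) * \<tau> + of_int b) ^ 2" using large that Q by blast
    have "0 < cmod (of_int (2 * a) * \<tau> + of_int b) * Im \<tau> / 4"
      using l y by (intro divide_pos_pos mult_pos_pos) auto
    also have "\<dots> \<le> cmod (qf_at Q \<tau>)"
      unfolding Q by (rule qf_at_lower_bound) (use that Q l y in auto)
    finally show ?thesis by auto
  qed
  define M where "M = (\<lambda>Q. (4 / y0) ^ 3 * ((2 * K) ^ 3 * majorant Q))"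
  have M: "M summable_on A" if "A \<subseteq> forms" for A
    unfolding M_def
    by (intro summable_on_cmult_right summable_on_subset_banach[OF summable_majorant that])
  have le: "norm (inverse (qf_at Q \<tau> ^ 3)) \<le> M Q" if "Q \<in> forms - B0" "\<tau> \<in> cball z y0" for Q \<tau>
  proof -
    obtain a b c where Q: "Q = (a, b, c)" by (cases Q)
    have "norm (inverse (qf_at Q \<tau> ^ 3)) \<le> (4 / Im \<tau>) ^ 3 * ((2 * K) ^ 3 * majorant Q)"
      unfolding Q K_def by (rule inverse_cube_bound) (use pos region large that Q in auto)
    also have "\<dots> \<le> M Q"
      unfolding M_def using pos region[OF that(2)]
      by (intro mult_right_mono power_mono divide_left_mono mult_nonneg_nonneg)
         (auto simp: majorant_def Q)
    finally show ?thesis .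
  qed
  define G0 where "G0 = (\<lambda>\<tau>. \<Sum>\<^sub>\<infinity>Q\<in>forms - B0. inverse (qf_at Q \<tau> ^ 3))"
  have G0: "G0 holomorphic_on ball z y0"
    unfolding G0_def
  proof (rule infsum_holomorphic_on_ball[where S = "cball z y0"])
    show "(\<lambda>\<tau>. inverse (qf_at Q \<tau> ^ 3)) holomorphic_on cball z y0" if "Q \<in> forms - B0" for Q
      using nz[OF that] by (intro holomorphic_intros) auto
    show "norm (inverse (qf_at Q \<tau> ^ 3)) \<le> M Q" if "Q \<in> forms - B0" "\<tau> \<in> cball z y0" for Q \<tau>
      using that by (rule le)
    show "M summable_on forms - B0" by (rule M) auto
  qed auto
  have sum0: "(\<lambda>Q. inverse (qf_at Q \<tau> ^ 3)) summable_on (forms - B0)" if "\<tau> \<in> cball z y0" for \<tau>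
    by (rule abs_summable_summable, rule summable_on_comparison_test[OF M[OF Diff_subset]])
       (auto intro: le[OF _ that] simp del: qf_at_eq)
  \<comment> \<open>The roots of the finitely many exceptional forms, apart from z itself; the
    radius is chosen to avoid them.\<close>
  define A where "A = (\<Union>Q\<in>B0. {\<tau>. qf_at Q \<tau> = 0}) - {z}"
  have "finite A" using fin finite_roots by (auto simp: A_def B0_def)
  then have "open (- A)" using finite_imp_closed by (auto simp: open_Compl)
  moreover have "z \<in> - A" by (simp add: A_def)
  ultimately obtain \<epsilon>1 where \<epsilon>1: "\<epsilon>1 > 0" "ball z \<epsilon>1 \<subseteq> - A" by (meson openE)
  define \<epsilon> where "\<epsilon> = min \<epsilon>1 y0"
  have \<epsilon>: "\<epsilon> > 0" "ball z \<epsilon> \<subseteq> - A" "ball z \<epsilon> \<subseteq> ball z y0"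
    using \<epsilon>1 pos by (auto simp: \<epsilon>_def)
  let ?B = "{Q \<in> forms. qf_at Q z = 0}"
  have zc: "z \<in> cball z y0" using pos by simp
  have B: "?B \<subseteq> B0" using nz[OF _ zc] by blast
  define G where "G = (\<lambda>\<tau>. (\<Sum>Q\<in>B0 - ?B. inverse (qf_at Q \<tau> ^ 3)) + G0 \<tau>)"
  have nz': "qf_at Q \<tau> \<noteq> 0" if "Q \<in> B0 - ?B" "\<tau> \<in> ball z \<epsilon>" for Q \<tau>
  proof (cases "\<tau> = z")
    case False
    then show ?thesis using that \<epsilon>(2) by (auto simp: A_def)
  next
    case True
    then show ?thesis using that by (auto simp: B0_def)
  qed
  show ?thesis
  proof (rule that[of \<epsilon> G])
    show "\<epsilon> > 0" by fact
    show "ball z \<epsilon> \<subseteq> {\<tau>. Im \<tau> > 0}"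
    proof
      fix \<tau> assume "\<tau> \<in> ball z \<epsilon>"
      then have "\<tau> \<in> cball z y0" using \<epsilon>(3) by auto
      from region(2)[OF this] show "\<tau> \<in> {\<tau>. Im \<tau> > 0}" using pos by simp
    qed
    show "finite ?B" using fin B by (rule finite_subset[rotated])
    have "G0 holomorphic_on ball z \<epsilon>" by (rule holomorphic_on_subset[OF G0 \<epsilon>(3)])
    then show "G holomorphic_on ball z \<epsilon>"
      unfolding G_def using nz' by (intro holomorphic_intros) auto
    show "\<tau> \<notin> form_roots d r" if \<tau>: "\<tau> \<in> ball z \<epsilon> - {z}" for \<tau>
    proof
      assume "\<tau> \<in> form_roots d r"
      then obtain Q where Q: "Q \<in> forms" "qf_at Q \<tau> = 0" by (auto simp: form_roots_def)
      moreover have "\<tau> \<in> cball z y0" "\<tau> \<notin> A" using \<tau> \<epsilon> by auto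
      ultimately show False using nz[of Q \<tau>] \<tau> by (auto simp: A_def)
    qed
    fix \<tau> assume \<tau>: "\<tau> \<in> ball z \<epsilon>"
    then have \<tau>': "\<tau> \<in> cball z y0" using \<epsilon>(3) by auto
    have "B0 \<subseteq> forms" by (auto simp: B0_def)
    then have forms: "forms = B0 \<union> (forms - B0)" by auto
    show "(\<lambda>Q. inverse (qf_at Q \<tau> ^ 3)) summable_on forms"
      by (subst forms) (intro summable_on_Un_disjoint summable_on_finite fin sum0 \<tau>', auto)
    have "form_sum d r \<tau> = (\<Sum>\<^sub>\<infinity>Q\<in>B0 \<union> (forms - B0). inverse (qf_at Q \<tau> ^ 3))"
      using forms by (simp add: form_sum_def)
    also have "\<dots> = (\<Sum>Q\<in>B0. inverse (qf_at Q \<tau> ^ 3)) + G0 \<tau>"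
      unfolding G0_def
      by (subst infsum_Un_disjoint) (use fin sum0[OF \<tau>'] in auto)
    also have "(\<Sum>Q\<in>B0. inverse (qf_at Q \<tau> ^ 3))
        = (\<Sum>Q\<in>B0 - ?B. inverse (qf_at Q \<tau> ^ 3)) + (\<Sum>Q\<in>?B. inverse (qf_at Q \<tau> ^ 3))"
      by (rule sum.subset_diff[OF B fin])
    finally show "form_sum d r \<tau> = (\<Sum>Q | Q \<in> forms \<and> qf_at Q z = 0. inverse (qf_at Q \<tau> ^ 3)) + G \<tau>"
      by (simp add: G_def)
  qed
qed

lemma summable_form_sum:
  assumes "Im \<tau> > 0"
  shows "(\<lambda>Q. inverse (qf_at Q \<tau> ^ 3)) summable_on forms"
  using local_expansion[OF assms] by (metis centre_in_ball)

lemma eventually_not_root: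
  assumes "Im z > 0"
  shows "\<forall>\<^sub>F \<tau> in at z. \<tau> \<notin> form_roots d r"
proof -
  obtain \<epsilon> where "\<epsilon> > 0" "\<And>\<tau>. \<tau> \<in> ball z \<epsilon> - {z} \<Longrightarrow> \<tau> \<notin> form_roots d r"
    by (rule local_expansion[OF assms]) (rule that)
  then show ?thesis
    unfolding eventually_at by (auto simp: dist_commute)
qed

lemma form_sum_holomorphic_at:
  assumes "Im z > 0" "z \<notin> form_roots d r"
  shows "form_sum d r analytic_on {z}"
proof -
  obtain \<epsilon> G where *: "\<epsilon> > 0" "G holomorphic_on ball z \<epsilon>"
    "\<And>\<tau>. \<tau> \<in> ball z \<epsilon> \<Longrightarrow> form_sum d r \<tau> = (\<Sum>Q | Q \<in> forms \<and> qf_at Q z = 0. inverse (qf_at Q \<tau> ^ 3)) + G \<tau>"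
    by (rule local_expansion[OF assms(1)]) (rule that)
  have "{Q \<in> forms. qf_at Q z = 0} = {}" using assms(2) by (auto simp: form_roots_def)
  with * have "\<And>\<tau>. \<tau> \<in> ball z \<epsilon> \<Longrightarrow> G \<tau> = form_sum d r \<tau>" by simp
  with *(1,2) show ?thesis
    unfolding analytic_at_ball by (metis holomorphic_cong)
qed

lemma form_sum_meromorphic: "form_sum d r meromorphic_on {\<tau>. Im \<tau> > 0}"
  unfolding meromorphic_on_meromorphic_at[of _ "{\<tau>. Im \<tau> > 0}"]
proof
  fix z assume "z \<in> {\<tau>. Im \<tau> > 0}"
  then have z: "Im z > 0" by simp
  obtain \<epsilon> G where *: "\<epsilon> > 0" "G holomorphic_on ball z \<epsilon>"
    "\<And>\<tau>. \<tau> \<in> ball z \<epsilon> \<Longrightarrow> form_sum d r \<tau> = (\<Sum>Q | Q \<in> forms \<and> qf_at Q z = 0. inverse (qf_at Q \<tau> ^ 3)) + G \<tau>"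
    by (rule local_expansion[OF z]) (rule that)
  have "\<forall>\<^sub>F w in at z. w \<in> ball z \<epsilon>"
    using *(1) by (intro eventually_at_in_open') auto
  then have ev: "\<forall>\<^sub>F w in at z. form_sum d r w = (\<Sum>Q | Q \<in> forms \<and> qf_at Q z = 0. inverse (qf_at Q w ^ 3)) + G w"
    by eventually_elim (rule *(3))
  have "G analytic_on {z}" using * by (auto simp: analytic_at_ball)
  then have G: "G meromorphic_on {z}" by (rule analytic_on_imp_meromorphic_on)
  have Q: "qf_at Q meromorphic_on {z}" for Q
    by (rule analytic_on_imp_meromorphic_on) (auto simp: analytic_at intro!: holomorphic_intros exI[of _ UNIV])
  have "(\<lambda>w. (\<Sum>Q | Q \<in> forms \<and> qf_at Q z = 0. inverse (qf_at Q w ^ 3)) + G w) meromorphic_on {z}"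
    by (intro meromorphic_intros G Q)
  then show "form_sum d r meromorphic_on {z}"
    by (subst meromorphic_on_cong[OF _ refl]) (use ev in auto)
qed

text \<open>Translation permutes the forms by [a, b, c] -> [a, b + 2 a, a + b + c]; as a is even, 2
  a is divisible by 4 and the class of b modulo 4 is kept.\<close>

lemma form_sum_shift: "form_sum d r (\<tau> + 1) = form_sum d r \<tau>"
  unfolding form_sum_def
proof (rule infsum_reindex_bij_witness[where j = "\<lambda>(a, b, c). (a, b + 2 * a, a + b + c)"
      and i = "\<lambda>(a, b, c). (a, b - 2 * a, a - b + c)"])
  have cong: "[b + 2 * a * n = r] (mod 4) \<longleftrightarrow> [b = r] (mod 4)" if "2 dvd a" for a b n :: int
  proof -
    have "[b + 2 * a * n = b] (mod 4)" using that by (auto simp: cong_iff_dvd_diff elim!: dvdE)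
    then show ?thesis by (meson cong_sym cong_trans)
  qed
  show "(case Q of (a, b, c) \<Rightarrow> (a, b + 2 * a, a + b + c)) \<in> forms" if "Q \<in> forms" for Q
    using that cong[where n = 1] by (auto simp: forms_iff power2_eq_square algebra_simps split: prod.splits)
  show "(case Q of (a, b, c) \<Rightarrow> (a, b - 2 * a, a - b + c)) \<in> forms" if "Q \<in> forms" for Q
    using that cong[where n = "-1"] by (auto simp: forms_iff power2_eq_square algebra_simps split: prod.splits)
qed (auto simp: power2_eq_square algebra_simps)

text \<open>This is the action of the involution on forms. Negative d forces c > 0, evenness of a
  makes the new last coefficient integral, and -r is congruent to r modulo 4.\<close>

lemma fricke_form:
  assumes "(a, b, c) \<in> forms"
  shows "(2 * c, - b, a div 2) \<in> forms"
proof -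
  have *: "a > 0" "b\<^sup>2 - 4 * a * c = d" "2 dvd a" "[b = r] (mod 4)"
    using assms by (auto simp: forms_iff)
  have "0 < 4 * a * c" using *(2) d zero_le_power2[of b] by linarith
  then have "c > 0" using *(1) by (simp add: zero_less_mult_iff)
  moreover have "[- b = r] (mod 4)"
  proof -
    have "[- b = - r] (mod 4)" using *(4) by (simp add: cong_minus_minus_iff)
    moreover have "[- r = r] (mod 4)" using r by (simp add: cong_iff_dvd_diff)
    ultimately show ?thesis by (rule cong_trans)
  qed
  ultimately show ?thesis using * by (auto simp: forms_iff elim!: dvdE)
qed

lemma fricke_qf_at:
  assumes "(a, b, c) \<in> forms" "\<tau> \<noteq> 0"
  shows "qf_at (2 * c, - b, a div 2) \<tau> = 2 * \<tau>\<^sup>2 * qf_at (a, b, c) (- 1 / (2 * \<tau>))"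
proof -
  obtain k where "a = 2 * k" using assms by (auto simp: forms_iff elim!: dvdE)
  then show ?thesis using assms(2) by (simp add: field_simps power2_eq_square)
qed

lemma form_sum_fricke:
  assumes "Im \<tau> > 0"
  shows "form_sum d r (- 1 / (2 * \<tau>)) = (2 * \<tau>\<^sup>2) ^ 3 * form_sum d r \<tau>"
proof -
  have \<tau>: "\<tau> \<noteq> 0" using assms by auto
  have "form_sum d r (- 1 / (2 * \<tau>)) = (\<Sum>\<^sub>\<infinity>Q\<in>forms. (2 * \<tau>\<^sup>2) ^ 3 * inverse (qf_at Q \<tau> ^ 3))"
    unfolding form_sum_def
  proof (rule infsum_reindex_bij_witness[where j = "\<lambda>(a, b, c). (2 * c, - b, a div 2)"
        and i = "\<lambda>(a, b, c). (2 * c, - b, a div 2)"])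
    fix Q assume Q: "Q \<in> forms"
    obtain a b c where abc: "Q = (a, b, c)" by (cases Q)
    from Q show "(case Q of (a, b, c) \<Rightarrow> (2 * c, - b, a div 2)) \<in> forms"
      using fricke_form by (auto simp: abc)
    then show "(case Q of (a, b, c) \<Rightarrow> (2 * c, - b, a div 2)) \<in> forms" .
    show "(case case Q of (a, b, c) \<Rightarrow> (2 * c, - b, a div 2) of (a, b, c) \<Rightarrow> (2 * c, - b, a div 2)) = Q"
      using Q by (auto simp: abc forms_iff)
    then show "(case case Q of (a, b, c) \<Rightarrow> (2 * c, - b, a div 2) of (a, b, c) \<Rightarrow> (2 * c, - b, a div 2)) = Q" .
    have "qf_at (2 * c, - b, a div 2) \<tau> = 2 * \<tau>\<^sup>2 * qf_at (a, b, c) (- 1 / (2 * \<tau>))"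
      by (rule fricke_qf_at) (use Q abc \<tau> in auto)
    then show "(2 * \<tau>\<^sup>2) ^ 3 * inverse (qf_at (case Q of (a, b, c) \<Rightarrow> (2 * c, - b, a div 2)) \<tau> ^ 3)
        = inverse (qf_at Q (- 1 / (2 * \<tau>)) ^ 3)"
      using \<tau> by (simp add: abc power_mult_distrib del: qf_at_eq)
  qed
  also have "\<dots> = (2 * \<tau>\<^sup>2) ^ 3 * form_sum d r \<tau>"
    unfolding form_sum_def by (rule infsum_cmult_right) (rule summable_form_sum[OF assms])
  finally show ?thesis .
qed

text \<open>For Im \<tau> > 1 evenness gives a \<ge> 2, hence \<bar>2 a \<tau> + b\<bar> \<ge> 4,
  and no form is exceptional. The factor (4 / Im \<tau>)^3 supplies the decay, translation to
  \<bar>Re \<tau>\<bar> \<le> 1 the uniformity; 6 is 2 (1 + (X + 1)/y0) at X = y0 = 1.\<close>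

lemma cusp_bound:
  obtains C where "\<And>\<tau>. Im \<tau> > 1 \<Longrightarrow> norm (form_sum d r \<tau>) \<le> C / Im \<tau> ^ 3"
proof -
  define C where "C = 4 ^ 3 * (6 ^ 3 * infsum majorant forms)"
  have "norm (form_sum d r \<tau>) \<le> C / Im \<tau> ^ 3" if \<tau>: "Im \<tau> > 1" for \<tau>
  proof -
    define \<tau>' where "\<tau>' = \<tau> + of_int (- round (Re \<tau>))"
    have eq: "form_sum d r \<tau>' = form_sum d r \<tau>"
      unfolding \<tau>'_def by (rule periodic_shift_int[where f = "form_sum d r", OF form_sum_shift]) (use \<tau> in auto)
    have re: "\<bar>Re \<tau>'\<bar> \<le> 1"
      using of_int_round_abs_le[of "Re \<tau>"] by (simp add: \<tau>'_def abs_minus_commute)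
    have im: "Im \<tau>' = Im \<tau>" by (simp add: \<tau>'_def)
    have le: "norm (inverse (qf_at Q \<tau>' ^ 3)) \<le> (4 / Im \<tau>) ^ 3 * (6 ^ 3 * majorant Q)" if "Q \<in> forms" for Q
    proof -
      obtain a b c where Q: "Q = (a, b, c)" by (cases Q)
      have "a > 0" "2 dvd a" using that by (auto simp: Q forms_iff)
      then have "a \<ge> 2" by (auto elim!: dvdE)
      then have "4 * 1 \<le> of_int (2 * a) * Im \<tau>" using \<tau> by (intro mult_mono) auto
      also have "\<dots> \<le> cmod (of_int (2 * a) * \<tau>' + of_int b)"
        using abs_Im_le_cmod[of "of_int (2 * a) * \<tau>' + of_int b"] im by simp
      finally have "4 \<le> cmod (of_int (2 * a) * \<tau>' + of_int b)" by simp
      from power_mono[OF this, of 2] have "16 \<le> cmod (of_int (2 * a) * \<tau>' + of_int b) ^ 2" by simp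
      from inverse_cube_bound[of a b c 1 1 \<tau>', OF _ _ _ _ _ this] that Q re im \<tau>
      show ?thesis by simp
    qed
    have "norm (form_sum d r \<tau>') \<le> (\<Sum>\<^sub>\<infinity>Q\<in>forms. (4 / Im \<tau>) ^ 3 * (6 ^ 3 * majorant Q))"
      unfolding form_sum_def
      by (rule norm_infsum_le[OF has_sum_infsum has_sum_infsum])
         (use le summable_majorant \<tau> im in \<open>auto intro!: summable_form_sum summable_on_cmult_right\<close>)
    also have "\<dots> = (4 / Im \<tau>) ^ 3 * (6 ^ 3 * infsum majorant forms)"
      using summable_majorant by (simp add: infsum_cmult_right summable_on_cmult_right)
    also have "\<dots> = C / Im \<tau> ^ 3" by (simp add: C_def power_divide)
    finally show ?thesis by (simp add: eq)
  qed
  then show ?thesis by (rule that)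
qed

end


section \<open>Expansion at the cusp and removal of the poles\<close>

lemma nome_eq_imp_differ_by_int:
  assumes "nome w = nome z"
  obtains n :: int where "w = z + of_int n"
proof -
  from assms obtain n :: int where "2 * of_real pi * \<i> * w = 2 * of_real pi * \<i> * z + of_int (2 * n) * of_real pi * \<i>"
    unfolding nome_def by (auto simp: exp_eq)
  then have "2 * of_real pi * \<i> * w = 2 * of_real pi * \<i> * (z + of_int n)"
    by (simp add: algebra_simps)
  then have "w = z + of_int n" by simp
  then show ?thesis by (rule that)
qed

text \<open>A periodic function factors through \<open>nome\<close>. Away from q = 0 the factor is
  holomorphic because logarithms exist locally, and at q = 0 the singularity is removable because f
  tends to 0 at the cusp. The disc of radius exp(-2 pi) corresponds to Im \<tau> > 1.\<close>

lemma q_expansion_exists: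
  fixes f :: "complex \<Rightarrow> complex"
  assumes holo: "f holomorphic_on {\<tau>. Im \<tau> > 1}"
    and T: "\<And>\<tau>. f (\<tau> + 1) = f \<tau>"
    and cusp: "\<And>\<epsilon>. \<epsilon> > 0 \<Longrightarrow> \<exists>Y. \<forall>\<tau>. Im \<tau> > Y \<longrightarrow> norm (f \<tau>) < \<epsilon>"
  obtains h r where "r > 0" "h holomorphic_on ball 0 r" "h 0 = 0"
    "\<And>\<tau>. nome \<tau> \<in> ball 0 r \<Longrightarrow> Im \<tau> > 1 \<Longrightarrow> f \<tau> = h (nome \<tau>)"
proof -
  define r where "r = exp (- 2 * pi)"
  define L where "L = (\<lambda>q. Ln q / (2 * of_real pi * \<i>))"
  define h where "h = (\<lambda>q. if q = 0 then 0 else f (L q))"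
  have nomeL: "nome (L q) = q" if "q \<noteq> 0" for q
    using that by (simp add: L_def nome_def exp_Ln)
  have shift: "f w = f z" if eqn: "nome w = nome z" for w z
  proof -
    obtain n :: int where n: "w = z + of_int n" using nome_eq_imp_differ_by_int[OF eqn] by blast
    have *: "f (z + of_nat k) = f z" for z k
    proof (induction k)
      case (Suc k)
      have "z + of_nat (Suc k) = (z + of_nat k) + 1" by simp
      then show ?case using T[of "z + of_nat k"] Suc by (simp add: add_ac)
    qed simp
    show ?thesis
    proof (cases "n \<ge> 0")
      case True
      then have "of_int n = (of_nat (nat n) :: complex)" by simp
      then show ?thesis using *[of z "nat n"] n by simp
    next
      case False
      then have "z = w + of_nat (nat (- n))" using n by simp
      then show ?thesis using *[of w "nat (- n)"] by simp
    qed
  qed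
  have h_nome: "h (nome \<tau>) = f \<tau>" for \<tau>
    using shift[OF nomeL[of "nome \<tau>"]] by (simp add: h_def)
  have Im1: "Im \<tau> > 1" if "cmod (nome \<tau>) < r" for \<tau>
    using that by (simp add: norm_nome r_def)
  have "h holomorphic_on ball 0 r"
  proof (rule no_isolated_singularity'[where K = "{0}"])
    show "h holomorphic_on ball 0 r - {0}"
    proof (rule analytic_imp_holomorphic, rule analytic_on_analytic_at[THEN iffD2], rule ballI)
      fix q0 :: complex assume q0: "q0 \<in> ball 0 r - {0}"
      \<comment> \<open>The principal logarithm jumps on the negative axis; applied to q / q0, which
        stays in the right half-plane, it yields a branch near any q0, and by periodicity the choice
        of branch does not affect f.\<close>
      define M where "M = (\<lambda>q. L q0 + L (q / q0))"
      have nomeM: "nome (M q) = q" if "q \<noteq> 0" for q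
        using that q0 by (simp add: M_def nome_add nomeL)
      define S where "S = ball q0 (min (cmod q0) (r - cmod q0))"
      have S: "q \<noteq> 0" "cmod q < r" "q / q0 \<notin> \<real>\<^sub>\<le>\<^sub>0" if "q \<in> S" for q
      proof -
        have d: "cmod (q0 - q) < cmod q0" "cmod (q0 - q) < r - cmod q0" using that by (auto simp: S_def dist_norm)
        show "q \<noteq> 0" using d by auto
        show "cmod q < r" using norm_triangle_ineq2[of q q0] d by (simp add: norm_minus_commute)
        have "cmod (1 - q / q0) < 1"
        proof -
          have "1 - q / q0 = (q0 - q) / q0" using q0 by (simp add: field_simps)
          then show ?thesis using d q0 by (simp add: norm_divide)
        qed
        then have "Re (q / q0) > 0" using complex_Re_le_cmod[of "1 - q / q0"] by simp
        then show "q / q0 \<notin> \<real>\<^sub>\<le>\<^sub>0" by (auto elim!: nonpos_Reals_cases)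
      qed
      have "M holomorphic_on S"
        unfolding M_def L_def using S q0 by (intro holomorphic_intros) auto
      moreover have "M ` S \<subseteq> {\<tau>. Im \<tau> > 1}"
      proof (rule image_subsetI)
        fix q assume "q \<in> S"
        then have "cmod (nome (M q)) < r" using S nomeM by simp
        then show "M q \<in> {\<tau>. Im \<tau> > 1}" using Im1 by simp
      qed
      ultimately have "(f \<circ> M) holomorphic_on S"
        using holomorphic_on_compose_gen[OF _ holo] by blast
      then have "h holomorphic_on S"
      proof (rule holomorphic_transform)
        fix q assume q: "q \<in> S"
        show "(f \<circ> M) q = h q" using h_nome[of "M q"] nomeM S[OF q] by simp
      qed
      moreover have "open S" "q0 \<in> S" using q0 by (auto simp: S_def)
      ultimately show "h analytic_on {q0}" by (auto simp: analytic_at)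
    qed
    show "(h \<longlongrightarrow> h z) (at z within ball 0 r)" if "z \<in> {0}" for z
    proof -
      have "h \<midarrow>0\<rightarrow> 0"
      proof (rule LIM_I)
        fix \<epsilon> :: real assume "\<epsilon> > 0"
        then obtain Y where Y: "\<And>\<tau>. Im \<tau> > Y \<Longrightarrow> norm (f \<tau>) < \<epsilon>" using cusp by blast
        show "\<exists>s>0. \<forall>q. q \<noteq> 0 \<and> norm (q - 0) < s \<longrightarrow> norm (h q - 0) < \<epsilon>"
        proof (intro exI[of _ "exp (- 2 * pi * Y)"] conjI allI impI)
          fix q :: complex assume q: "q \<noteq> 0 \<and> norm (q - 0) < exp (- 2 * pi * Y)"
          then have "Im (L q) > Y" using norm_nome[of "L q"] nomeL[of q] by simp
          then show "norm (h q - 0) < \<epsilon>" using Y q by (simp add: h_def)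
        qed simp
      qed
      then show ?thesis using that by (auto simp: h_def intro: tendsto_within_subset)
    qed
  qed auto
  moreover have "r > 0" "h 0 = 0" by (simp_all add: r_def h_def)
  ultimately show ?thesis by (intro that[of r h]) (simp_all add: h_nome)
qed

text \<open>The values of f on R are not to be trusted, so the extension is defined as the limit of
  f at each point. Sparseness of R makes this limit agree with every local extension, which settles
  compatibility.\<close>

lemma holomorphic_gluing:
  fixes f :: "complex \<Rightarrow> complex"
  assumes sparse: "\<And>z. z \<in> S \<Longrightarrow> \<forall>\<^sub>F w in at z. w \<notin> R"
    and loc: "\<And>z. z \<in> S \<Longrightarrow> \<exists>\<epsilon>>0. \<exists>g. g holomorphic_on ball z \<epsilon> \<and> ball z \<epsilon> \<subseteq> S
                \<and> (\<forall>w\<in>ball z \<epsilon> - R. g w = f w)"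
  obtains g where "g holomorphic_on S" "\<And>w. w \<in> S - R \<Longrightarrow> g w = f w"
proof -
  define g where "g = (\<lambda>z. Lim (at z) f)"
  have eq: "g w = g' w" if g': "g' holomorphic_on ball z \<epsilon>" "ball z \<epsilon> \<subseteq> S"
      "\<forall>w\<in>ball z \<epsilon> - R. g' w = f w" and w: "w \<in> ball z \<epsilon>" for g' z \<epsilon> w
  proof -
    have "isCont g' w"
      by (rule continuous_on_interior[OF holomorphic_on_imp_continuous_on[OF g'(1)]]) (use w in auto)
    then have "g' \<midarrow>w\<rightarrow> g' w" by (simp add: isCont_def)
    have "\<forall>\<^sub>F u in at w. u \<in> ball z \<epsilon>"
      using w by (intro eventually_at_in_open') auto
    moreover have "\<forall>\<^sub>F u in at w. u \<notin> R" by (rule sparse) (use g'(2) w in auto)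
    ultimately have "\<forall>\<^sub>F u in at w. g' u = f u"
      by eventually_elim (use g'(3) in auto)
    with \<open>g' \<midarrow>w\<rightarrow> g' w\<close> have "f \<midarrow>w\<rightarrow> g' w" by (rule Lim_transform_eventually)
    then show ?thesis unfolding g_def by (intro tendsto_Lim) auto
  qed
  have "g holomorphic_on S"
  proof (rule analytic_imp_holomorphic, rule analytic_on_analytic_at[THEN iffD2], rule ballI)
    fix z assume "z \<in> S"
    from loc[OF this] obtain \<epsilon> g' where *: "\<epsilon> > 0" "g' holomorphic_on ball z \<epsilon>" "ball z \<epsilon> \<subseteq> S"
      "\<forall>w\<in>ball z \<epsilon> - R. g' w = f w" by blast
    have "g holomorphic_on ball z \<epsilon>"
      by (rule holomorphic_transform[OF *(2)]) (rule eq[OF *(2,3,4), symmetric])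
    then show "g analytic_on {z}" using *(1) by (auto simp: analytic_at_ball)
  qed
  moreover have "g w = f w" if "w \<in> S - R" for w
  proof -
    from loc[of w] that obtain \<epsilon> g' where *: "\<epsilon> > 0" "g' holomorphic_on ball w \<epsilon>" "ball w \<epsilon> \<subseteq> S"
      "\<forall>u\<in>ball w \<epsilon> - R. g' u = f u" by blast
    then show ?thesis using eq[OF *(2,3,4), of w] that by auto
  qed
  ultimately show ?thesis by (rule that)
qed

context level2
begin

lemma qf_at_factor:
  assumes "(a, b, c) \<in> forms" "Im z > 0" "qf_at (a, b, c) z = 0"
  shows "qf_at (a, b, c) w = of_int a * (w - z) * (w - cnj z)"
proof -
  have 1: "of_int a * z\<^sup>2 + of_int b * z + of_int c = 0" using assms by simp
  then have "cnj (of_int a * z\<^sup>2 + of_int b * z + of_int c) = cnj 0" by (simp only:)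
  then have 2: "of_int a * (cnj z)\<^sup>2 + of_int b * cnj z + of_int c = 0" by simp
  have "(z - cnj z) * (of_int a * (z + cnj z) + of_int b)
      = (of_int a * z\<^sup>2 + of_int b * z + of_int c) - (of_int a * (cnj z)\<^sup>2 + of_int b * cnj z + of_int c)"
    by (simp add: algebra_simps power2_eq_square)
  also have "\<dots> = 0" by (simp only: 1 2) simp
  finally have "of_int a * (z + cnj z) + of_int b = 0"
    using assms(2) by (auto simp: complex_eq_iff)
  then have b: "of_int b = - (of_int a * (z + cnj z))" by (simp add: eq_neg_iff_add_eq_0 add.commute)
  have c: "of_int c = of_int a * z * cnj z"
    using 1 unfolding b by (simp add: algebra_simps power2_eq_square)
  show ?thesis unfolding qf_at_eq b c by (simp add: algebra_simps power2_eq_square)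
qed

text \<open>Each form vanishing at a root z has simple zeros at z and at \<open>cnj z\<close>, and
  P(w) = (w - z) p(w) with p holomorphic; hence (P / Q)^3 extends over z.\<close>

lemma pole_clearing:
  assumes P: "P holomorphic_on {\<tau>. Im \<tau> > 0}"
    and zero: "\<And>\<tau>. Im \<tau> > 0 \<Longrightarrow> \<tau> \<in> form_roots d r \<Longrightarrow> P \<tau> = 0"
  obtains g where "g holomorphic_on {\<tau>. Im \<tau> > 0}"
    "\<And>\<tau>. Im \<tau> > 0 \<Longrightarrow> \<tau> \<notin> form_roots d r \<Longrightarrow> g \<tau> = form_sum d r \<tau> * P \<tau> ^ 3"
proof -
  have "\<exists>\<epsilon>>0. \<exists>g. g holomorphic_on ball z \<epsilon> \<and> ball z \<epsilon> \<subseteq> {\<tau>. Im \<tau> > 0}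
      \<and> (\<forall>w\<in>ball z \<epsilon> - form_roots d r. g w = form_sum d r w * P w ^ 3)"
    if z: "z \<in> {\<tau>. Im \<tau> > 0}" for z
  proof -
    let ?B = "{Q \<in> forms. qf_at Q z = 0}"
    have z': "Im z > 0" using z by simp
    obtain \<epsilon> G where *: "\<epsilon> > 0" "ball z \<epsilon> \<subseteq> {\<tau>. Im \<tau> > 0}" "G holomorphic_on ball z \<epsilon>"
      "\<And>\<tau>. \<tau> \<in> ball z \<epsilon> \<Longrightarrow> form_sum d r \<tau> = (\<Sum>Q\<in>?B. inverse (qf_at Q \<tau> ^ 3)) + G \<tau>"
      by (rule local_expansion[OF z']) (rule that)
    have P': "P holomorphic_on ball z \<epsilon>" using P *(2) by (rule holomorphic_on_subset)
    show ?thesis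
    proof (cases "?B = {}")
      case True
      have "(\<lambda>w. G w * P w ^ 3) holomorphic_on ball z \<epsilon>"
        by (intro holomorphic_intros * P')
      then show ?thesis using * True by (intro exI[of _ \<epsilon>] conjI exI[of _ "\<lambda>w. G w * P w ^ 3"]) auto
    next
      case False
      then have "z \<in> form_roots d r" unfolding form_roots_def by blast
      then have "P z = 0" by (rule zero[OF z'])
      define p where "p = (\<lambda>w. if w = z then deriv P z else (P w - P z) / (w - z))"
      have p: "p holomorphic_on ball z \<epsilon>"
        unfolding p_def by (rule pole_lemma[OF P']) (use *(1) in auto)
      have Pp: "P w = (w - z) * p w" for w using \<open>P z = 0\<close> by (simp add: p_def)
      define g where "g = (\<lambda>w. (\<Sum>Q\<in>?B. (p w / (of_int (fst Q) * (w - cnj z))) ^ 3) + G w * P w ^ 3)"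
      have nz: "w - cnj z \<noteq> 0" if "w \<in> ball z \<epsilon>" for w
        using that *(2) z' by (auto simp: complex_eq_iff dest!: subsetD[where c = w])
      have "g holomorphic_on ball z \<epsilon>"
        unfolding g_def using nz by (intro holomorphic_intros * P' p) (auto simp: forms_iff)
      moreover have "g w = form_sum d r w * P w ^ 3" if w: "w \<in> ball z \<epsilon> - form_roots d r" for w
      proof -
        have "(p w / (of_int (fst Q) * (w - cnj z))) ^ 3 = inverse (qf_at Q w ^ 3) * P w ^ 3" if Q: "Q \<in> ?B" for Q
        proof -
          obtain a b c where abc: "Q = (a, b, c)" by (cases Q)
          have "w \<noteq> z" using w Q by (auto simp: form_roots_def)
          have "qf_at Q w = of_int a * (w - z) * (w - cnj z)"
            unfolding abc by (rule qf_at_factor) (use Q abc z' in auto)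
          moreover have "a \<noteq> 0" using Q by (auto simp: abc forms_iff)
          moreover have "(p w / (A * v)) ^ 3 = inverse ((A * u * v) ^ 3) * (u * p w) ^ 3"
            if "u \<noteq> 0" "v \<noteq> 0" "A \<noteq> 0" for u v A using that by (simp add: field_simps)
          ultimately show ?thesis using \<open>w \<noteq> z\<close> nz[of w] w unfolding Pp by (simp add: abc del: qf_at_eq)
        qed
        then show ?thesis using *(4)[of w] w by (simp add: g_def sum_distrib_right distrib_right)
      qed
      ultimately show ?thesis using * by blast
    qed
  qed
  then show ?thesis
    using holomorphic_gluing[where S = "{\<tau>. Im \<tau> > 0}" and R = "form_roots d r"
        and f = "\<lambda>w. form_sum d r w * P w ^ 3"] eventually_not_root that by (metis (no_types, lifting) DiffI mem_Collect_eq)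
qed

text \<open>The roots are isolated, so continuity carries the identity over to them.\<close>

lemma eq_off_roots:
  assumes u: "u holomorphic_on {\<tau>. Im \<tau> > 0}" and v: "v holomorphic_on {\<tau>. Im \<tau> > 0}"
    and eq: "\<And>\<tau>. Im \<tau> > 0 \<Longrightarrow> \<tau> \<notin> form_roots d r \<Longrightarrow> u \<tau> = v \<tau>"
    and z: "Im z > 0"
  shows "u z = v z"
proof (rule tendsto_unique)
  have cont: "isCont f z" if "f holomorphic_on {\<tau>. Im \<tau> > 0}" for f :: "complex \<Rightarrow> complex"
    using that open_upper_half_plane z
    by (metis continuous_on_eq_continuous_at holomorphic_on_imp_continuous_on mem_Collect_eq)
  show "v \<midarrow>z\<rightarrow> v z" using cont[OF v] by (simp add: isCont_def)
  have "\<forall>\<^sub>F w in at z. w \<in> {\<tau>. Im \<tau> > 0}"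
    by (rule eventually_at_in_open') (use z open_upper_half_plane in auto)
  then have "\<forall>\<^sub>F w in at z. u w = v w"
    using eventually_not_root[OF z] by eventually_elim (use eq in auto)
  moreover have "u \<midarrow>z\<rightarrow> u z" using cont[OF u] by (simp add: isCont_def)
  ultimately show "v \<midarrow>z\<rightarrow> u z" by (rule Lim_transform_eventually[rotated])
qed simp

lemma form_roots_shift:
  assumes "\<tau> + 1 \<in> form_roots d r"
  shows "\<tau> \<in> form_roots d r"
proof -
  obtain a b c where Q: "(a, b, c) \<in> forms" "qf_at (a, b, c) (\<tau> + 1) = 0"
    using assms by (auto simp: form_roots_def)
  have "[b + 2 * a = b] (mod 4)" using Q(1) by (auto simp: forms_iff cong_iff_dvd_diff elim!: dvdE)
  then have "[b + 2 * a = r] (mod 4)" using Q(1) by (auto simp: forms_iff intro: cong_trans)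
  then have "(a, b + 2 * a, a + b + c) \<in> forms"
    using Q(1) by (auto simp: forms_iff power2_eq_square algebra_simps)
  moreover have "qf_at (a, b + 2 * a, a + b + c) \<tau> = qf_at (a, b, c) (\<tau> + 1)"
    by (simp add: power2_eq_square algebra_simps)
  ultimately show ?thesis using Q(2) by (auto simp: form_roots_def simp del: qf_at_eq)
qed

lemma form_roots_fricke:
  assumes "- 1 / (2 * \<tau>) \<in> form_roots d r" "Im \<tau> > 0"
  shows "\<tau> \<in> form_roots d r"
proof -
  obtain a b c where Q: "(a, b, c) \<in> forms" "qf_at (a, b, c) (- 1 / (2 * \<tau>)) = 0"
    using assms by (auto simp: form_roots_def)
  have "\<tau> \<noteq> 0" using assms by auto
  from fricke_form[OF Q(1)] fricke_qf_at[OF Q(1) this] Q(2) show ?thesis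
    by (auto simp: form_roots_def simp del: qf_at_eq)
qed

text \<open>Off the roots, which translation and involution permute, the laws follow from those of
  the factors, and they extend by continuity. The sum has sign +1 and P has sign -1, cubed; the
  exponent 3 k + 3 collects weight 6 k from P^3 and 6 from the sum.\<close>

lemma pole_clearing_invariant:
  assumes P: "P holomorphic_on {\<tau>. Im \<tau> > 0}"
    and zero: "\<And>\<tau>. Im \<tau> > 0 \<Longrightarrow> \<tau> \<in> form_roots d r \<Longrightarrow> P \<tau> = 0"
    and T: "\<And>\<tau>. Im \<tau> > 0 \<Longrightarrow> P (\<tau> + 1) = P \<tau>"
    and W: "\<And>\<tau>. Im \<tau> > 0 \<Longrightarrow> P (- 1 / (2 * \<tau>)) = - ((2 * \<tau>\<^sup>2) ^ k * P \<tau>)"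
  obtains g where "g holomorphic_on {\<tau>. Im \<tau> > 0}"
    "\<And>\<tau>. Im \<tau> > 0 \<Longrightarrow> \<tau> \<notin> form_roots d r \<Longrightarrow> g \<tau> = form_sum d r \<tau> * P \<tau> ^ 3"
    "\<And>\<tau>. Im \<tau> > 0 \<Longrightarrow> g (\<tau> + 1) = g \<tau>"
    "\<And>\<tau>. Im \<tau> > 0 \<Longrightarrow> g (- 1 / (2 * \<tau>)) = - ((2 * \<tau>\<^sup>2) ^ (3 * k + 3) * g \<tau>)"
proof -
  obtain g where g: "g holomorphic_on {\<tau>. Im \<tau> > 0}"
    "\<And>\<tau>. Im \<tau> > 0 \<Longrightarrow> \<tau> \<notin> form_roots d r \<Longrightarrow> g \<tau> = form_sum d r \<tau> * P \<tau> ^ 3"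
    using pole_clearing[OF P zero] by blast
  have "g (\<tau> + 1) = g \<tau>" if "Im \<tau> > 0" for \<tau>
  proof (rule eq_off_roots[where u = "\<lambda>\<tau>. g (\<tau> + 1)" and v = g, OF _ g(1) _ that])
    have "(g \<circ> (\<lambda>\<tau>. \<tau> + 1)) holomorphic_on {\<tau>. Im \<tau> > 0}"
      by (rule holomorphic_on_compose_gen[OF _ g(1)]) (auto intro!: holomorphic_intros)
    then show "(\<lambda>\<tau>. g (\<tau> + 1)) holomorphic_on {\<tau>. Im \<tau> > 0}" by (simp add: o_def)
    show "g (\<tau> + 1) = g \<tau>" if "Im \<tau> > 0" "\<tau> \<notin> form_roots d r" for \<tau>
      using g(2)[of "\<tau> + 1"] g(2)[OF that] form_roots_shift[of \<tau>] that T[OF that(1)] form_sum_shift by auto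
  qed
  moreover have "g (- 1 / (2 * \<tau>)) = - ((2 * \<tau>\<^sup>2) ^ (3 * k + 3) * g \<tau>)" if "Im \<tau> > 0" for \<tau>
  proof (rule eq_off_roots[where u = "\<lambda>\<tau>. g (- 1 / (2 * \<tau>))"
        and v = "\<lambda>\<tau>. - ((2 * \<tau>\<^sup>2) ^ (3 * k + 3) * g \<tau>)", OF _ _ _ that])
    have "(g \<circ> (\<lambda>\<tau>. - 1 / (2 * \<tau>))) holomorphic_on {\<tau>. Im \<tau> > 0}"
    proof (rule holomorphic_on_compose_gen[OF _ g(1)])
      show "(\<lambda>\<tau>. - 1 / (2 * \<tau>)) ` {\<tau>. Im \<tau> > 0} \<subseteq> {\<tau>. Im \<tau> > 0}"
        using Im_fricke_pos by auto
    qed (auto intro!: holomorphic_intros)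
    then show "(\<lambda>\<tau>. g (- 1 / (2 * \<tau>))) holomorphic_on {\<tau>. Im \<tau> > 0}" by (simp add: o_def)
    show "(\<lambda>\<tau>. - ((2 * \<tau>\<^sup>2) ^ (3 * k + 3) * g \<tau>)) holomorphic_on {\<tau>. Im \<tau> > 0}"
      by (intro holomorphic_intros g)
    show "g (- 1 / (2 * \<tau>)) = - ((2 * \<tau>\<^sup>2) ^ (3 * k + 3) * g \<tau>)" if "Im \<tau> > 0" "\<tau> \<notin> form_roots d r" for \<tau>
    proof -
      have "- 1 / (2 * \<tau>) \<notin> form_roots d r" using form_roots_fricke that by blast
      then have "g (- 1 / (2 * \<tau>)) = (2 * \<tau>\<^sup>2) ^ 3 * form_sum d r \<tau> * (- ((2 * \<tau>\<^sup>2) ^ k * P \<tau>)) ^ 3"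
        using g(2)[OF Im_fricke_pos[OF that(1)]] form_sum_fricke[OF that(1)] W[OF that(1)] by simp
      also have "\<dots> = - ((2 * \<tau>\<^sup>2) ^ (3 * k + 3) * (form_sum d r \<tau> * P \<tau> ^ 3))"
      proof -
        have "x ^ 3 * s * (- (x ^ k * p)) ^ 3 = - (x ^ (3 * k + 3) * (s * p ^ 3))" for x s p :: complex
        proof -
          have "x ^ (3 * k + 3) = x ^ 3 * (x ^ k) ^ 3" by (simp add: power_add power_mult mult.commute)
          then show ?thesis by (simp add: power_mult_distrib mult_ac)
        qed
        then show ?thesis .
      qed
      finally show ?thesis using g(2)[OF that] by simp
    qed
  qed
  ultimately show ?thesis using g that by blast
qed

text \<open>A root in the upper half-plane has imaginary part sqrt \<bar>d\<bar> / (2 a) \<le> sqrt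
  8 / 4. Above height 1 no pole disturbs the expansion at the cusp.\<close>

lemma root_Im_le_1:
  assumes "\<tau> \<in> form_roots d r"
  shows "Im \<tau> \<le> 1"
proof (rule ccontr)
  assume "\<not> Im \<tau> \<le> 1"
  then have \<tau>: "Im \<tau> > 1" by simp
  obtain a b c where Q: "(a, b, c) \<in> forms" "qf_at (a, b, c) \<tau> = 0"
    using assms by (auto simp: form_roots_def)
  have "a > 0" "2 dvd a" using Q by (auto simp: forms_iff)
  then have "a \<ge> 2" by (auto elim!: dvdE)
  then have "4 * 1 \<le> of_int (2 * a) * Im \<tau>" using \<tau> by (intro mult_mono) auto
  also have "\<dots> \<le> cmod (of_int (2 * a) * \<tau> + of_int b)"
    using abs_Im_le_cmod[of "of_int (2 * a) * \<tau> + of_int b"] by simp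
  finally have l: "4 \<le> cmod (of_int (2 * a) * \<tau> + of_int b)" by simp
  from power_mono[OF this, of 2] have "16 \<le> cmod (of_int (2 * a) * \<tau> + of_int b) ^ 2" by simp
  from qf_at_lower_bound[OF Q(1) _ this] \<tau> have "cmod (of_int (2 * a) * \<tau> + of_int b) * Im \<tau> \<le> 0"
    unfolding Q(2) by simp
  moreover have "0 < cmod (of_int (2 * a) * \<tau> + of_int b) * Im \<tau>"
    using l \<tau> by (intro mult_pos_pos) auto
  ultimately show False by simp
qed

lemma form_sum_q_expansion:
  obtains h \<rho> where "\<rho> > 0" "h holomorphic_on ball 0 \<rho>" "h 0 = 0"
    "\<And>\<tau>. nome \<tau> \<in> ball 0 \<rho> \<Longrightarrow> Im \<tau> > 1 \<Longrightarrow> form_sum d r \<tau> = h (nome \<tau>)"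
proof (rule q_expansion_exists[of "form_sum d r"])
  show "form_sum d r holomorphic_on {\<tau>. Im \<tau> > 1}"
    by (rule analytic_imp_holomorphic, rule analytic_on_analytic_at[THEN iffD2])
       (use form_sum_holomorphic_at root_Im_le_1 in force)
  show "form_sum d r (\<tau> + 1) = form_sum d r \<tau>" for \<tau> by (rule form_sum_shift)
  show "\<exists>Y. \<forall>\<tau>. Im \<tau> > Y \<longrightarrow> norm (form_sum d r \<tau>) < \<epsilon>" if \<epsilon>: "\<epsilon> > 0" for \<epsilon>
  proof -
    obtain C where C: "\<And>\<tau>. Im \<tau> > 1 \<Longrightarrow> norm (form_sum d r \<tau>) \<le> C / Im \<tau> ^ 3"
      using cusp_bound by blast
    show ?thesis
    proof (intro exI[of _ "max 1 (C / \<epsilon>)"] allI impI)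
      fix \<tau> assume \<tau>: "Im \<tau> > max 1 (C / \<epsilon>)"
      then have "C < \<epsilon> * Im \<tau>" using \<epsilon> by (simp add: field_simps)
      also have "\<dots> \<le> \<epsilon> * Im \<tau> ^ 3"
        using \<epsilon> \<tau> self_le_power[of "Im \<tau>" 3] by (intro mult_left_mono) auto
      finally have "C / Im \<tau> ^ 3 < \<epsilon>" using \<tau> by (simp add: field_simps)
      then show "norm (form_sum d r \<tau>) < \<epsilon>" using C[of \<tau>] \<tau> by simp
    qed
  qed
qed (use that in blast)

text \<open>Translations make \<open>\<bar>b\<bar> \<le> a\<close>; for \<open>a \<ge> 4\<close> the involution then replaces \<open>a\<close> by \<open>2c < a\<close>.\<close>

lemma root_induct:
  assumes T: "\<And>\<tau>. Im \<tau> > 0 \<Longrightarrow> P (\<tau> + 1) \<longleftrightarrow> P \<tau>"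
    and W: "\<And>\<tau>. Im \<tau> > 0 \<Longrightarrow> P (- 1 / (2 * \<tau>)) \<Longrightarrow> P \<tau>"
    and base: "\<And>b c \<tau>. (2, b, c) \<in> forms \<Longrightarrow> \<bar>b\<bar> \<le> 2 \<Longrightarrow> Im \<tau> > 0 \<Longrightarrow> qf_at (2, b, c) \<tau> = 0 \<Longrightarrow> P \<tau>"
    and "\<tau> \<in> form_roots d r" "Im \<tau> > 0"
  shows "P \<tau>"
proof -
  have "P \<tau>" if "(a, b, c) \<in> forms" "qf_at (a, b, c) \<tau> = 0" "Im \<tau> > 0" for a b c \<tau>
    using that
  proof (induction "nat a" arbitrary: a b c \<tau> rule: less_induct)
    case less
    have abc: "a > 0" "b\<^sup>2 - 4 * a * c = d" "2 dvd a" "[b = r] (mod 4)"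
      using less.prems by (auto simp: forms_iff)
    define n where "n = - round (of_int b / (2 * of_int a) :: real)"
    define b' c' where "b' = b + 2 * a * n" and "c' = a * n\<^sup>2 + b * n + c"
    define \<tau>' where "\<tau>' = \<tau> - of_int n"
    have \<tau>': "Im \<tau>' > 0" using less.prems by (simp add: \<tau>'_def)
    have P: "P \<tau>' \<longleftrightarrow> P \<tau>"
      unfolding \<tau>'_def using periodic_shift_int[where f = P, OF T, of \<tau> "- n"] less.prems by simp
    have "[b' = b] (mod 4)" using abc(3) by (auto simp: b'_def cong_iff_dvd_diff elim!: dvdE)
    then have b'r: "[b' = r] (mod 4)" using abc(4) by (rule cong_trans)
    have disc: "b'\<^sup>2 - 4 * a * c' = d"
      using abc(2) by (simp add: b'_def c'_def power2_eq_square algebra_simps)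
    have Q: "(a, b', c') \<in> forms" using abc b'r disc by (simp add: forms_iff)
    have root: "qf_at (a, b', c') \<tau>' = 0"
      using less.prems(2) by (simp add: b'_def c'_def \<tau>'_def power2_eq_square algebra_simps)
    have b': "\<bar>b'\<bar> \<le> a"
    proof -
      have "\<bar>of_int b / (2 * of_int a) + of_int n :: real\<bar> \<le> 1/2"
        using of_int_round_abs_le[of "of_int b / (2 * of_int a) :: real"] by (simp add: n_def abs_minus_commute)
      then have "\<bar>of_int b' / (2 * of_int a) :: real\<bar> \<le> 1/2"
        using abc(1) by (simp add: b'_def add_divide_distrib)
      then have "\<bar>of_int b' :: real\<bar> \<le> of_int a" using abc(1) by (simp add: field_simps)
      then show ?thesis by linarith
    qed
    have "P \<tau>'"
    proof (cases "a = 2")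
      case True
      then show ?thesis using base[of b' c' \<tau>'] Q b' \<tau>' root by simp
    next
      case False
      then have "a \<ge> 4" using abc by (auto elim!: dvdE)
      have "\<tau>' \<noteq> 0" using \<tau>' by auto
      have W': "Im (- 1 / (2 * \<tau>')) > 0" by (rule Im_fricke_pos[OF \<tau>'])
      then have "- 1 / (2 * \<tau>') \<noteq> 0" by auto
      from fricke_qf_at[OF Q this]
      have root': "qf_at (2 * c', - b', a div 2) (- 1 / (2 * \<tau>')) = 0"
        using root \<open>\<tau>' \<noteq> 0\<close> by (simp del: qf_at_eq)
      have "b'\<^sup>2 \<le> a\<^sup>2" using b' by (simp add: abs_le_square_iff [symmetric])
      then have "4 * a * c' \<le> a * a + 8" using disc d by (simp add: power2_eq_square)
      moreover have "4 * 4 \<le> a * a" using \<open>a \<ge> 4\<close> by (intro mult_mono) auto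
      ultimately have "a * (2 * c') < a * a" by (simp add: algebra_simps)
      then have "2 * c' < a" using abc(1) by simp
      then have "nat (2 * c') < nat a" using abc(1) by simp
      from less.hyps[OF this fricke_form[OF Q] root' W'] W[OF \<tau>'] show ?thesis by blast
    qed
    with P show ?case by simp
  qed
  then show ?thesis using assms(4,5) by (auto simp: form_roots_def simp del: qf_at_eq)
qed

end


context level2
begin

text \<open>When a single form vanishes at z, the singular part is one explicit term and all others
  are absorbed in a function holomorphic at z.\<close>

lemma clearing_local:
  assumes z: "Im z > 0" and Q: "{Q \<in> forms. qf_at Q z = 0} = {Q0}"
    and g: "\<And>\<tau>. Im \<tau> > 0 \<Longrightarrow> \<tau> \<notin> form_roots d r \<Longrightarrow> g \<tau> = form_sum d r \<tau> * P \<tau> ^ 3"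
  obtains \<epsilon> G where "\<epsilon> > 0" "G holomorphic_on ball z \<epsilon>"
    "\<And>w. w \<in> ball z \<epsilon> - {z} \<Longrightarrow> qf_at Q0 w \<noteq> 0"
    "\<And>w. w \<in> ball z \<epsilon> - {z} \<Longrightarrow> g w = (P w / qf_at Q0 w) ^ 3 + G w * P w ^ 3"
proof -
  obtain \<epsilon> G where *: "\<epsilon> > 0" "ball z \<epsilon> \<subseteq> {\<tau>. Im \<tau> > 0}" "G holomorphic_on ball z \<epsilon>"
    "\<And>\<tau>. \<tau> \<in> ball z \<epsilon> - {z} \<Longrightarrow> \<tau> \<notin> form_roots d r"
    "\<And>\<tau>. \<tau> \<in> ball z \<epsilon> \<Longrightarrow> form_sum d r \<tau> = (\<Sum>Q | Q \<in> forms \<and> qf_at Q z = 0. inverse (qf_at Q \<tau> ^ 3)) + G \<tau>"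
    by (rule local_expansion[OF z]) (rule that)
  show ?thesis
  proof (rule that[OF *(1,3)])
    fix w assume w: "w \<in> ball z \<epsilon> - {z}"
    have "Q0 \<in> forms" using Q by auto
    then show "qf_at Q0 w \<noteq> 0" using *(4)[OF w] by (auto simp: form_roots_def simp del: qf_at_eq)
    have "form_sum d r w = inverse (qf_at Q0 w ^ 3) + G w" using *(5)[of w] w by (simp add: Q)
    then show "g w = (P w / qf_at Q0 w) ^ 3 + G w * P w ^ 3"
      using g[of w] *(2,4) w by (auto simp: distrib_right power_divide inverse_eq_divide)
  qed
qed

text \<open>As w tends to z, the quotient of P by the form tends to the quotient of derivatives, and
  the regular part dies with P^3. The value of g at z itself is reached by continuity, its formula
  being available off the roots only.\<close>

lemma clearing_value:
  assumes z: "Im z > 0" and Q: "{Q \<in> forms. qf_at Q z = 0} = {Q0}"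
    and g: "\<And>\<tau>. Im \<tau> > 0 \<Longrightarrow> \<tau> \<notin> form_roots d r \<Longrightarrow> g \<tau> = form_sum d r \<tau> * P \<tau> ^ 3"
    and "g holomorphic_on {\<tau>. Im \<tau> > 0}"
    and P: "(P has_field_derivative P') (at z)" "P z = 0"
    and Q0: "(qf_at Q0 has_field_derivative Q') (at z)" "Q' \<noteq> 0"
  shows "g z = (P' / Q') ^ 3"
proof (rule tendsto_unique)
  obtain \<epsilon> G where *: "\<epsilon> > 0" "G holomorphic_on ball z \<epsilon>"
    "\<And>w. w \<in> ball z \<epsilon> - {z} \<Longrightarrow> qf_at Q0 w \<noteq> 0"
    "\<And>w. w \<in> ball z \<epsilon> - {z} \<Longrightarrow> g w = (P w / qf_at Q0 w) ^ 3 + G w * P w ^ 3"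
    by (rule clearing_local[OF z Q g]) (assumption | rule that)+
  have "qf_at Q0 z = 0" using Q by auto
  then have 1: "(\<lambda>w. (P w / (w - z)) / (qf_at Q0 w / (w - z))) \<midarrow>z\<rightarrow> P' / Q'"
    using P(1) Q0(1) unfolding has_field_derivative_iff \<open>P z = 0\<close>
    by (intro tendsto_divide Q0(2)) simp_all
  have "isCont G z"
    by (rule continuous_on_interior[OF holomorphic_on_imp_continuous_on[OF *(2)]]) (use *(1) in auto)
  then have 2: "G \<midarrow>z\<rightarrow> G z" by (simp add: isCont_def)
  have "isCont P z" using P(1) by (rule DERIV_isCont)
  then have 3: "P \<midarrow>z\<rightarrow> 0" using P(2) by (simp add: isCont_def)
  have "(\<lambda>w. ((P w / (w - z)) / (qf_at Q0 w / (w - z))) ^ 3 + G w * P w ^ 3) \<midarrow>z\<rightarrow> (P' / Q') ^ 3 + G z * 0 ^ 3"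
    by (intro tendsto_intros 1 2 3)
  moreover have "\<forall>\<^sub>F w in at z. ((P w / (w - z)) / (qf_at Q0 w / (w - z))) ^ 3 + G w * P w ^ 3 = g w"
  proof -
    have "\<forall>\<^sub>F w in at z. w \<in> ball z \<epsilon> - {z}"
      unfolding eventually_at using *(1) by (auto simp: dist_commute)
    then show ?thesis
    proof eventually_elim
      case (elim w)
      then show ?case using *(4)[OF elim] by simp
    qed
  qed
  ultimately show "g \<midarrow>z\<rightarrow> (P' / Q') ^ 3"
    using Lim_transform_eventually by fastforce
  have "isCont g z"
    using assms(4) open_upper_half_plane z
    by (metis continuous_on_eq_continuous_at holomorphic_on_imp_continuous_on mem_Collect_eq)
  then show "g \<midarrow>z\<rightarrow> g z" by (simp add: isCont_def)
qed simp

end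

text \<open>The power series of \<open>form_b\<close> with its zero at the cusp divided out; it
  makes the leading q-coefficients visible.\<close>

definition qv :: "complex \<Rightarrow> complex" where
  "qv q = euler_fun (q\<^sup>2) ^ 16 / euler_fun q ^ 8"

lemma qb_eq: "qb q = q * qv q"
  by (simp add: qb_def qv_def)

lemma qv_0 [simp]: "qv 0 = 1"
  by (simp add: qv_def)

lemma qv_holomorphic: "qv holomorphic_on ball 0 1"
proof -
  have sq: "q\<^sup>2 \<in> ball 0 1" if "q \<in> ball 0 1" for q :: complex
    using that by (simp add: norm_power power_less_one_iff abs_square_less_1)
  have h: "(\<lambda>q. q\<^sup>2) holomorphic_on ball (0::complex) 1" "(\<lambda>q. q\<^sup>2) ` ball (0::complex) 1 \<subseteq> ball 0 1"
    using sq by (auto intro!: holomorphic_intros)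
  have "(\<lambda>q. euler_fun (q\<^sup>2)) holomorphic_on ball 0 1"
    using holomorphic_on_compose_gen[OF h(1) euler_fun_holomorphic h(2)] by (simp add: o_def)
  then show ?thesis
    unfolding qv_def
    by (intro holomorphic_intros euler_fun_holomorphic) (use euler_fun_nonzero in auto)
qed

section \<open>The forms of discriminant -4\<close>

interpretation disc4: level2 "-4" 2
  by unfold_locales (auto simp: cong_def)

lemma forms4_roots_at_elliptic_point:
  assumes "(a, b, c) \<in> level2_forms (-4) 2" "qf_at (a, b, c) (Complex (-1/2) (1/2)) = 0"
  shows "(a, b, c) = (2, 2, 1)"
proof -
  let ?z = "Complex (-1/2) (1/2)"
  have z2: "?z\<^sup>2 = Complex 0 (-1/2)" by (simp add: power2_eq_square complex_eq_iff)
  have "of_int a * Complex 0 (-1/2) + of_int b * ?z + of_int c = 0"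
    using assms(2) by (simp only: qf_at_eq z2)
  then have "real_of_int b = real_of_int a" "2 * real_of_int c = real_of_int b"
    by (simp_all add: complex_eq_iff)
  then have "b = a" "b = 2 * c" by linarith+
  moreover have "a > 0" "b\<^sup>2 - 4 * a * c = -4" using assms(1) by (auto simp: disc4.forms_iff)
  ultimately have "c > 0" "c * c = 1" by (auto simp: power2_eq_square)
  then have "c = 1" by (auto simp: zmult_eq_1_iff)
  with \<open>b = a\<close> \<open>b = 2 * c\<close> show ?thesis by simp
qed

text \<open>The point z = (-1 + i)/2 satisfies -1/(2 z) = z + 1, so J(z) = -2 z^2 J(z) = i
  J(z).\<close>

lemma J_fun_elliptic_point: "J_fun (Complex (-1/2) (1/2)) = 0"
proof -
  let ?z = "Complex (-1/2) (1/2)"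
  have z2: "?z\<^sup>2 = Complex 0 (-1/2)" by (simp add: power2_eq_square complex_eq_iff)
  have "- 1 / (2 * ?z) = ?z + 1"
  proof -
    have "(?z + 1) * (2 * ?z) = - 1" by (simp add: complex_eq_iff)
    moreover have "?z \<noteq> 0" by (simp add: complex_eq_iff)
    ultimately show ?thesis by (metis divide_eq_eq mult_eq_0_iff zero_neq_numeral)
  qed
  then have "J_fun ?z = - 2 * ?z\<^sup>2 * J_fun ?z"
    using J_fun_fricke[of ?z] by simp
  also have "- 2 * ?z\<^sup>2 = \<i>" unfolding z2 by (simp add: complex_eq_iff)
  finally have "(1 - \<i>) * J_fun ?z = 0" by (simp add: algebra_simps)
  then show ?thesis by (simp add: complex_eq_iff)
qed

text \<open>Reduction leaves [2, 2, 1] and [2, -2, 1], whose roots (-1 + i)/2 and (1 + i)/2 differ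
  by a translation.\<close>

lemma J_fun_zero_at_roots4:
  assumes "Im \<tau> > 0" "\<tau> \<in> form_roots (-4) 2"
  shows "J_fun \<tau> = 0"
proof (rule disc4.root_induct[where P = "\<lambda>\<tau>. J_fun \<tau> = 0", OF _ _ _ assms(2,1)])
  fix b c :: int and \<tau> :: complex
  assume *: "(2, b, c) \<in> level2_forms (-4) 2" "\<bar>b\<bar> \<le> 2" "Im \<tau> > 0" "qf_at (2, b, c) \<tau> = 0"
  have "b = -2 \<or> b = -1 \<or> b = 0 \<or> b = 1 \<or> b = 2" using *(2) by linarith
  moreover have "[b = 2] (mod 4)" "b\<^sup>2 - 8 * c = -4" using *(1) by (auto simp: disc4.forms_iff)
  ultimately have bc: "(b = 2 \<or> b = -2) \<and> c = 1" by (auto simp: cong_def)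
  have "(2 * \<tau> + of_int b / 2)\<^sup>2 - \<i>\<^sup>2 = 2 * qf_at (2, b, c) \<tau>"
    using bc by (auto simp: power2_eq_square algebra_simps)
  then have "(2 * \<tau> + of_int b / 2)\<^sup>2 = \<i>\<^sup>2" by (simp only: *(4) mult_zero_right right_minus_eq)
  then have "2 * \<tau> + of_int b / 2 = \<i> \<or> 2 * \<tau> + of_int b / 2 = - \<i>"
    by (simp only: power2_eq_iff)
  then have "Im (2 * \<tau> + of_int b / 2) = 1 \<and> Re (2 * \<tau> + of_int b / 2) = 0"
    using *(3) by (auto simp: complex_eq_iff)
  then have "\<tau> = Complex (-1/2) (1/2) \<or> \<tau> = Complex (-1/2) (1/2) + 1"
    using bc by (auto simp: complex_eq_iff)
  then show "J_fun \<tau> = 0" using J_fun_elliptic_point by auto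
next
  fix \<tau> :: complex assume \<tau>: "Im \<tau> > 0" "J_fun (- 1 / (2 * \<tau>)) = 0"
  then show "J_fun \<tau> = 0" unfolding J_fun_fricke[OF \<tau>(1)] by auto
qed auto

text \<open>With k = 6 the criterion asks for order 2. The sum vanishes at the cusp, so subtracting
  one multiple of a b (a - 64 b), which has sign -1 and q-coefficient 1, reaches it.\<close>

lemma weight_12_identity:
  obtains \<beta> g where "g holomorphic_on {\<tau>. Im \<tau> > 0}"
    "\<And>\<tau>. Im \<tau> > 0 \<Longrightarrow> \<tau> \<notin> form_roots (-4) 2 \<Longrightarrow> g \<tau> = form_sum (-4) 2 \<tau> * J_fun \<tau> ^ 3"
    "\<And>\<tau>. Im \<tau> > 0 \<Longrightarrow> g \<tau> = \<beta> * form_a \<tau> * form_b \<tau> * (form_a \<tau> - 64 * form_b \<tau>)"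
proof -
  have W: "J_fun (- 1 / (2 * \<tau>)) = - ((2 * \<tau>\<^sup>2) ^ 1 * J_fun \<tau>)" if "Im \<tau> > 0" for \<tau>
    unfolding J_fun_fricke[OF that] by simp
  obtain g where g: "g holomorphic_on {\<tau>. Im \<tau> > 0}"
    "\<And>\<tau>. Im \<tau> > 0 \<Longrightarrow> \<tau> \<notin> form_roots (-4) 2 \<Longrightarrow> g \<tau> = form_sum (-4) 2 \<tau> * J_fun \<tau> ^ 3"
    "\<And>\<tau>. Im \<tau> > 0 \<Longrightarrow> g (\<tau> + 1) = g \<tau>"
    "\<And>\<tau>. Im \<tau> > 0 \<Longrightarrow> g (- 1 / (2 * \<tau>)) = - ((2 * \<tau>\<^sup>2) ^ (3 * 1 + 3) * g \<tau>)"
    by (rule disc4.pole_clearing_invariant[where k = 1, OF forms_holomorphic(1)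
          J_fun_zero_at_roots4 forms_shift(1) W]) (assumption | rule that)+
  obtain h \<rho> where h: "\<rho> > 0" "h holomorphic_on ball 0 \<rho>" "h 0 = 0"
    "\<And>\<tau>. nome \<tau> \<in> ball 0 \<rho> \<Longrightarrow> Im \<tau> > 1 \<Longrightarrow> form_sum (-4) 2 \<tau> = h (nome \<tau>)"
    by (rule disc4.form_sum_q_expansion) (rule that)
  define \<sigma> where "\<sigma> = min \<rho> 1"
  have \<sigma>: "\<sigma> > 0" "ball 0 \<sigma> \<subseteq> ball (0::complex) \<rho>" "ball 0 \<sigma> \<subseteq> ball (0::complex) 1"
    using h(1) by (auto simp: \<sigma>_def)
  have q: "f holomorphic_on ball 0 \<sigma>" if "f holomorphic_on ball 0 1" for f :: "complex \<Rightarrow> complex"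
    using that \<sigma>(3) by (rule holomorphic_on_subset)
  obtain k where k: "k holomorphic_on ball 0 \<sigma>" "\<And>q. q \<in> ball 0 \<sigma> \<Longrightarrow> h q = q * k q"
    using holomorphic_factor_zero_at_0[OF holomorphic_on_subset[OF h(2) \<sigma>(2)] \<sigma>(1) h(3)] by blast
  \<comment> \<open>The coefficient of q in the sum over forms, unknown until the pole is
    examined.\<close>
  define \<beta> where "\<beta> = k 0"
  define m where "m = (\<lambda>q. k q * qJ q ^ 3 - \<beta> * qa q * qv q * (qa q - 64 * qb q))"
  have m: "m holomorphic_on ball 0 \<sigma>" "m 0 = 0"
    by (auto simp: m_def \<beta>_def intro!: holomorphic_intros k q[OF q_holomorphic(2)] q[OF q_holomorphic(4)]
        q[OF q_holomorphic(5)] q[OF qv_holomorphic])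
  obtain m' where m': "m' holomorphic_on ball 0 \<sigma>" "\<And>q. q \<in> ball 0 \<sigma> \<Longrightarrow> m q = q * m' q"
    using holomorphic_factor_zero_at_0[OF m(1) \<sigma>(1) m(2)] by blast
  define R where "R = (\<lambda>\<tau>. \<beta> * form_a \<tau> * form_b \<tau> * (form_a \<tau> - 64 * form_b \<tau>))"
  have "g \<tau> - R \<tau> = 0" if "Im \<tau> > 0" for \<tau>
  proof (rule weight_vanishing[where f = "\<lambda>\<tau>. g \<tau> - R \<tau>" and h = m' and r = \<sigma> and m = 2 and k = 6 and Y = 1])
    show "(\<lambda>\<tau>. g \<tau> - R \<tau>) holomorphic_on {\<tau>. Im \<tau> > 0}"
      unfolding R_def by (intro holomorphic_intros g forms_holomorphic)
    show "g (\<tau> + 1) - R (\<tau> + 1) = g \<tau> - R \<tau>" if "Im \<tau> > 0" for \<tau>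
      using g(3)[OF that] by (simp add: R_def)
    show "norm (g (- 1 / (2 * \<tau>)) - R (- 1 / (2 * \<tau>))) = norm (2 * \<tau>\<^sup>2) ^ 6 * norm (g \<tau> - R \<tau>)"
      if "Im \<tau> > 0" for \<tau>
    proof -
      have "R (- 1 / (2 * \<tau>)) = - ((2 * \<tau>\<^sup>2) ^ 6 * R \<tau>)"
        unfolding R_def form_a_fricke[OF that] form_b_fricke[OF that]
        by (simp add: algebra_simps eval_nat_numeral)
      then have "g (- 1 / (2 * \<tau>)) - R (- 1 / (2 * \<tau>)) = - ((2 * \<tau>\<^sup>2) ^ 6 * (g \<tau> - R \<tau>))"
        using g(4)[OF that] by (simp add: algebra_simps)
      then show ?thesis by (simp only: norm_minus_cancel norm_mult norm_power)
    qed
    show "g \<tau> - R \<tau> = nome \<tau> ^ 2 * m' (nome \<tau>)" if "Im \<tau> > 1" "nome \<tau> \<in> ball 0 \<sigma>" for \<tau>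
    proof -
      have "\<tau> \<notin> form_roots (-4) 2" using disc4.root_Im_le_1 that by force
      then have "g \<tau> = h (nome \<tau>) * J_fun \<tau> ^ 3" using g(2) h(4) that \<sigma>(2) by auto
      then have "g \<tau> - R \<tau> = nome \<tau> * m (nome \<tau>)"
        using k(2)[OF that(2)] by (simp add: m_def R_def q_expansions qb_eq algebra_simps)
      then show ?thesis using m'(2)[OF that(2)] by (simp add: power2_eq_square)
    qed
  qed (use that \<sigma> m' in auto)
  then show ?thesis using g that[of g \<beta>] by (simp add: R_def)
qed

lemma form_sum4:
  assumes "Im \<tau> > 0" "\<tau> \<notin> form_roots (-4) 2"
  shows "form_sum (-4) 2 \<tau> * J_fun \<tau> ^ 3
           = 4 * of_real pi ^ 3 * form_a \<tau> * form_b \<tau> * (form_a \<tau> - 64 * form_b \<tau>)"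
    and "J_fun \<tau> \<noteq> 0"
proof -
  obtain \<beta> g where g: "g holomorphic_on {\<tau>. Im \<tau> > 0}"
    "\<And>\<tau>. Im \<tau> > 0 \<Longrightarrow> \<tau> \<notin> form_roots (-4) 2 \<Longrightarrow> g \<tau> = form_sum (-4) 2 \<tau> * J_fun \<tau> ^ 3"
    "\<And>\<tau>. Im \<tau> > 0 \<Longrightarrow> g \<tau> = \<beta> * form_a \<tau> * form_b \<tau> * (form_a \<tau> - 64 * form_b \<tau>)"
    by (rule weight_12_identity) (rule that)
  define z where "z = Complex (-1/2) (1/2)"
  have z: "Im z > 0" by (simp add: z_def)
  have Jz: "J_fun z = 0" by (simp add: z_def J_fun_elliptic_point del: divide_minus_left)
  have a: "form_a z \<noteq> 0" by (rule form_ab_nonzero) (rule z)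
  have b: "form_b z = - form_a z / 64"
    using J_squared[OF z] unfolding Jz by (simp add: field_simps eq_neg_iff_add_eq_0)
  have "qf_at (2, 2, 1) z = 0" by (simp add: z_def power2_eq_square complex_eq_iff)
  moreover have "(2, 2, 1) \<in> level2_forms (-4) 2" by (simp add: disc4.forms_iff)
  ultimately have Q: "{Q \<in> level2_forms (-4) 2. qf_at Q z = 0} = {(2, 2, 1)}"
    using forms4_roots_at_elliptic_point unfolding z_def by (auto simp del: qf_at_eq)
  \<comment> \<open>As J vanishes at z, the term with E drops out, and a + 64 b = 0 turns a - 64 b
    into 2 a.\<close>
  have J': "(J_fun has_field_derivative - of_real pi * \<i> * form_a z) (at z)"
    by (rule DERIV_cong[OF deriv_J_fun[OF z]]) (simp add: Jz b)
  have "(qf_at (2, 2, 1) has_field_derivative 4 * z + 2) (at z)"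
    unfolding qf_at_eq[abs_def] by (auto intro!: derivative_eq_intros)
  moreover have "4 * z + 2 = 2 * \<i>" by (simp add: z_def complex_eq_iff)
  ultimately have Q': "(qf_at (2, 2, 1) has_field_derivative 2 * \<i>) (at z)" by simp
  have "g z = (- of_real pi * \<i> * form_a z / (2 * \<i>)) ^ 3"
    by (rule disc4.clearing_value[OF z Q g(2,1) J' Jz Q']) auto
  also have "- of_real pi * \<i> * form_a z / (2 * \<i>) = - (of_real pi * form_a z / 2)"
    by (simp add: field_simps)
  also have "(- (of_real pi * form_a z / 2)) ^ 3 = - (of_real pi ^ 3) * form_a z ^ 3 / 8"
    by (simp add: power3_eq_cube)
  finally have "\<beta> * form_a z * form_b z * (form_a z - 64 * form_b z) = - (of_real pi ^ 3) * form_a z ^ 3 / 8"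
    using g(3)[OF z] by simp
  then have "form_a z ^ 3 * \<beta> = form_a z ^ 3 * (4 * of_real pi ^ 3)"
    unfolding b by (simp add: field_simps power3_eq_cube)
  then have \<beta>: "\<beta> = 4 * of_real pi ^ 3" using a by simp
  show eq: "form_sum (-4) 2 \<tau> * J_fun \<tau> ^ 3
           = 4 * of_real pi ^ 3 * form_a \<tau> * form_b \<tau> * (form_a \<tau> - 64 * form_b \<tau>)"
    using g(2)[OF assms] g(3)[OF assms(1)] by (simp add: \<beta>)
  \<comment> \<open>A zero of J off the roots would make the left side 0, while a = -64 b makes the
    right side a nonzero multiple of a b^2.\<close>
  show "J_fun \<tau> \<noteq> 0"
  proof
    assume J: "J_fun \<tau> = 0"
    have "form_a \<tau> = - 64 * form_b \<tau>"
      using J_squared[OF assms(1)] unfolding J by (simp add: eq_neg_iff_add_eq_0)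
    with eq J form_ab_nonzero[OF assms(1)] show False by simp
  qed
qed


section \<open>The forms of discriminant -8\<close>

interpretation disc8: level2 "-8" 0
  by unfold_locales (auto simp: cong_def)

definition form_B :: "complex \<Rightarrow> complex" where
  "form_B \<tau> = form_a \<tau> - 64 * form_b \<tau>"

lemma form_B_holomorphic: "form_B holomorphic_on {\<tau>. Im \<tau> > 0}"
  unfolding form_B_def[abs_def] by (intro holomorphic_intros forms_holomorphic)

lemma form_B_fricke:
  assumes "Im \<tau> > 0"
  shows "form_B (- 1 / (2 * \<tau>)) = - ((2 * \<tau>\<^sup>2) ^ 2 * form_B \<tau>)"
  unfolding form_B_def form_a_fricke[OF assms] form_b_fricke[OF assms]
  by (simp add: algebra_simps power_mult_distrib flip: power_mult)

lemma form_B_shift: "form_B (\<tau> + 1) = form_B \<tau>"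
  by (simp add: form_B_def)

lemma fricke_fixed_point:
  assumes "2 * \<tau>\<^sup>2 = (-1 :: complex)"
  shows "- 1 / (2 * \<tau>) = \<tau>"
proof -
  have "\<tau> \<noteq> 0" "\<tau> * (2 * \<tau>) = - 1" using assms by (auto simp: power2_eq_square algebra_simps)
  then show ?thesis by (metis divide_eq_eq mult_eq_0_iff zero_neq_numeral)
qed

lemma form_B_fixed_point:
  assumes "2 * \<tau>\<^sup>2 = -1" "Im \<tau> > 0"
  shows "form_B \<tau> = 0"
  using form_B_fricke[OF assms(2)] unfolding fricke_fixed_point[OF assms(1)] assms(1)
  by simp

text \<open>Only [2, 0, 1] is reduced, as 4 divides b and \<bar>b\<bar> \<le> 2. Its root z = i/sqrt
  2 is fixed by the involution, and there (2 z^2)^2 = 1 together with the sign -1 forces B to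
  vanish.\<close>

lemma form_B_zero_at_roots:
  assumes "Im \<tau> > 0" "\<tau> \<in> form_roots (-8) 0"
  shows "form_B \<tau> = 0"
proof (rule disc8.root_induct[where P = "\<lambda>\<tau>. form_B \<tau> = 0", OF _ _ _ assms(2,1)])
  fix b c :: int and \<tau> :: complex
  assume *: "(2, b, c) \<in> level2_forms (-8) 0" "\<bar>b\<bar> \<le> 2" "Im \<tau> > 0" "qf_at (2, b, c) \<tau> = 0"
  have "b = -2 \<or> b = -1 \<or> b = 0 \<or> b = 1 \<or> b = 2" using *(2) by linarith
  moreover have "[b = 0] (mod 4)" "b\<^sup>2 - 8 * c = -8" using *(1) by (auto simp: disc8.forms_iff)
  ultimately have "b = 0 \<and> c = 1" by (auto simp: cong_def)
  then have "2 * \<tau>\<^sup>2 = -1" using *(4) by (simp add: eq_neg_iff_add_eq_0)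
  then show "form_B \<tau> = 0" using *(3) by (rule form_B_fixed_point)
next
  fix \<tau> :: complex assume \<tau>: "Im \<tau> > 0" "form_B (- 1 / (2 * \<tau>)) = 0"
  then show "form_B \<tau> = 0" unfolding form_B_fricke[OF \<tau>(1)] by auto
qed (auto simp: form_B_shift)

lemma forms8_roots_at_fixed_point:
  assumes "(a, b, c) \<in> level2_forms (-8) 0" "qf_at (a, b, c) z = 0" "2 * z\<^sup>2 = -1" "Im z > 0"
  shows "(a, b, c) = (2, 0, 1)"
proof -
  have "Re (2 * z\<^sup>2) = -1" "Im (2 * z\<^sup>2) = 0" by (simp_all only: assms(3)) simp_all
  then have re: "Re z = 0" "Re (z\<^sup>2) = - 1 / 2" "Im (z\<^sup>2) = 0" using assms(4) by (auto simp: power2_eq_square)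
  have "Im (qf_at (a, b, c) z) = 0" "Re (qf_at (a, b, c) z) = 0" using assms(2) by simp_all
  then have "real_of_int b * Im z = 0" "2 * real_of_int c = real_of_int a"
    using re by simp_all
  then have "b = 0" "a = 2 * c" using assms(4) by (simp, linarith)
  moreover have "a > 0" "b\<^sup>2 - 4 * a * c = -8" using assms(1) by (auto simp: disc8.forms_iff)
  ultimately have "c > 0" "c * c = 1" by (auto simp: power2_eq_square)
  then have "c = 1" by (auto simp: zmult_eq_1_iff)
  with \<open>b = 0\<close> \<open>a = 2 * c\<close> show ?thesis by simp
qed

text \<open>With k = 9 the criterion asks for order 3. The forms a b J^5 and a^2 b^2 J have orders 1
  and 2 at the cusp with leading coefficient 1, so two successive subtractions reach it; odd powers
  of J give them the required sign -1.\<close>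

lemma weight_18_identity:
  obtains \<alpha> \<beta> g where "g holomorphic_on {\<tau>. Im \<tau> > 0}"
    "\<And>\<tau>. Im \<tau> > 0 \<Longrightarrow> \<tau> \<notin> form_roots (-8) 0 \<Longrightarrow> g \<tau> = form_sum (-8) 0 \<tau> * form_B \<tau> ^ 3"
    "\<And>\<tau>. Im \<tau> > 0 \<Longrightarrow> g \<tau> = J_fun \<tau> * (form_a \<tau> * form_b \<tau>)
        * (\<alpha> * J_fun \<tau> ^ 4 + \<beta> * (form_a \<tau> * form_b \<tau>))"
proof -
  obtain g where g: "g holomorphic_on {\<tau>. Im \<tau> > 0}"
    "\<And>\<tau>. Im \<tau> > 0 \<Longrightarrow> \<tau> \<notin> form_roots (-8) 0 \<Longrightarrow> g \<tau> = form_sum (-8) 0 \<tau> * form_B \<tau> ^ 3"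
    "\<And>\<tau>. Im \<tau> > 0 \<Longrightarrow> g (\<tau> + 1) = g \<tau>"
    "\<And>\<tau>. Im \<tau> > 0 \<Longrightarrow> g (- 1 / (2 * \<tau>)) = - ((2 * \<tau>\<^sup>2) ^ (3 * 2 + 3) * g \<tau>)"
    by (rule disc8.pole_clearing_invariant[where k = 2, OF form_B_holomorphic
          form_B_zero_at_roots form_B_shift form_B_fricke]) (assumption | rule that)+
  obtain h \<rho> where h: "\<rho> > 0" "h holomorphic_on ball 0 \<rho>" "h 0 = 0"
    "\<And>\<tau>. nome \<tau> \<in> ball 0 \<rho> \<Longrightarrow> Im \<tau> > 1 \<Longrightarrow> form_sum (-8) 0 \<tau> = h (nome \<tau>)"
    by (rule disc8.form_sum_q_expansion) (rule that)
  define \<sigma> where "\<sigma> = min \<rho> 1"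
  have \<sigma>: "\<sigma> > 0" "ball 0 \<sigma> \<subseteq> ball (0::complex) \<rho>" "ball 0 \<sigma> \<subseteq> ball (0::complex) 1"
    using h(1) by (auto simp: \<sigma>_def)
  have q: "f holomorphic_on ball 0 \<sigma>" if "f holomorphic_on ball 0 1" for f :: "complex \<Rightarrow> complex"
    using that \<sigma>(3) by (rule holomorphic_on_subset)
  note q_hol = q[OF q_holomorphic(2)] q[OF q_holomorphic(4)] q[OF q_holomorphic(5)] q[OF qv_holomorphic]
  obtain k where k: "k holomorphic_on ball 0 \<sigma>" "\<And>q. q \<in> ball 0 \<sigma> \<Longrightarrow> h q = q * k q"
    using holomorphic_factor_zero_at_0[OF holomorphic_on_subset[OF h(2) \<sigma>(2)] \<sigma>(1) h(3)] by blast
  \<comment> \<open>\<open>\<alpha>\<close> is the coefficient of q in the sum over forms, and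
    \<open>\<beta>\<close> below is the coefficient of q^2 that remains in g after subtracting
    \<open>\<alpha>\<close> a b J^5; both are still unknown.\<close>
  define \<alpha> where "\<alpha> = k 0"
  define u where "u = (\<lambda>q. qa q * qv q)"
  define m1 where "m1 = (\<lambda>q. k q * (qa q - 64 * qb q) ^ 3 - \<alpha> * u q * qJ q ^ 5)"
  have m1: "m1 holomorphic_on ball 0 \<sigma>" "m1 0 = 0"
    by (auto simp: m1_def \<alpha>_def u_def intro!: holomorphic_intros k q_hol)
  obtain k1 where k1: "k1 holomorphic_on ball 0 \<sigma>" "\<And>q. q \<in> ball 0 \<sigma> \<Longrightarrow> m1 q = q * k1 q"
    using holomorphic_factor_zero_at_0[OF m1(1) \<sigma>(1) m1(2)] by blast
  define \<beta> where "\<beta> = k1 0"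
  define m2 where "m2 = (\<lambda>q. k1 q - \<beta> * qJ q * u q ^ 2)"
  have m2: "m2 holomorphic_on ball 0 \<sigma>" "m2 0 = 0"
    by (auto simp: m2_def \<beta>_def u_def intro!: holomorphic_intros k1 q_hol)
  obtain k2 where k2: "k2 holomorphic_on ball 0 \<sigma>" "\<And>q. q \<in> ball 0 \<sigma> \<Longrightarrow> m2 q = q * k2 q"
    using holomorphic_factor_zero_at_0[OF m2(1) \<sigma>(1) m2(2)] by blast
  define R where "R = (\<lambda>\<tau>. J_fun \<tau> * (form_a \<tau> * form_b \<tau>)
        * (\<alpha> * J_fun \<tau> ^ 4 + \<beta> * (form_a \<tau> * form_b \<tau>)))"
  have "g \<tau> - R \<tau> = 0" if "Im \<tau> > 0" for \<tau>
  proof (rule weight_vanishing[where f = "\<lambda>\<tau>. g \<tau> - R \<tau>" and h = k2 and r = \<sigma> and m = 3 and k = 9 and Y = 1])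
    show "(\<lambda>\<tau>. g \<tau> - R \<tau>) holomorphic_on {\<tau>. Im \<tau> > 0}"
      unfolding R_def by (intro holomorphic_intros g forms_holomorphic)
    show "g (\<tau> + 1) - R (\<tau> + 1) = g \<tau> - R \<tau>" if "Im \<tau> > 0" for \<tau>
      using g(3)[OF that] by (simp add: R_def)
    show "norm (g (- 1 / (2 * \<tau>)) - R (- 1 / (2 * \<tau>))) = norm (2 * \<tau>\<^sup>2) ^ 9 * norm (g \<tau> - R \<tau>)"
      if "Im \<tau> > 0" for \<tau>
    proof -
      have ab: "form_a (- 1 / (2 * \<tau>)) * form_b (- 1 / (2 * \<tau>)) = (2 * \<tau>\<^sup>2) ^ 4 * (form_a \<tau> * form_b \<tau>)"
        unfolding form_a_fricke[OF that] form_b_fricke[OF that]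
        by (simp add: power_mult_distrib flip: power_mult power_add)
      have J: "J_fun (- 1 / (2 * \<tau>)) = - ((2 * \<tau>\<^sup>2) * J_fun \<tau>)"
        unfolding J_fun_fricke[OF that] by simp
      have "(- (x * j)) * (x ^ 4 * y) * (\<alpha> * (- (x * j)) ^ 4 + \<beta> * (x ^ 4 * y))
          = - (x ^ 9 * (j * y * (\<alpha> * j ^ 4 + \<beta> * y)))" for x j y
      proof -
        have "x ^ 9 = x * x ^ 4 * x ^ 4" by (simp flip: power_Suc power_add)
        then show ?thesis by (simp add: algebra_simps power_mult_distrib)
      qed
      then have "R (- 1 / (2 * \<tau>)) = - ((2 * \<tau>\<^sup>2) ^ 9 * R \<tau>)"
        unfolding R_def ab J .
      then have "g (- 1 / (2 * \<tau>)) - R (- 1 / (2 * \<tau>)) = - ((2 * \<tau>\<^sup>2) ^ 9 * (g \<tau> - R \<tau>))"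
        using g(4)[OF that] by (simp add: algebra_simps)
      then show ?thesis by (simp only: norm_minus_cancel norm_mult norm_power)
    qed
    show "g \<tau> - R \<tau> = nome \<tau> ^ 3 * k2 (nome \<tau>)" if "Im \<tau> > 1" "nome \<tau> \<in> ball 0 \<sigma>" for \<tau>
    proof -
      have "\<tau> \<notin> form_roots (-8) 0" using disc8.root_Im_le_1 that by force
      then have "g \<tau> = h (nome \<tau>) * form_B \<tau> ^ 3" using g(2) h(4) that \<sigma>(2) by auto
      also have "\<dots> = nome \<tau> * (m1 (nome \<tau>) + \<alpha> * u (nome \<tau>) * qJ (nome \<tau>) ^ 5)"
        using k(2)[OF that(2)] by (simp add: m1_def form_B_def q_expansions)
      also have "\<dots> = nome \<tau> * (nome \<tau> * (m2 (nome \<tau>) + \<beta> * qJ (nome \<tau>) * u (nome \<tau>) ^ 2)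
          + \<alpha> * u (nome \<tau>) * qJ (nome \<tau>) ^ 5)"
        unfolding k1(2)[OF that(2)] by (simp add: m2_def)
      also have "\<dots> = nome \<tau> * (nome \<tau> * (nome \<tau> * k2 (nome \<tau>) + \<beta> * qJ (nome \<tau>) * u (nome \<tau>) ^ 2)
          + \<alpha> * u (nome \<tau>) * qJ (nome \<tau>) ^ 5)"
        unfolding k2(2)[OF that(2)] ..
      also have "\<dots> = nome \<tau> ^ 3 * k2 (nome \<tau>) + R \<tau>"
      proof -
        have j5: "j ^ 5 = j * j ^ 4" for j :: complex by (simp flip: power_Suc)
        show ?thesis unfolding R_def q_expansions qb_eq u_def j5
          by (simp add: algebra_simps power2_eq_square power3_eq_cube)
      qed
      finally show ?thesis by simp
    qed
  qed (use that \<sigma> k2 in auto)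
  then show ?thesis using g that[of g \<alpha> \<beta>] by (simp add: R_def)
qed

section \<open>Power series at the fixed point of the involution\<close>

unbundle no vec_syntax
unbundle fps_syntax

lemma fps_mult_nth_2:
  fixes F G :: "complex fps"
  shows "(F * G) $ 2 = F $ 0 * G $ 2 + F $ 1 * G $ 1 + F $ 2 * G $ 0"
  by (simp add: fps_mult_nth numeral_2_eq_2 add_ac)

lemma fps_deriv_nth_012:
  fixes F :: "complex fps"
  shows "fps_deriv F $ 0 = F $ 1" "fps_deriv F $ 1 = 2 * F $ 2" "fps_deriv F $ 2 = 3 * F $ 3"
  by (simp_all add: numeral_2_eq_2 numeral_3_eq_3)

text \<open>Below \<open>z\<close> is the fixed point \<open>i/\<surd>2\<close> of the involution, \<open>p = \<pi>i\<close> and \<open>j\<close> is the value of \<open>J_fun\<close> at \<open>z\<close>.\<close>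

lemma taylor_coefficients:
  fixes FJ FE FB :: "complex fps" and p z j :: complex
  assumes "fps_deriv FJ = fps_const (p / 2) * (FE * FJ - FB)"
    and "fps_deriv FE = fps_const (p / 4) * (FE * FE - FJ * FJ)"
    and "fps_deriv FB = fps_const p * (FE * FB - FJ * FJ * FJ)"
    and z: "z * z = - 1 / 2"
    and init: "FJ $ 0 = j" "p * FE $ 0 = 4 * z" "FB $ 0 = 0"
  shows "FJ $ 1 = 2 * z * j" "FJ $ 2 = - 3 / 2 * j + 3 / 16 * p\<^sup>2 * j ^ 3"
    "FB $ 1 = - p * j ^ 3" "FB $ 2 = - 5 * p * z * j ^ 3"
    "FB $ 3 = p * j ^ 3 * (15 / 2 - 5 / 48 * p\<^sup>2 * j\<^sup>2)"
proof -
  have zz: "z * (z * x) = - x / 2" for x using z by (simp add: mult.assoc [symmetric])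
  have D: "fps_deriv FJ $ n = (fps_const (p / 2) * (FE * FJ - FB)) $ n"
    "fps_deriv FE $ n = (fps_const (p / 4) * (FE * FE - FJ * FJ)) $ n"
    "fps_deriv FB $ n = (fps_const p * (FE * FB - FJ * FJ * FJ)) $ n" for n
    using assms(1-3) by simp_all
  note mult = fps_mult_nth_0 fps_mult_nth_1 fps_mult_nth_2 fps_mult_left_const_nth fps_sub_nth
  have "FJ $ 1 = (p * FE $ 0) * FJ $ 0 / 2"
    using D(1)[of 0] unfolding fps_deriv_nth_012 mult init(1,3) by simp
  then show J1: "FJ $ 1 = 2 * z * j" unfolding init by simp
  have "FE $ 1 = p / 4 * (FE $ 0 * FE $ 0 - j * j)"
    using D(2)[of 0] unfolding fps_deriv_nth_012 mult init(1,3) by simp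
  \<comment> \<open>The coefficients of \<open>FE\<close> are used only after multiplication by p,
    because E(z) = 4 z / p has p in the denominator.\<close>
  then have "p * FE $ 1 = p * (p / 4 * (FE $ 0 * FE $ 0 - j * j))"
    by (rule arg_cong)
  also have "\<dots> = ((p * FE $ 0) * (p * FE $ 0) - p * p * j * j) / 4"
    by (simp add: algebra_simps)
  also have "(p * FE $ 0) * (p * FE $ 0) = 16 * (z * z)" by (simp only: init) simp
  also have "\<dots> = - 8" by (simp add: z)
  finally have E1: "p * FE $ 1 = - 2 - p * p * j * j / 4" by (simp add: diff_divide_distrib)
  have "FB $ 1 = - (p * (j * j * j))"
    using D(3)[of 0] unfolding fps_deriv_nth_012 mult init(1,3) by simp
  then show B1: "FB $ 1 = - p * j ^ 3" by (simp add: power3_eq_cube)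
  have "2 * FJ $ 2 = p / 2 * (FE $ 0 * FJ $ 1 + FE $ 1 * j - FB $ 1)"
    using D(1)[of 1] unfolding fps_deriv_nth_012 mult init(1,3) by simp
  also have "\<dots> = ((p * FE $ 0) * FJ $ 1 + (p * FE $ 1) * j - p * FB $ 1) / 2"
    by (simp add: algebra_simps)
  finally have "2 * FJ $ 2 = ((p * FE $ 0) * FJ $ 1 + (p * FE $ 1) * j - p * FB $ 1) / 2" .
  then have "2 * FJ $ 2 = 2 * (- 3 / 2 * j + 3 / 16 * p\<^sup>2 * j ^ 3)"
    unfolding init J1 E1 B1 by (simp add: algebra_simps power2_eq_square power3_eq_cube zz)
  then show J2: "FJ $ 2 = - 3 / 2 * j + 3 / 16 * p\<^sup>2 * j ^ 3"
    by (rule mult_left_cancel[THEN iffD1, rotated]) simp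
  have "2 * FB $ 2 = (p * FE $ 0) * FB $ 1 - 3 * p * j * j * FJ $ 1"
    using D(3)[of 1] unfolding fps_deriv_nth_012 mult init(1,3) by (simp add: algebra_simps)
  then have "2 * FB $ 2 = 2 * (- 5 * p * z * j ^ 3)"
    unfolding init J1 B1 by (simp add: algebra_simps power2_eq_square power3_eq_cube zz)
  then show B2: "FB $ 2 = - 5 * p * z * j ^ 3"
    by (rule mult_left_cancel[THEN iffD1, rotated]) simp
  have "3 * FB $ 3 = (p * FE $ 0) * FB $ 2 + (p * FE $ 1) * FB $ 1
      - 3 * p * j * j * FJ $ 2 - 3 * p * j * FJ $ 1 * FJ $ 1"
    using D(3)[of 2] unfolding fps_deriv_nth_012 mult init(1,3) by (simp add: algebra_simps)
  then have "3 * FB $ 3 = 3 * (p * j ^ 3 * (15 / 2 - 5 / 48 * p\<^sup>2 * j\<^sup>2))"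
    unfolding init J1 E1 B1 J2 B2 by (simp add: algebra_simps power2_eq_square power3_eq_cube zz)
  then show "FB $ 3 = p * j ^ 3 * (15 / 2 - 5 / 48 * p\<^sup>2 * j\<^sup>2)"
    by (rule mult_left_cancel[THEN iffD1, rotated]) simp
qed

lemma fps_eq_X_times:
  fixes F :: "complex fps"
  assumes "F $ 0 = 0"
  shows "F = fps_X * fps_shift 1 F"
  using assms by (simp add: fps_eq_iff fps_X_mult_nth)

text \<open>Comparing the coefficients of order 0 and 2 in \<open>H = (B/Q)\<^sup>3 + G B\<^sup>3\<close>, where \<open>Q\<close> vanishes simply,
  determines the two unknown constants; the coefficient of order 1 gives no information by symmetry.\<close>

lemma principal_part_comparison:
  fixes FJ FE FB FG FD FH :: "complex fps" and p z j \<alpha> \<beta> :: complex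
  assumes ode: "fps_deriv FJ = fps_const (p / 2) * (FE * FJ - FB)"
      "fps_deriv FE = fps_const (p / 4) * (FE * FE - FJ * FJ)"
      "fps_deriv FB = fps_const p * (FE * FB - FJ * FJ * FJ)"
    and p: "p \<noteq> 0" and z: "z * z = - 1 / 2" and j: "j \<noteq> 0"
    and init: "FJ $ 0 = j" "p * FE $ 0 = 4 * z" "FB $ 0 = 0"
    and FD: "fps_const 256 * FD = FJ * FJ * (FJ * FJ) - FB * FB"
    and FH: "FH = FJ * FD * (fps_const \<alpha> * (FJ * FJ * (FJ * FJ)) + fps_const \<beta> * FD)"
    and Q: "FH * FQ ^ 3 = FB ^ 3 + FG * FB ^ 3 * FQ ^ 3"
    and FQ: "FQ = fps_const (4 * z) * fps_X + fps_const 2 * fps_X ^ 2"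
  shows "\<alpha> = - 10 * p ^ 3 * z \<and> \<beta> = - 1536 * p ^ 3 * z"
proof -
  have zz: "z * (z * x) = - x / 2" for x using z by (simp add: mult.assoc [symmetric])
  note coef = taylor_coefficients[OF ode z init]
  note mult = fps_mult_nth_0 fps_mult_nth_1 fps_mult_nth_2 fps_mult_left_const_nth fps_sub_nth fps_add_nth
  define R where "R = fps_shift 1 FB"
  define S :: "complex fps" where "S = fps_const (4 * z) + fps_const 2 * fps_X"
  have FB: "FB = fps_X * R" unfolding R_def by (rule fps_eq_X_times) (rule init)
  have FQ': "FQ = fps_X * S" by (simp add: FQ S_def algebra_simps power2_eq_square)
  have "fps_X ^ 3 * (FH * S ^ 3) = fps_X ^ 3 * (R ^ 3 + fps_X ^ 3 * (FG * R ^ 3 * S ^ 3))"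
    using Q unfolding FB FQ' by (simp add: power_mult_distrib algebra_simps)
  \<comment> \<open>A factor X^3 cancels on both sides; the unknown remainder \<open>FG\<close> then
    enters only from order 3 on, and the three lowest coefficients do not see it.\<close>
  then have eq: "FH * S ^ 3 = R ^ 3 + fps_X ^ 3 * (FG * R ^ 3 * S ^ 3)"
    by simp
  have eqn: "(FH * (S * (S * S))) $ n = (R * (R * R)) $ n" if "n < 3" for n
  proof -
    have "(fps_X ^ 3 * (FG * R ^ 3 * S ^ 3)) $ n = 0"
      using that by (simp only: fps_X_power_mult_nth if_True)
    then have "(FH * S ^ 3) $ n = (R ^ 3) $ n" by (simp only: eq fps_add_nth add_0_right)
    then show ?thesis by (simp only: power3_eq_cube mult.assoc)
  qed
  have R: "R $ 0 = - p * j ^ 3" "R $ 1 = - 5 * p * z * j ^ 3"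
    "R $ 2 = p * j ^ 3 * (15 / 2 - 5 / 48 * p\<^sup>2 * j\<^sup>2)"
  proof -
    have "R $ 0 = FB $ 1" "R $ 1 = FB $ 2" "R $ 2 = FB $ 3"
      by (simp_all add: R_def numeral_2_eq_2 numeral_3_eq_3)
    then show "R $ 0 = - p * j ^ 3" "R $ 1 = - 5 * p * z * j ^ 3"
      "R $ 2 = p * j ^ 3 * (15 / 2 - 5 / 48 * p\<^sup>2 * j\<^sup>2)"
      by (simp_all only: coef)
  qed
  have S: "S $ 0 = 4 * z" "S $ 1 = 2" "S $ 2 = 0"
    by (simp_all add: S_def)
  have FD256: "256 * FD $ n = (FJ * FJ * (FJ * FJ) - FB * FB) $ n" for n
    using arg_cong[OF FD, of "\<lambda>F. F $ n"] by simp
  have "256 * FD $ 0 = 256 * (j ^ 4 / 256)"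
    unfolding FD256 mult init by (simp add: eval_nat_numeral)
  then have D0: "FD $ 0 = j ^ 4 / 256"
    by (rule mult_left_cancel[THEN iffD1, rotated]) simp
  have "256 * FD $ 1 = 256 * (j ^ 4 * z / 32)"
    unfolding FD256 mult init coef by (simp add: eval_nat_numeral)
  then have D1: "FD $ 1 = j ^ 4 * z / 32"
    by (rule mult_left_cancel[THEN iffD1, rotated]) simp
  have "256 * FD $ 2 = 256 * (j ^ 4 * (- 18 - p\<^sup>2 * j\<^sup>2 / 4) / 256)"
    unfolding FD256 mult init coef by (simp add: field_simps eval_nat_numeral z zz)
  then have D2: "FD $ 2 = j ^ 4 * (- 18 - p\<^sup>2 * j\<^sup>2 / 4) / 256"
    by (rule mult_left_cancel[THEN iffD1, rotated]) simp
  \<comment> \<open>B vanishes at z, so a b = J^4/256 there, and the lowest coefficient of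
    \<open>FH\<close> depends on the two unknowns only through this combination.\<close>
  define T where "T = \<alpha> + \<beta> / 256"
  have z0: "z \<noteq> 0" using z by auto
  have "32 * j ^ 9 * (z * (256 * \<alpha> + \<beta>)) = 32 * j ^ 9 * (2048 * p ^ 3)"
    using eqn[of 0] unfolding FH mult init coef S R D0
    by (simp add: field_simps eval_nat_numeral z zz)
  then have "z * (256 * \<alpha> + \<beta>) = 2048 * p ^ 3"
    by (rule mult_left_cancel[THEN iffD1, rotated]) (use j in simp)
  then have T: "z * T = 8 * p ^ 3" by (simp add: T_def field_simps)
  have "T = - 2 * (z * (z * T))" by (simp add: zz)
  also have "\<dots> = - 16 * p ^ 3 * z" unfolding T by simp
  finally have T': "T = - 16 * p ^ 3 * z" .
  then have \<beta>: "\<beta> = 256 * (- 16 * p ^ 3 * z - \<alpha>)" by (simp add: T_def field_simps)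
  \<comment> \<open>With T known, the comparison of order 2 separates the two unknowns.\<close>
  have "\<alpha> * z = 5 * p ^ 3"
    using eqn[of 2] j p unfolding FH mult init coef S R D0 D1 D2 \<beta>
    by (simp add: field_simps eval_nat_numeral z zz)
  then have az: "z * \<alpha> = 5 * p ^ 3" by (simp add: mult.commute)
  have "\<alpha> = - 2 * (z * (z * \<alpha>))" by (simp add: zz)
  also have "\<dots> = - 10 * p ^ 3 * z" unfolding az by simp
  finally have \<alpha>: "\<alpha> = - 10 * p ^ 3 * z" .
  moreover have "\<beta> = - 1536 * p ^ 3 * z" unfolding \<beta> \<alpha> by simp
  ultimately show ?thesis ..
qed


text \<open>Since a + 64 b = J^2, the forms a and b enter the derivative only through J and B; thus
  J, E and B satisfy a closed system of differential equations.\<close>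

lemma deriv_form_B:
  assumes "Im \<tau> > 0"
  shows "(form_B has_field_derivative
           of_real pi * \<i> * (E_fun \<tau> * form_B \<tau> - J_fun \<tau> * J_fun \<tau> * J_fun \<tau>)) (at \<tau>)"
proof -
  have "(form_B has_field_derivative of_real pi * \<i> * (E_fun \<tau> - J_fun \<tau>) * form_a \<tau>
      - 64 * (of_real pi * \<i> * (E_fun \<tau> + J_fun \<tau>) * form_b \<tau>)) (at \<tau>)"
    unfolding form_B_def[abs_def]
    by (intro DERIV_diff DERIV_cmult deriv_form_a deriv_form_b assms)
  moreover have "J_fun \<tau> * J_fun \<tau> * J_fun \<tau> = J_fun \<tau> * (form_a \<tau> + 64 * form_b \<tau>)"
    by (simp add: J_squared[OF assms, symmetric] power2_eq_square)
  then have "of_real pi * \<i> * (E_fun \<tau> - J_fun \<tau>) * form_a \<tau>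
      - 64 * (of_real pi * \<i> * (E_fun \<tau> + J_fun \<tau>) * form_b \<tau>)
      = of_real pi * \<i> * (E_fun \<tau> * form_B \<tau> - J_fun \<tau> * J_fun \<tau> * J_fun \<tau>)"
    by (simp add: form_B_def algebra_simps)
  ultimately show ?thesis by (simp only:)
qed

text \<open>This transfers a differential equation to Taylor coefficients; uniqueness of expansions
  identifies the formal derivative with the expansion of the right-hand side.\<close>

lemma fps_expansion_ode:
  assumes f: "f holomorphic_on {\<tau>. Im \<tau> > 0}" and z: "Im z > 0"
    and d: "\<And>\<tau>. Im \<tau> > 0 \<Longrightarrow> (f has_field_derivative g \<tau>) (at \<tau>)"
    and g: "(\<lambda>x. g (z + x)) has_fps_expansion G"
  shows "fps_deriv (fps_expansion f z) = G"
proof -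
  have "f analytic_on {z}"
    using f open_upper_half_plane z by (auto simp: analytic_at)
  then have "(\<lambda>x. f (z + x)) has_fps_expansion fps_expansion f z"
    by (rule analytic_at_imp_has_fps_expansion)
  then have D: "deriv (\<lambda>x. f (z + x)) has_fps_expansion fps_deriv (fps_expansion f z)"
    by (rule has_fps_expansion_deriv)
  have "open {x. Im (z + x) > 0}"
    by (intro open_Collect_less continuous_intros)
  then have "\<forall>\<^sub>F x in nhds 0. x \<in> {x. Im (z + x) > 0}"
    by (rule eventually_nhds_in_open) (use z in simp)
  then have "\<forall>\<^sub>F x in nhds 0. deriv (\<lambda>x. f (z + x)) x = g (z + x)"
  proof eventually_elim
    case (elim x)
    have "((\<lambda>x. f (z + x)) has_field_derivative g (z + x) * 1) (at x)"
      by (rule DERIV_chain2[where f = f and g = "\<lambda>x. z + x"], rule d)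
         (use elim in \<open>auto intro!: derivative_eq_intros\<close>)
    then show ?case by (simp add: DERIV_imp_deriv)
  qed
  then have "deriv (\<lambda>x. f (z + x)) has_fps_expansion G"
    using g by (subst has_fps_expansion_cong[OF _ refl])
  with D show ?thesis by (rule fps_expansion_unique_complex)
qed

lemma has_fps_expansion_upper_half_plane:
  assumes "f holomorphic_on {\<tau>. Im \<tau> > 0}" "Im z > 0"
  shows "(\<lambda>x. f (z + x)) has_fps_expansion fps_expansion f z"
  using assms open_upper_half_plane
  by (intro analytic_at_imp_has_fps_expansion) (auto simp: analytic_at)

lemma form_sum8:
  assumes "Im \<tau> > 0" "\<tau> \<notin> form_roots (-8) 0"
  shows "form_sum (-8) 0 \<tau> * form_B \<tau> ^ 3
           = - (of_real (sqrt 2) * of_real pi ^ 3) * J_fun \<tau> * (form_a \<tau> * form_b \<tau>)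
               * (5 * J_fun \<tau> ^ 4 + 768 * (form_a \<tau> * form_b \<tau>))"
    and "form_B \<tau> \<noteq> 0"
proof -
  obtain \<alpha> \<beta> g where g: "g holomorphic_on {\<tau>. Im \<tau> > 0}"
    "\<And>\<tau>. Im \<tau> > 0 \<Longrightarrow> \<tau> \<notin> form_roots (-8) 0 \<Longrightarrow> g \<tau> = form_sum (-8) 0 \<tau> * form_B \<tau> ^ 3"
    "\<And>\<tau>. Im \<tau> > 0 \<Longrightarrow> g \<tau> = J_fun \<tau> * (form_a \<tau> * form_b \<tau>)
        * (\<alpha> * J_fun \<tau> ^ 4 + \<beta> * (form_a \<tau> * form_b \<tau>))"
    by (rule weight_18_identity) (rule that)
  define z where "z = Complex 0 (sqrt 2 / 2)"
  define p where "p = of_real pi * \<i>"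
  have z: "Im z > 0" by (simp add: z_def)
  have zz: "z * z = - 1 / 2" by (simp add: z_def complex_eq_iff)
  then have z2: "2 * z\<^sup>2 = - 1" by (simp add: power2_eq_square)
  have p0: "p \<noteq> 0" by (simp add: p_def)
  have Bz: "form_B z = 0" by (rule form_B_fixed_point[OF z2 z])
  have Jz: "J_fun z \<noteq> 0"
  proof
    assume "J_fun z = 0"
    then have "form_a z + 64 * form_b z = 0" using J_squared[OF z] by simp
    with Bz have "form_a z = 0" by (simp add: form_B_def)
    with form_ab_nonzero[OF z] show False by simp
  qed
  \<comment> \<open>Because 2 z^2 = -1 at the fixed point, the law of E becomes an equation for E(z)
    alone.\<close>
  have "E_fun z = - E_fun z - 8 * \<i> * z / of_real pi"
    using E_fun_fricke[OF z] unfolding fricke_fixed_point[OF z2] z2 by simp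
  then have Ez: "p * E_fun z = 4 * z"
  proof -
    assume e: "E_fun z = - E_fun z - 8 * \<i> * z / of_real pi"
    have "2 * E_fun z = E_fun z + (- E_fun z - 8 * \<i> * z / of_real pi)"
      unfolding e[symmetric] by simp
    then have "2 * E_fun z = - 8 * \<i> * z / of_real pi" by simp
    then have "p * (2 * E_fun z) = p * (- 8 * \<i> * z / of_real pi)" by (rule arg_cong)
    then have "2 * (p * E_fun z) = p * (- 8 * \<i> * z / of_real pi)" by (simp only: mult.left_commute)
    also have "\<dots> = 2 * (4 * z)" by (simp add: p_def)
    finally show ?thesis by (rule mult_left_cancel[THEN iffD1, rotated]) simp
  qed
  have "{Q \<in> level2_forms (-8) 0. qf_at Q z = 0} = {(2, 0, 1)}"
  proof -
    have "qf_at (2, 0, 1) z = 0" using z2 by simp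
    moreover have "(2, 0, 1) \<in> level2_forms (-8) 0" by (simp add: disc8.forms_iff)
    moreover have "Q = (2, 0, 1)" if Q: "Q \<in> level2_forms (-8) 0" "qf_at Q z = 0" for Q
    proof -
      obtain a b c where abc: "Q = (a, b, c)" by (cases Q)
      show ?thesis unfolding abc
        by (rule forms8_roots_at_fixed_point[OF Q(1)[unfolded abc] Q(2)[unfolded abc] z2 z])
    qed
    ultimately show ?thesis by blast
  qed
  then obtain \<epsilon> G where G: "\<epsilon> > 0" "G holomorphic_on ball z \<epsilon>"
    "\<And>w. w \<in> ball z \<epsilon> - {z} \<Longrightarrow> qf_at (2, 0, 1) w \<noteq> 0"
    "\<And>w. w \<in> ball z \<epsilon> - {z} \<Longrightarrow> g w = (form_B w / qf_at (2, 0, 1) w) ^ 3 + G w * form_B w ^ 3"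
    by (rule disc8.clearing_local[OF z _ g(2)]) (assumption | rule that)+
  define D where "D = (\<lambda>\<tau>. form_a \<tau> * form_b \<tau>)"
  have D: "D holomorphic_on {\<tau>. Im \<tau> > 0}"
    unfolding D_def by (intro holomorphic_intros forms_holomorphic)
  define FJ FE FB FD FG where "FJ = fps_expansion J_fun z" and "FE = fps_expansion E_fun z"
    and "FB = fps_expansion form_B z" and "FD = fps_expansion D z" and "FG = fps_expansion G z"
  have FJ: "(\<lambda>x. J_fun (z + x)) has_fps_expansion FJ"
    and FE: "(\<lambda>x. E_fun (z + x)) has_fps_expansion FE"
    and FB: "(\<lambda>x. form_B (z + x)) has_fps_expansion FB"
    and FD: "(\<lambda>x. D (z + x)) has_fps_expansion FD"
    unfolding FJ_def FE_def FB_def FD_def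
    by (intro has_fps_expansion_upper_half_plane forms_holomorphic form_B_holomorphic D z)+
  have "G analytic_on {z}" using G(1,2) by (auto simp: analytic_at_ball)
  then have FG: "(\<lambda>x. G (z + x)) has_fps_expansion FG"
    unfolding FG_def by (rule analytic_at_imp_has_fps_expansion)
  have "open {x. Im (z + x) > 0}"
    by (intro open_Collect_less continuous_intros)
  then have ev_pos: "\<forall>\<^sub>F x in nhds 0. x \<in> {x. Im (z + x) > 0}"
    by (rule eventually_nhds_in_open) (use z in simp)
  have "\<alpha> = - 10 * p ^ 3 * z \<and> \<beta> = - 1536 * p ^ 3 * z"
  proof (rule principal_part_comparison[where FJ = FJ and FE = FE and FB = FB and FD = FD and FG = FG
        and j = "J_fun z" and FQ = "fps_const (4 * z) * fps_X + fps_const 2 * fps_X ^ 2"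
        and FH = "FJ * FD * (fps_const \<alpha> * (FJ * FJ * (FJ * FJ)) + fps_const \<beta> * FD)"])
    show "fps_deriv FJ = fps_const (p / 2) * (FE * FJ - FB)"
      unfolding FJ_def
    proof (rule fps_expansion_ode[OF forms_holomorphic(1) z deriv_J_fun])
      show "(\<lambda>x. of_real pi * \<i> / 2 * (E_fun (z + x) * J_fun (z + x)
          - (form_a (z + x) - 64 * form_b (z + x)))) has_fps_expansion
          fps_const (p / 2) * (FE * fps_expansion J_fun z - FB)"
        unfolding form_B_def [symmetric] p_def [symmetric] FJ_def [symmetric]
        by (intro fps_expansion_intros FE FJ FB)
    qed
    show "fps_deriv FE = fps_const (p / 4) * (FE * FE - FJ * FJ)"
      unfolding FE_def
    proof (rule fps_expansion_ode[OF forms_holomorphic(2) z deriv_E_fun])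
      show "(\<lambda>x. of_real pi * \<i> / 4 * (E_fun (z + x) ^ 2 - J_fun (z + x) ^ 2)) has_fps_expansion
          fps_const (p / 4) * (fps_expansion E_fun z * fps_expansion E_fun z - FJ * FJ)"
        unfolding power2_eq_square p_def [symmetric] FE_def [symmetric]
        by (intro fps_expansion_intros FE FJ)
    qed
    show "fps_deriv FB = fps_const p * (FE * FB - FJ * FJ * FJ)"
      unfolding FB_def
    proof (rule fps_expansion_ode[OF form_B_holomorphic z deriv_form_B])
      show "(\<lambda>x. of_real pi * \<i> * (E_fun (z + x) * form_B (z + x)
          - J_fun (z + x) * J_fun (z + x) * J_fun (z + x))) has_fps_expansion
          fps_const p * (FE * fps_expansion form_B z - FJ * FJ * FJ)"
        unfolding p_def [symmetric] FB_def [symmetric]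
        by (intro fps_expansion_intros FE FJ FB)
    qed
    \<comment> \<open>J^4 = (a + 64 b)^2 and B^2 = (a - 64 b)^2 express a b through J and B, whose
      Taylor coefficients are known.\<close>
    have eqD: "256 * D \<tau> = J_fun \<tau> * J_fun \<tau> * (J_fun \<tau> * J_fun \<tau>) - form_B \<tau> * form_B \<tau>"
      if "Im \<tau> > 0" for \<tau>
    proof -
      have "J_fun \<tau> * J_fun \<tau> = form_a \<tau> + 64 * form_b \<tau>"
        using J_squared[OF that] by (simp add: power2_eq_square)
      then show ?thesis by (simp add: D_def form_B_def algebra_simps)
    qed
    show "fps_const 256 * FD = FJ * FJ * (FJ * FJ) - FB * FB"
    proof (rule fps_expansion_unique_complex)
      show "(\<lambda>x. 256 * D (z + x)) has_fps_expansion fps_const 256 * FD"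
        by (intro fps_expansion_intros FD)
      have "(\<lambda>x. J_fun (z + x) * J_fun (z + x) * (J_fun (z + x) * J_fun (z + x))
          - form_B (z + x) * form_B (z + x)) has_fps_expansion FJ * FJ * (FJ * FJ) - FB * FB"
        by (intro fps_expansion_intros FJ FB)
      moreover have "\<forall>\<^sub>F x in nhds 0. 256 * D (z + x)
          = J_fun (z + x) * J_fun (z + x) * (J_fun (z + x) * J_fun (z + x)) - form_B (z + x) * form_B (z + x)"
        using ev_pos by eventually_elim (use eqD in simp)
      ultimately show "(\<lambda>x. 256 * D (z + x)) has_fps_expansion FJ * FJ * (FJ * FJ) - FB * FB"
        by (subst has_fps_expansion_cong[OF _ refl])
    qed
    show "FJ * FD * (fps_const \<alpha> * (FJ * FJ * (FJ * FJ)) + fps_const \<beta> * FD)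
        * (fps_const (4 * z) * fps_X + fps_const 2 * fps_X ^ 2) ^ 3
      = FB ^ 3 + FG * FB ^ 3 * (fps_const (4 * z) * fps_X + fps_const 2 * fps_X ^ 2) ^ 3"
    proof (rule fps_expansion_unique_complex)
      let ?L = "\<lambda>x. J_fun (z + x) * D (z + x) * (\<alpha> * (J_fun (z + x) * J_fun (z + x) * (J_fun (z + x) * J_fun (z + x)))
          + \<beta> * D (z + x)) * (4 * z * x + 2 * x ^ 2) ^ 3"
      let ?R = "\<lambda>x. form_B (z + x) ^ 3 + G (z + x) * form_B (z + x) ^ 3 * (4 * z * x + 2 * x ^ 2) ^ 3"
      show "?L has_fps_expansion FJ * FD * (fps_const \<alpha> * (FJ * FJ * (FJ * FJ)) + fps_const \<beta> * FD)
        * (fps_const (4 * z) * fps_X + fps_const 2 * fps_X ^ 2) ^ 3"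
        by (intro fps_expansion_intros FJ FD)
      have R: "?R has_fps_expansion FB ^ 3 + FG * FB ^ 3 * (fps_const (4 * z) * fps_X + fps_const 2 * fps_X ^ 2) ^ 3"
        by (intro fps_expansion_intros FB FG)
      have "\<forall>\<^sub>F x in nhds 0. x \<in> ball 0 \<epsilon>"
        by (rule eventually_nhds_in_open) (use G(1) in auto)
      then have "\<forall>\<^sub>F x in nhds 0. ?L x = ?R x"
        using ev_pos
      proof eventually_elim
        case (elim x)
        \<comment> \<open>The constant term 2 z^2 + 1 vanishes, and the zero at x = 0 is simple
          since z is nonzero.\<close>
        have q: "qf_at (2, 0, 1) (z + x) = 4 * z * x + 2 * x ^ 2"
          using zz by (simp add: power2_eq_square algebra_simps)
        have gx: "g (z + x) = J_fun (z + x) * D (z + x) * (\<alpha> * (J_fun (z + x) * J_fun (z + x) * (J_fun (z + x) * J_fun (z + x)))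
          + \<beta> * D (z + x))"
          using g(3)[of "z + x"] elim by (simp add: D_def eval_nat_numeral mult.assoc)
        show ?case
        proof (cases "x = 0")
          case True
          then show ?thesis by (simp add: Bz)
        next
          case False
          then have w: "z + x \<in> ball z \<epsilon> - {z}" using elim by (simp add: dist_norm)
          have "(B / Q) ^ 3 * Q ^ 3 = B ^ 3" if "Q \<noteq> 0" for B Q :: complex
            using that by (simp add: power_divide)
          then show ?thesis
            using G(3,4)[OF w] unfolding gx [symmetric] q by (simp add: distrib_right)
        qed
      qed
      then show "?L has_fps_expansion FB ^ 3 + FG * FB ^ 3 * (fps_const (4 * z) * fps_X + fps_const 2 * fps_X ^ 2) ^ 3"
        using R by (subst has_fps_expansion_cong[OF _ refl])
    qed
    show "FJ $ 0 = J_fun z" "p * FE $ 0 = 4 * z" "FB $ 0 = 0"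
      using Ez Bz by (simp_all add: FJ_def FE_def FB_def fps_expansion_def)
  qed (fact p0 zz Jz refl)+
  moreover have pz: "p ^ 3 * z = of_real (sqrt 2) * of_real pi ^ 3 / 2"
  proof -
    have "z = of_real (sqrt 2) * \<i> / 2" by (simp add: z_def complex_eq_iff)
    moreover have "(c * \<i>) ^ 3 * (y * \<i> / 2) = y * c ^ 3 / 2" for c y :: complex
    proof -
      have "(c * \<i>) ^ 3 * (y * \<i> / 2) = y * c ^ 3 * (\<i>\<^sup>2 * \<i>\<^sup>2) / 2"
        by (simp only: power_mult_distrib power2_eq_square power3_eq_cube times_divide_eq_right mult_ac)
      then show ?thesis by simp
    qed
    ultimately show ?thesis by (simp only: p_def)
  qed
  have "- 10 * p ^ 3 * z = - 5 * (of_real (sqrt 2) * of_real pi ^ 3)"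
    "- 1536 * p ^ 3 * z = - 768 * (of_real (sqrt 2) * of_real pi ^ 3)"
    by (simp_all only: mult.assoc[of _ "p ^ 3" z] pz) simp_all
  ultimately have ab: "\<alpha> = - 5 * (of_real (sqrt 2) * of_real pi ^ 3)"
    "\<beta> = - 768 * (of_real (sqrt 2) * of_real pi ^ 3)" by simp_all
  show eq: "form_sum (-8) 0 \<tau> * form_B \<tau> ^ 3
           = - (of_real (sqrt 2) * of_real pi ^ 3) * J_fun \<tau> * (form_a \<tau> * form_b \<tau>)
               * (5 * J_fun \<tau> ^ 4 + 768 * (form_a \<tau> * form_b \<tau>))"
    using g(2)[OF assms] g(3)[OF assms(1)] unfolding ab by (simp add: algebra_simps)
  \<comment> \<open>If B vanished off the roots, then a = 64 b and J^2 = 128 b, the last factor on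
    the right would be 131072 b^2, and the right side could not be 0.\<close>
  show "form_B \<tau> \<noteq> 0"
  proof
    assume B: "form_B \<tau> = 0"
    then have a: "form_a \<tau> = 64 * form_b \<tau>" by (simp add: form_B_def)
    have J2: "J_fun \<tau> ^ 2 = 128 * form_b \<tau>" using J_squared[OF assms(1)] by (simp add: a)
    have "J_fun \<tau> ^ 4 = (J_fun \<tau> ^ 2) ^ 2" by (simp flip: power_mult)
    then have J4: "J_fun \<tau> ^ 4 = 16384 * form_b \<tau> ^ 2" by (simp add: J2 power_mult_distrib)
    have "J_fun \<tau> \<noteq> 0" using J2 form_ab_nonzero[OF assms(1)] by auto
    moreover have "5 * J_fun \<tau> ^ 4 + 768 * (form_a \<tau> * form_b \<tau>) = 131072 * form_b \<tau> ^ 2"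
      by (simp add: J4 a power2_eq_square)
    ultimately show False using eq B form_ab_nonzero[OF assms(1)] by simp
  qed
qed

section \<open>Passage to rational functions of t and the two identities\<close>

lemma upper_half_plane_iff: "\<tau> \<in> upper_half_plane \<longleftrightarrow> Im \<tau> > 0"
  by (simp add: upper_half_plane_def)

lemma t_fun_eq: "Im \<tau> > 0 \<Longrightarrow> t_fun \<tau> = form_b \<tau> / form_a \<tau>"
  using form_b_eq[of \<tau>] form_ab_nonzero[of \<tau>] by (simp add: field_simps)

lemma F_form_eq: "F_form d r \<tau> = of_real (\<bar>real_of_int d\<bar> powr (5 / 2) / (4 * pi ^ 3)) * form_sum d r \<tau>"
  by (simp add: F_form_def form_sum_def)

text \<open>Both are even holomorphic: t is b / a with a free of zeros, and the second function
  equals 9 J a.\<close>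

lemma t_J_E6_meromorphic:
  "t_fun meromorphic_on upper_half_plane"
  "(\<lambda>\<tau>. 8 * J_fun \<tau> ^ 3 + Eis6 \<tau>) meromorphic_on upper_half_plane"
proof -
  have t: "t_fun holomorphic_on {\<tau>. Im \<tau> > 0}"
  proof (rule holomorphic_transform)
    show "(\<lambda>\<tau>. form_b \<tau> / form_a \<tau>) holomorphic_on {\<tau>. Im \<tau> > 0}"
      using form_ab_nonzero by (intro holomorphic_intros forms_holomorphic) auto
  qed (use t_fun_eq in auto)
  have JE: "(\<lambda>\<tau>. 8 * J_fun \<tau> ^ 3 + Eis6 \<tau>) holomorphic_on {\<tau>. Im \<tau> > 0}"
  proof (rule holomorphic_transform)
    show "(\<lambda>\<tau>. 9 * J_fun \<tau> * form_a \<tau>) holomorphic_on {\<tau>. Im \<tau> > 0}"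
      by (intro holomorphic_intros forms_holomorphic)
  qed (use numerator_form in auto)
  show "t_fun meromorphic_on upper_half_plane"
    "(\<lambda>\<tau>. 8 * J_fun \<tau> ^ 3 + Eis6 \<tau>) meromorphic_on upper_half_plane"
    unfolding upper_half_plane_def using t JE open_upper_half_plane
    by (auto intro!: analytic_on_imp_meromorphic_on simp: analytic_on_open)
qed

lemma powr_5_2:
  assumes "x \<ge> 0"
  shows "x powr (5 / 2) = x ^ 2 * sqrt x"
proof -
  have "x powr (5 / 2) = x powr 2 * x powr (1 / 2)" by (simp flip: powr_add)
  also have "\<dots> = x ^ 2 * sqrt x" using assms by (cases "x = 0") (simp_all add: powr_half_sqrt)
  finally show ?thesis .
qed

text \<open>The identities are verified after multiplication by B^3, respectively J^3, which have no
  zeros off the roots. At the roots themselves the pointwise values depend on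
  \<open>inverse 0 = 0\<close>.\<close>

theorem theorem5p3:
  shows "(F_form (-8) 0 meromorphic_on upper_half_plane \<and>
          C6a meromorphic_on upper_half_plane \<and>
          (\<forall>\<tau>\<in>upper_half_plane - form_roots (-8) 0. F_form (-8) 0 \<tau> = -64 * C6a \<tau>)) \<and>
         (F_form (-4) 2 meromorphic_on upper_half_plane \<and>
          C6b meromorphic_on upper_half_plane \<and>
          (\<forall>\<tau>\<in>upper_half_plane - form_roots (-4) 2. F_form (-4) 2 \<tau> = 32 * C6b \<tau>))"
proof (intro conjI ballI)
  show "F_form (-8) 0 meromorphic_on upper_half_plane" "F_form (-4) 2 meromorphic_on upper_half_plane"
    unfolding F_form_eq[abs_def] upper_half_plane_def
    by (intro meromorphic_intros disc8.form_sum_meromorphic disc4.form_sum_meromorphic)+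
  show "C6a meromorphic_on upper_half_plane" "C6b meromorphic_on upper_half_plane"
    unfolding C6a_def[abs_def] C6b_def[abs_def] by (intro meromorphic_intros t_J_E6_meromorphic)+
next
  fix \<tau> assume "\<tau> \<in> upper_half_plane - form_roots (-8) 0"
  then have \<tau>: "Im \<tau> > 0" "\<tau> \<notin> form_roots (-8) 0" by (auto simp: upper_half_plane_iff)
  define a b J B where "a = form_a \<tau>" and "b = form_b \<tau>" and "J = J_fun \<tau>" and "B = form_B \<tau>"
  have a0: "a \<noteq> 0" using form_ab_nonzero[OF \<tau>(1)] by (simp add: a_def)
  have B0: "B \<noteq> 0" using form_sum8(2)[OF \<tau>] by (simp add: B_def)
  have Bab: "B = a - 64 * b" by (simp add: B_def a_def b_def form_B_def)
  have "J ^ 4 = (J ^ 2) ^ 2" by (simp flip: power_mult)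
  then have J4: "J ^ 4 = (a + 64 * b) ^ 2"
    using J_squared[OF \<tau>(1)] by (simp add: J_def a_def b_def)
  have t: "t_fun \<tau> = b / a" by (simp add: t_fun_eq \<tau> a_def b_def)
  \<comment> \<open>The denominator of \<open>C6a\<close> becomes a multiple of (B / a)^3, which
    places its poles at the zeros of B.\<close>
  have one: "1 - 64 * t_fun \<tau> = B / a" using a0 by (simp add: t Bab field_simps)
  have "F_form (-8) 0 \<tau> = of_real (32 * sqrt 2 / pi ^ 3) * form_sum (-8) 0 \<tau>"
  proof -
    have "sqrt 8 = sqrt (2 ^ 2 * 2)" by simp
    also have "\<dots> = 2 * sqrt 2" unfolding real_sqrt_mult by simp
    finally have "\<bar>real_of_int (-8)\<bar> powr (5 / 2) / (4 * pi ^ 3) = 32 * sqrt 2 / pi ^ 3"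
      by (simp add: powr_5_2)
    then show ?thesis by (simp only: F_form_eq)
  qed
  then have "F_form (-8) 0 \<tau> * B ^ 3 = of_real (32 * sqrt 2 / pi ^ 3)
      * (- (of_real (sqrt 2) * of_real pi ^ 3) * J * (a * b) * (5 * J ^ 4 + 768 * (a * b)))"
    by (simp only: mult.assoc[of "of_real (32 * sqrt 2 / pi ^ 3)" "form_sum (-8) 0 \<tau>"]
        form_sum8(1)[OF \<tau>] a_def b_def J_def B_def)
  also have "\<dots> = - 64 * (J * (a * b) * (5 * J ^ 4 + 768 * (a * b)))"
  proof -
    have "of_real (sqrt 2) * of_real (sqrt 2) = (2 :: complex)"
      by (simp flip: of_real_mult)
    then have "of_real (32 * sqrt 2 / pi ^ 3) * (of_real (sqrt 2) * of_real pi ^ 3) = (64 :: complex)"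
      by simp
    then show ?thesis by (simp add: mult.assoc [symmetric])
  qed
  \<comment> \<open>5 (a + 64 b)^2 + 768 a b = 5 a^2 + 1408 a b + 20480 b^2, the homogeneous version
    of the quadratic polynomial in t.\<close>
  also have "\<dots> = - 64 * (b * (5 * a ^ 2 + 1408 * a * b + 20480 * b ^ 2) * a * J)"
    unfolding J4 by (simp add: algebra_simps power2_eq_square)
  also have "\<dots> = (- 64 * C6a \<tau>) * B ^ 3"
  proof -
    have "C6a \<tau> = (b / a * (5 + 1408 * (b / a) + 20480 * (b / a) ^ 2)) / (9 * (B / a) ^ 3) * (9 * J * a)"
      unfolding C6a_def numerator_form[OF \<tau>(1)] t
      unfolding one[unfolded t] unfolding J_def a_def ..
    also have "\<dots> = b * (5 * a ^ 2 + 1408 * a * b + 20480 * b ^ 2) * a * J / B ^ 3"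
      using a0 B0 by (simp add: field_simps eval_nat_numeral)
    finally show ?thesis using B0 by simp
  qed
  finally show "F_form (-8) 0 \<tau> = -64 * C6a \<tau>"
    by (rule mult_right_cancel[THEN iffD1, rotated]) (use B0 in simp)
next
  fix \<tau> assume "\<tau> \<in> upper_half_plane - form_roots (-4) 2"
  then have \<tau>: "Im \<tau> > 0" "\<tau> \<notin> form_roots (-4) 2" by (auto simp: upper_half_plane_iff)
  define a b J where "a = form_a \<tau>" and "b = form_b \<tau>" and "J = J_fun \<tau>"
  have a0: "a \<noteq> 0" using form_ab_nonzero[OF \<tau>(1)] by (simp add: a_def)
  have J0: "J \<noteq> 0" using form_sum4(2)[OF \<tau>] by (simp add: J_def)
  have J2: "J ^ 2 = a + 64 * b" using J_squared[OF \<tau>(1)] by (simp add: J_def a_def b_def)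
  have t: "t_fun \<tau> = b / a" by (simp add: t_fun_eq \<tau> a_def b_def)
  \<comment> \<open>The denominator of \<open>C6b\<close> becomes a multiple of (J^2 / a)^2; the
    factor J in the numerator 9 J a reduces J^4 to J^3.\<close>
  have one: "1 + 64 * t_fun \<tau> = J ^ 2 / a" using a0 by (simp add: t J2 field_simps)
  have "F_form (-4) 2 \<tau> = of_real (8 / pi ^ 3) * form_sum (-4) 2 \<tau>"
  proof -
    have "sqrt 4 = (2 :: real)" by simp
    then have "\<bar>real_of_int (-4)\<bar> powr (5 / 2) / (4 * pi ^ 3) = 8 / pi ^ 3"
      by (simp add: powr_5_2)
    then show ?thesis by (simp only: F_form_eq)
  qed
  then have "F_form (-4) 2 \<tau> * J ^ 3 = of_real (8 / pi ^ 3) * (4 * of_real pi ^ 3 * a * b * (a - 64 * b))"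
    by (simp only: mult.assoc[of "of_real (8 / pi ^ 3)" "form_sum (-4) 2 \<tau>"]
        form_sum4(1)[OF \<tau>] a_def b_def J_def)
  also have "\<dots> = 32 * (a * b * (a - 64 * b))" by simp
  also have "\<dots> = 32 * C6b \<tau> * J ^ 3"
  proof -
    have "C6b \<tau> = (b / a * (1 - 64 * (b / a))) / (9 * (J ^ 2 / a) ^ 2) * (9 * J * a)"
      unfolding C6b_def numerator_form[OF \<tau>(1)] t
      unfolding one[unfolded t] unfolding J_def a_def ..
    also have "\<dots> = a * b * (a - 64 * b) / J ^ 3"
      using a0 J0 by (simp add: field_simps eval_nat_numeral)
    finally show ?thesis using J0 by simp
  qed
  finally show "F_form (-4) 2 \<tau> = 32 * C6b \<tau>"
    by (rule mult_right_cancel[THEN iffD1, rotated]) (use J0 in simp)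
qed

end
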